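(* Let $c_0\in\mathcal{M}=G/H$, let $\alpha\colon C^\infty(I,T\mathcal{M})\to C^\infty(I,\mathfrak{g})$ be a smooth map such that $\rho_{c_0}\circ\alpha\circ D=\mathrm{id}_{C^\infty_{c_0}(I,\mathcal{M})}$ and $\alpha\circ D(\mathcal{P}_{c_0})\subseteq C^\infty(I,\mathfrak{g}\setminus\{0\})$, and let $\mathcal{R}\colon\mathcal{P}_{c_0}\to C^\infty(I,\mathfrak{g}\setminus\{0\})$, $\mathcal{R}(c)=\alpha(\dot c)/\sqrt{\|\alpha(\dot c)\|}$. Let $c\in\mathcal{P}_{c_0}$ and $v,w\in T_c\mathcal{P}_{c_0}$ (so $v,w\colon I\to T\mathcal{M}$ are curves with $v(t),w(t)\in T_{c(t)}\mathcal{M}$). Then the pullback $G^{\mathcal{R}}$ of the $L^2$ metric on $C^\infty(I,\mathfrak{g}\setminus\{0\})$ under $\mathcal{R}$ to $\mathcal{P}_{c_0}$ is given by $$G^{\mathcal{R}}_c(v,w)=\int_I \tfrac14\langle D_sv,u_c\rangle\langle D_sw,u_c\rangle+\big\langle D_sv-u_c\langle D_sv,u_c\rangle,\;D_sw-u_c\langle D_sw,u_c\rangle\big\rangle\,ds,$$ where $D_sv:=T_c(\alpha\circ D)(v)/\|\alpha(\dot c)\|$, $u_c:=\alpha(\dot c)/\|\alpha(\dot c)\|$, and $ds=\|\alpha(\dot c(t))\|\,dt$. In particular, the pullback of the $L^2$ norm is given by $$G^{\mathcal{R}}_c(v,v)=\int_I\tfrac14\langle D_sv,u_c\rangle^2+\big\|D_sv-u_c\langle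 D_sv,u_c\rangle\big\|^2\,ds.$$
   Context: $G$ is a finite-dimensional Lie group with identity $e$ and Lie algebra $\mathfrak{g}=T_eG$; $H\subseteq G$ is a closed Lie subgroup; $\mathcal{M}=G/H$ carries the manifold structure making $\pi\colon G\to G/H$, $g\mapsto gH$, a submersion. $\Lambda\colon G\times\mathcal{M}\to\mathcal{M}$, $(g,kH)\mapsto (gk)H$, and $\Lambda_{c_0}(g)=\Lambda(g,c_0)$. $I=[0,1]$. For a manifold $N$, $C^\infty(I,N)$ carries the compact-open $C^\infty$-topology and its usual infinite-dimensional (Fréchet) manifold structure; smoothness is in the sense of Bastiani calculus. $\mathrm{Imm}(I,\mathcal{M})\subseteq C^\infty(I,\mathcal{M})$ is the open subset of curves with nowhere vanishing derivative. $\mathrm{Evol}\colon C^\infty(I,\mathfrak{g})\to\{g\in C^\infty(I,G): g(0)=e\}$ sends $q$ to the solution $g$ of $\dot g(t)=T_eR_{g(t)}(q(t))$, $g(0)=e$, where $R_g$ is right multiplication by $g$. $C^\infty_{c_0}(I,\mathcal{M})=\{c\in C^\infty(I,\mathcal{M}): c(0)=c_0\}$, $\mathcal{P}_{c_0}=\mathrm{Imm}(I,\mathcal{M})\cap C^\infty_{c_0}(I,\mathcal{M})$, $\rho_{c_0}\colon C^\infty(I,\mathfrak{g})\to C^\infty_{c_0}(I,\mathcal{M})$, $\rho_{c_0}(q)(t)=\Lambda_{c_0}(\mathrm{Evol}(q)(t))$, and $D(c)=\dot c$. $\langle\cdot,\cdot\rangle$ is a fixed inner product on $\mathfrak{g}=T_eG$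 (coming from a right invariant Riemannian metric on $G$), $\|\cdot\|$ its norm. The $L^2$ metric on $C^\infty(I,\mathfrak{g})$ is $\langle f,g\rangle_{L^2}=\int_0^1\langle f(t),g(t)\rangle\,dt$, restricted to the open subset $C^\infty(I,\mathfrak{g}\setminus\{0\})$. The pullback metric is $G^{\mathcal{R}}_c(v,w)=\langle T_c\mathcal{R}(v),T_c\mathcal{R}(w)\rangle_{L^2}$. $T_c(\alpha\circ D)(v)\in C^\infty(I,\mathfrak{g})$ denotes the tangent map of $\alpha\circ D|_{\mathcal{P}_{c_0}}$ at $c$ applied to $v$; all operations in the integrand are pointwise in $t$. *)

theory Defs
  imports "HOL-Analysis.Analysis" "HOL-Algebra.Coset"
begin

section \<open>Bastiani calculus\<close>

text \<open>
  The derivatives are taken within \<open>S\<close>. If \<open>S\<close> is open this is the two-sided directional derivative;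
  for relatively open subsets of \<open>[0,1] \<times> E\<close> it is one-sided at boundary points in directions
  transversal to the boundary.
\<close>

definition has_dir_deriv ::
    "'a::real_vector set \<Rightarrow> ('a \<Rightarrow> 'b::{real_vector,topological_space}) \<Rightarrow> 'a \<Rightarrow> 'a \<Rightarrow> 'b \<Rightarrow> bool" where
  "has_dir_deriv S f x v l \<longleftrightarrow>
     ((\<lambda>s. (f (x + s *\<^sub>R v) - f x) /\<^sub>R s) \<longlongrightarrow> l) (at 0 within {s. x + s *\<^sub>R v \<in> S})"

definition dir_deriv ::
    "'a::real_vector set \<Rightarrow> ('a \<Rightarrow> 'b::{real_vector,t2_space}) \<Rightarrow> 'a \<Rightarrow> 'a \<Rightarrow> 'b" where
  "dir_deriv S f x v = Lim (at 0 within {s. x + s *\<^sub>R v \<in> S}) (\<lambda>s. (f (x + s *\<^sub>R v) - f x) /\<^sub>R s)"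

text \<open>\<open>iter_dir_deriv S f k y x\<close> is \<open>d\<^sup>(\<^sup>k\<^sup>) f(x; y 0, \<dots>, y (k-1))\<close>; it ignores \<open>y j\<close> for \<open>j \<ge> k\<close>.\<close>

primrec iter_dir_deriv ::
    "'a::real_vector set \<Rightarrow> ('a \<Rightarrow> 'b::{real_vector,t2_space}) \<Rightarrow> nat \<Rightarrow> (nat \<Rightarrow> 'a) \<Rightarrow> 'a \<Rightarrow> 'b" where
  "iter_dir_deriv S f 0 y = f"
| "iter_dir_deriv S f (Suc k) y = (\<lambda>x. dir_deriv S (iter_dir_deriv S f k y) x (y k))"

text \<open>
  The directions range over \<open>nat \<Rightarrow> 'a\<close> with the product topology. As only the first \<open>k\<close> of them
  matter, the continuity condition is joint continuity on \<open>S \<times> E\<^sup>k\<close>.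
\<close>

definition bastiani_smooth_on ::
    "'a::{real_vector,topological_space} set \<Rightarrow> ('a \<Rightarrow> 'b::{real_vector,t2_space}) \<Rightarrow> bool" where
  "bastiani_smooth_on S f \<longleftrightarrow>
     (\<forall>k. (\<forall>x\<in>S. \<forall>y. \<exists>l. has_dir_deriv S (iter_dir_deriv S f k y) x (y k) l) \<and>
          continuous_on (S \<times> UNIV) (\<lambda>(x, y). iter_dir_deriv S f k y x))"


section \<open>The Frechet space of smooth curves in a vector space\<close>

primrec nth_deriv :: "nat \<Rightarrow> real set \<Rightarrow> (real \<Rightarrow> 'a::real_normed_vector) \<Rightarrow> real \<Rightarrow> 'a" where
  "nth_deriv 0 S f = f"
| "nth_deriv (Suc k) S f = (\<lambda>t. vector_derivative (nth_deriv k S f) (at t within S))"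

definition smooth_path_on :: "real set \<Rightarrow> (real \<Rightarrow> 'a::real_normed_vector) \<Rightarrow> bool" where
  "smooth_path_on S f \<longleftrightarrow> (\<forall>k. \<forall>t\<in>S. nth_deriv k S f differentiable (at t within S))"

lemma at_within_unit_interval: "t \<in> {0..1} \<Longrightarrow> at t within {0..1::real} \<noteq> bot"
  using trivial_limit_within[of t "{0..1}"] islimpt_Icc[of 0 "1::real" t] by auto

lemma nth_deriv_cong:
  assumes "\<And>t. t \<in> S \<Longrightarrow> f t = g t" "t \<in> S"
  shows "nth_deriv k S f t = nth_deriv k S g t"
  using assms(2)
proof (induction k arbitrary: t)
  case 0
  then show ?case using assms(1) by simp
next
  case (Suc k)
  have "(nth_deriv k S f has_vector_derivative y) (at t within S) \<longleftrightarrow>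
        (nth_deriv k S g has_vector_derivative y) (at t within S)" for y
    by (rule has_vector_derivative_cong_ev)
       (use Suc in \<open>auto intro: always_eventually\<close>)
  then show ?case by (simp add: vector_derivative_def)
qed

lemma nth_deriv_linear_combination:
  assumes f: "smooth_path_on {0..1} f" and g: "smooth_path_on {0..1} g"
  shows "t \<in> {0..1} \<Longrightarrow> nth_deriv k {0..1} (\<lambda>t. a *\<^sub>R f t + b *\<^sub>R g t) t =
           a *\<^sub>R nth_deriv k {0..1} f t + b *\<^sub>R nth_deriv k {0..1} g t" (is "_ \<Longrightarrow> ?eq k t")
    and "t \<in> {0..1} \<Longrightarrow>
           nth_deriv k {0..1} (\<lambda>t. a *\<^sub>R f t + b *\<^sub>R g t) differentiable (at t within {0..1})"
proof -
  let ?I = "{0..1::real}" and ?h = "\<lambda>t. a *\<^sub>R f t + b *\<^sub>R g t"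
  have D: "(nth_deriv k ?I ?h has_vector_derivative
             a *\<^sub>R nth_deriv (Suc k) ?I f t + b *\<^sub>R nth_deriv (Suc k) ?I g t) (at t within ?I)"
    if "t \<in> ?I" and eq: "\<And>s. s \<in> ?I \<Longrightarrow> ?eq k s" for k t
  proof -
    have "(nth_deriv k ?I f has_vector_derivative nth_deriv (Suc k) ?I f t) (at t within ?I)"
         "(nth_deriv k ?I g has_vector_derivative nth_deriv (Suc k) ?I g t) (at t within ?I)"
      using f g that(1) unfolding smooth_path_on_def
      by (simp_all del: atLeastAtMost_iff flip: vector_derivative_works)
    then have "((\<lambda>t. a *\<^sub>R nth_deriv k ?I f t + b *\<^sub>R nth_deriv k ?I g t) has_vector_derivative
             a *\<^sub>R nth_deriv (Suc k) ?I f t + b *\<^sub>R nth_deriv (Suc k) ?I g t) (at t within ?I)"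
      by (intro has_vector_derivative_add
            bounded_linear.has_vector_derivative[OF bounded_linear_scaleR_right])
    then show ?thesis
      by (rule has_vector_derivative_transform[OF that(1), rotated]) (rule eq)
  qed
  have eq: "?eq k t" if "t \<in> ?I" for k t
    using that
  proof (induction k arbitrary: t)
    case (Suc k)
    show ?case
      using vector_derivative_within[OF at_within_unit_interval D, OF Suc.prems Suc.prems Suc.IH]
      by simp
  qed simp
  show "t \<in> ?I \<Longrightarrow> ?eq k t" by (rule eq)
  show "nth_deriv k ?I ?h differentiable (at t within ?I)" if "t \<in> ?I"
    by (rule differentiableI_vector, rule D[OF that eq])
qed

lemma smooth_path_on_linear_combination:
  "smooth_path_on {0..1} f \<Longrightarrow> smooth_path_on {0..1} g \<Longrightarrow>
     smooth_path_on {0..1} (\<lambda>t. a *\<^sub>R f t + b *\<^sub>R g t)"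
  using nth_deriv_linear_combination(2) unfolding smooth_path_on_def by blast

lemma smooth_path_on_zero: "smooth_path_on {0..1} (\<lambda>t. 0)"
proof -
  have z: "t \<in> {0..1} \<Longrightarrow> nth_deriv k {0..1} (\<lambda>t. 0::'a) t = 0" for k t
  proof (induction k arbitrary: t)
    case (Suc k)
    have "(nth_deriv k {0..1} (\<lambda>t. 0::'a) has_vector_derivative 0) (at t within {0..1})"
      by (rule has_vector_derivative_transform[OF Suc.prems _ has_vector_derivative_const])
         (use Suc.IH in simp)
    then show ?case
      using vector_derivative_within[OF at_within_unit_interval[OF Suc.prems]] by simp
  qed simp
  show ?thesis
    unfolding smooth_path_on_def
  proof (intro allI ballI)
    fix k t assume t: "t \<in> {0..1::real}"
    have "(nth_deriv k {0..1} (\<lambda>t. 0::'a) has_vector_derivative 0) (at t within {0..1})"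
      by (rule has_vector_derivative_transform[OF t _ has_vector_derivative_const]) (simp add: z)
    then show "nth_deriv k {0..1} (\<lambda>t. 0::'a) differentiable (at t within {0..1})"
      by (rule differentiableI_vector)
  qed
qed

text \<open>\<open>'a smooth_curve\<close> is \<open>C\<^sup>\<infinity>([0,1], 'a)\<close>; the value \<open>0\<close> outside the interval is a normalisation.\<close>

typedef (overloaded) ('a::real_normed_vector) smooth_curve =
    "{f :: real \<Rightarrow> 'a. smooth_path_on {0..1} f \<and> (\<forall>t. t \<notin> {0..1} \<longrightarrow> f t = 0)}"
  morphisms curve_at Abs_smooth_curve
  using smooth_path_on_zero by blast

definition curve_of :: "(real \<Rightarrow> 'a::real_normed_vector) \<Rightarrow> 'a smooth_curve" where
  "curve_of f = Abs_smooth_curve (\<lambda>t. if t \<in> {0..1} then f t else 0)"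

lemma curve_eqI: "(\<And>t. curve_at p t = curve_at q t) \<Longrightarrow> p = q"
  by (metis curve_at_inject ext)

lemma smooth_path_on_curve_at: "smooth_path_on {0..1} (curve_at q)"
  using curve_at[of q] by simp

lemma smooth_path_on_cong:
  assumes "\<And>t. t \<in> S \<Longrightarrow> f t = g t" "smooth_path_on S f"
  shows "smooth_path_on S g"
  unfolding smooth_path_on_def
proof (intro allI ballI)
  fix k t assume t: "t \<in> S"
  have "nth_deriv k S f differentiable (at t within S)"
    using assms(2) t by (simp add: smooth_path_on_def)
  then have "(nth_deriv k S f has_vector_derivative nth_deriv (Suc k) S f t) (at t within S)"
    by (simp add: vector_derivative_works)
  then have "(nth_deriv k S g has_vector_derivative nth_deriv (Suc k) S f t) (at t within S)"
    by (rule has_vector_derivative_transform[OF t, rotated])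
       (metis assms(1) nth_deriv_cong)
  then show "nth_deriv k S g differentiable (at t within S)"
    by (rule differentiableI_vector)
qed

lemma curve_at_curve_of:
  assumes "smooth_path_on {0..1} f"
  shows "curve_at (curve_of f) t = (if t \<in> {0..1} then f t else 0)"
proof -
  have "smooth_path_on {0..1} (\<lambda>t. if t \<in> {0..1} then f t else 0)"
    by (rule smooth_path_on_cong[OF _ assms]) simp
  then show ?thesis
    unfolding curve_of_def by (subst Abs_smooth_curve_inverse) auto
qed

lemma curve_at_outside: "t \<notin> {0..1} \<Longrightarrow> curve_at q t = 0"
  using curve_at[of q] by blast

instantiation smooth_curve :: (real_normed_vector) real_vector
begin

definition "0 = curve_of (\<lambda>t. 0)"
definition "p + q = curve_of (\<lambda>t. curve_at p t + curve_at q t)"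
definition "p - q = curve_of (\<lambda>t. curve_at p t - curve_at q t)"
definition "- q = curve_of (\<lambda>t. - curve_at q t)"
definition "a *\<^sub>R q = curve_of (\<lambda>t. a *\<^sub>R curve_at q t)"

lemma curve_at_ops:
  fixes p q :: "'a smooth_curve"
  shows "curve_at (0 :: 'a smooth_curve) t = 0"
    and "curve_at (p + q) t = curve_at p t + curve_at q t"
    and "curve_at (p - q) t = curve_at p t - curve_at q t"
    and "curve_at (- q) t = - curve_at q t"
    and "curve_at (a *\<^sub>R q) t = a *\<^sub>R curve_at q t"
proof -
  note lc = smooth_path_on_linear_combination[OF smooth_path_on_curve_at[of p] smooth_path_on_curve_at[of q]]
  show "curve_at (0 :: 'a smooth_curve) t = 0"
    by (simp add: zero_smooth_curve_def curve_at_curve_of[OF smooth_path_on_zero])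
  show "curve_at (p + q) t = curve_at p t + curve_at q t"
    using lc[of 1 1] by (simp add: plus_smooth_curve_def curve_at_curve_of curve_at_outside)
  show "curve_at (p - q) t = curve_at p t - curve_at q t"
    using lc[of 1 "-1"] by (simp add: minus_smooth_curve_def curve_at_curve_of curve_at_outside)
  show "curve_at (- q) t = - curve_at q t"
    using lc[of 0 "-1"] by (simp add: uminus_smooth_curve_def curve_at_curve_of curve_at_outside)
  show "curve_at (a *\<^sub>R q) t = a *\<^sub>R curve_at q t"
    using lc[of 0 a] by (simp add: scaleR_smooth_curve_def curve_at_curve_of curve_at_outside)
qed

instance
  by standard (rule curve_eqI; simp add: curve_at_ops algebra_simps)+

end

text \<open>The compact-open \<open>C\<^sup>\<infinity>\<close>-topology: uniform convergence of all derivatives on \<open>[0,1]\<close>.\<close>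

definition curve_nbhd ::
    "nat \<Rightarrow> real \<Rightarrow> 'a::real_normed_vector smooth_curve \<Rightarrow> 'a smooth_curve set" where
  "curve_nbhd n e p = {q. \<forall>k\<le>n. \<forall>t\<in>{0..1}.
     norm (nth_deriv k {0..1} (curve_at q) t - nth_deriv k {0..1} (curve_at p) t) < e}"

lemma curve_nbhd_mono: "n \<le> m \<Longrightarrow> d \<le> e \<Longrightarrow> curve_nbhd m d p \<subseteq> curve_nbhd n e p"
  unfolding curve_nbhd_def by (auto simp del: atLeastAtMost_iff) (meson le_trans less_le_trans)

instantiation smooth_curve :: (real_normed_vector) t2_space
begin

definition open_smooth_curve :: "'a smooth_curve set \<Rightarrow> bool" where
  "open_smooth_curve U \<longleftrightarrow> (\<forall>p\<in>U. \<exists>n. \<exists>e>0. curve_nbhd n e p \<subseteq> U)"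

instance
proof
  show "open (UNIV :: 'a smooth_curve set)"
    unfolding open_smooth_curve_def by (auto intro: exI[of _ 1])
next
  fix U V :: "'a smooth_curve set"
  assume U: "open U" and V: "open V"
  show "open (U \<inter> V)"
    unfolding open_smooth_curve_def
  proof
    fix p assume p: "p \<in> U \<inter> V"
    obtain n e where e: "e > 0" and n: "curve_nbhd n e p \<subseteq> U"
      using U p unfolding open_smooth_curve_def by blast
    obtain m d where d: "d > 0" and m: "curve_nbhd m d p \<subseteq> V"
      using V p unfolding open_smooth_curve_def by blast
    have "curve_nbhd (max n m) (min e d) p \<subseteq> U \<inter> V"
      using curve_nbhd_mono[of n "max n m" "min e d" e p]
        curve_nbhd_mono[of m "max n m" "min e d" d p] n m by auto
    moreover have "min e d > 0" using e d by simp
    ultimately show "\<exists>n. \<exists>e>0. curve_nbhd n e p \<subseteq> U \<inter> V"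
      by blast
  qed
next
  fix K :: "'a smooth_curve set set"
  assume K: "\<forall>U\<in>K. open U"
  show "open (\<Union>K)"
    unfolding open_smooth_curve_def
  proof
    fix p assume "p \<in> \<Union>K"
    then obtain U where U: "U \<in> K" "p \<in> U" by blast
    then obtain n e where "e > 0" "curve_nbhd n e p \<subseteq> U"
      using K unfolding open_smooth_curve_def by blast
    then show "\<exists>n. \<exists>e>0. curve_nbhd n e p \<subseteq> \<Union>K"
      using U(1) by (meson Union_upper order_trans)
  qed
next
  have *: "open {q :: 'a smooth_curve. norm (curve_at q t - x) < e}" if t: "t \<in> {0..1}" for t x e
    unfolding open_smooth_curve_def
  proof
    fix p assume "p \<in> {q :: 'a smooth_curve. norm (curve_at q t - x) < e}"
    then have d: "e - norm (curve_at p t - x) > 0" by simp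
    have "norm (curve_at q t - x) < e" if "q \<in> curve_nbhd 0 (e - norm (curve_at p t - x)) p" for q
    proof -
      have "norm (curve_at q t - curve_at p t) < e - norm (curve_at p t - x)"
        using that t unfolding curve_nbhd_def by (simp del: atLeastAtMost_iff)
      then show ?thesis
        using norm_triangle_ineq[of "curve_at q t - curve_at p t" "curve_at p t - x"] by simp
    qed
    then have "curve_nbhd 0 (e - norm (curve_at p t - x)) p \<subseteq> {q. norm (curve_at q t - x) < e}"
      by auto
    then show "\<exists>n. \<exists>d>0. curve_nbhd n d p \<subseteq> {q. norm (curve_at q t - x) < e}"
      using d by blast
  qed
  fix p q :: "'a smooth_curve"
  assume "p \<noteq> q"
  then obtain t where ne: "curve_at p t \<noteq> curve_at q t"
    using curve_eqI by blast
  then have t: "t \<in> {0..1}"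
    using curve_at_outside by metis
  define e where "e = norm (curve_at p t - curve_at q t) / 2"
  have e: "e > 0" using ne by (simp add: e_def)
  let ?U = "{r :: 'a smooth_curve. norm (curve_at r t - curve_at p t) < e}"
  let ?V = "{r :: 'a smooth_curve. norm (curve_at r t - curve_at q t) < e}"
  have "?U \<inter> ?V = {}"
  proof -
    have False if "norm (x - curve_at p t) < e" "norm (x - curve_at q t) < e" for x
    proof -
      have "norm (curve_at p t - curve_at q t) \<le> norm (x - curve_at p t) + norm (x - curve_at q t)"
        using norm_triangle_ineq4[of "x - curve_at q t" "x - curve_at p t"] by simp
      then show False using that by (simp add: e_def)
    qed
    then show ?thesis by auto
  qed
  then show "\<exists>U V. open U \<and> open V \<and> p \<in> U \<and> q \<in> V \<and> U \<inter> V = {}"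
    using e by (intro exI[of _ ?U] exI[of _ ?V]) (auto intro: *[OF t])
qed

end


section \<open>Finite-dimensional manifolds\<close>

type_synonym ('p, 'e) chart = "'p set \<times> ('p \<Rightarrow> 'e)"
type_synonym ('p, 'e) atlas = "('p, 'e) chart set"

definition mcarrier :: "('p, 'e) atlas \<Rightarrow> 'p set" where
  "mcarrier A = (\<Union>(U, \<phi>)\<in>A. U)"

definition mtopology :: "('p, 'e::topological_space) atlas \<Rightarrow> 'p topology" where
  "mtopology A = topology_generated_by {W. \<exists>(U, \<phi>)\<in>A. W \<subseteq> U \<and> open (\<phi> ` W)}"

definition smooth_transition :: "('p, 'e::euclidean_space) chart \<Rightarrow> ('p, 'e) chart \<Rightarrow> bool" where
  "smooth_transition = (\<lambda>(U, \<phi>) (V, \<psi>).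
     open (\<phi> ` (U \<inter> V)) \<and> bastiani_smooth_on (\<phi> ` (U \<inter> V)) (\<psi> \<circ> inv_into U \<phi>))"

text \<open>Taking both charts equal in the second condition gives that chart images are open.\<close>

definition smooth_manifold :: "('p, 'e::euclidean_space) atlas \<Rightarrow> bool" where
  "smooth_manifold A \<longleftrightarrow>
     (\<forall>(U, \<phi>)\<in>A. inj_on \<phi> U) \<and>
     (\<forall>C\<in>A. \<forall>C'\<in>A. smooth_transition C C') \<and>
     Hausdorff_space (mtopology A)"

definition maximal_atlas :: "('p, 'e::euclidean_space) atlas \<Rightarrow> ('p, 'e) atlas" where
  "maximal_atlas A = {(U, \<phi>). U \<subseteq> mcarrier A \<and> inj_on \<phi> U \<and> open (\<phi> ` U) \<and>
     (\<forall>C\<in>A. smooth_transition (U, \<phi>) C \<and> smooth_transition C (U, \<phi>))}"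

definition prod_atlas :: "('p, 'e) atlas \<Rightarrow> ('q, 'f) atlas \<Rightarrow> ('p \<times> 'q, 'e \<times> 'f) atlas" where
  "prod_atlas A B = (\<lambda>((U, \<phi>), (V, \<psi>)). (U \<times> V, map_prod \<phi> \<psi>)) ` (A \<times> B)"

definition smooth_map ::
    "('p, 'e::euclidean_space) atlas \<Rightarrow> ('q, 'f::euclidean_space) atlas \<Rightarrow> ('p \<Rightarrow> 'q) \<Rightarrow> bool" where
  "smooth_map A B f \<longleftrightarrow>
     f ` mcarrier A \<subseteq> mcarrier B \<and>
     (\<forall>(U, \<phi>)\<in>A. \<forall>(V, \<psi>)\<in>B.
        open (\<phi> ` (U \<inter> f -` V)) \<and>
        bastiani_smooth_on (\<phi> ` (U \<inter> f -` V)) (\<psi> \<circ> f \<circ> inv_into U \<phi>))"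

text \<open>
  Tangent vectors at \<open>p\<close> are represented by their coordinates in a preferred chart at \<open>p\<close>. So every
  \<open>T\<^sub>p\<close> is the model space, and the tangent bundle consists of the pairs \<open>(p, x)\<close>.
\<close>

definition chart_at :: "('p, 'e) atlas \<Rightarrow> 'p \<Rightarrow> ('p, 'e) chart" where
  "chart_at A p = (SOME C. C \<in> A \<and> p \<in> fst C)"

definition tangent_map ::
    "('p, 'e::euclidean_space) atlas \<Rightarrow> ('q, 'f::euclidean_space) atlas \<Rightarrow> ('p \<Rightarrow> 'q) \<Rightarrow> 'p \<Rightarrow> 'e \<Rightarrow> 'f" where
  "tangent_map A B f p x =
     (let (U, \<phi>) = chart_at A p; (V, \<psi>) = chart_at B (f p)
      in dir_deriv (\<phi> ` (U \<inter> f -` V)) (\<psi> \<circ> f \<circ> inv_into U \<phi>) (\<phi> p) x)"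

definition tangent_chart ::
    "('p, 'e::euclidean_space) atlas \<Rightarrow> ('p, 'e) chart \<Rightarrow> ('p \<times> 'e, 'e \<times> 'e) chart" where
  "tangent_chart A = (\<lambda>(U, \<phi>).
     (U \<times> UNIV, \<lambda>(p, x). (\<phi> p,
        (let (V, \<psi>) = chart_at A p in dir_deriv (\<psi> ` (U \<inter> V)) (\<phi> \<circ> inv_into V \<psi>) (\<psi> p) x))))"

definition tangent_atlas :: "('p, 'e::euclidean_space) atlas \<Rightarrow> ('p \<times> 'e, 'e \<times> 'e) atlas" where
  "tangent_atlas A = tangent_chart A ` A"

definition submersion ::
    "('p, 'e::euclidean_space) atlas \<Rightarrow> ('q, 'f::euclidean_space) atlas \<Rightarrow> ('p \<Rightarrow> 'q) \<Rightarrow> bool" where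
  "submersion A B f \<longleftrightarrow> smooth_map A B f \<and> (\<forall>p\<in>mcarrier A. surj (tangent_map A B f p))"

definition submanifold :: "('p, 'e::euclidean_space) atlas \<Rightarrow> 'p set \<Rightarrow> bool" where
  "submanifold A N \<longleftrightarrow> N \<subseteq> mcarrier A \<and>
     (\<exists>d. \<forall>p\<in>N. \<exists>(U, \<phi>)\<in>maximal_atlas A. \<exists>F.
        p \<in> U \<and> subspace F \<and> dim F = d \<and> \<phi> ` (U \<inter> N) = \<phi> ` U \<inter> F)"


section \<open>Manifolds of smooth curves\<close>

definition smooth_curves :: "('p, 'e::euclidean_space) atlas \<Rightarrow> (real \<Rightarrow> 'p) set" where
  "smooth_curves B = {c \<in> extensional {0..1}. c ` {0..1} \<subseteq> mcarrier B \<and>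
     (\<forall>(U, \<psi>)\<in>B. openin (top_of_set {0..1}) {t\<in>{0..1}. c t \<in> U} \<and>
        smooth_path_on {t\<in>{0..1}. c t \<in> U} (\<psi> \<circ> c))}"

definition velocity :: "('p, 'e::euclidean_space) atlas \<Rightarrow> (real \<Rightarrow> 'p) \<Rightarrow> real \<Rightarrow> 'p \<times> 'e" where
  "velocity B c = (\<lambda>t\<in>{0..1}.
     (c t, (let (U, \<psi>) = chart_at B (c t) in vector_derivative (\<psi> \<circ> c) (at t within {0..1}))))"

text \<open>
  Charts of \<open>C\<^sup>\<infinity>([0,1], N)\<close> are given through their inverses \<open>q \<mapsto> (t \<mapsto> \<Phi> (t, q t))\<close>, where \<open>V\<close> is
  open in \<open>[0,1] \<times> E\<close> and \<open>(t, x) \<mapsto> (t, \<Phi> (t, x))\<close> is a diffeomorphism from \<open>V\<close> onto an open subset of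
  \<open>[0,1] \<times> N\<close>. Two of them differ by a superposition operator \<open>q \<mapsto> (t \<mapsto> \<chi> (t, q t))\<close> with \<open>\<chi>\<close> smooth, so
  they form a smooth atlas. The usual charts \<open>\<xi> \<mapsto> \<Sigma> \<circ> \<xi>\<close> on sections of \<open>c\<^sup>* TN\<close>, with \<open>\<Sigma>\<close> a local
  addition on \<open>N\<close>, have this form once \<open>c\<^sup>* TN\<close> is trivialised by \<open>\<tau>\<close>: \<open>\<Phi> (t, x) = \<Sigma> (\<tau>\<^sub>t x)\<close>. The atlas
  therefore defines the usual manifold structure.
\<close>

definition curve_chart ::
    "('p, 'e::euclidean_space) atlas \<Rightarrow> (real \<times> 'e) set \<Rightarrow> (real \<times> 'e \<Rightarrow> 'p) \<Rightarrow> bool" where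
  "curve_chart B V \<Phi> \<longleftrightarrow>
     openin (top_of_set ({0..1} \<times> UNIV)) V \<and>
     \<Phi> ` V \<subseteq> mcarrier B \<and>
     inj_on (\<lambda>(t, x). (t, \<Phi> (t, x))) V \<and>
     (\<forall>(U, \<psi>)\<in>B.
        let W = {z\<in>V. \<Phi> z \<in> U}; F = (\<lambda>(t, x). (t, \<psi> (\<Phi> (t, x)))) in
          openin (top_of_set ({0..1} \<times> UNIV)) W \<and>
          openin (top_of_set ({0..1} \<times> UNIV)) (F ` W) \<and>
          bastiani_smooth_on W F \<and>
          bastiani_smooth_on (F ` W) (inv_into W F))"

definition curve_chart_domain :: "(real \<times> 'e::euclidean_space) set \<Rightarrow> 'e smooth_curve set" where
  "curve_chart_domain V = {q. \<forall>t\<in>{0..1}. (t, curve_at q t) \<in> V}"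

definition curve_param :: "(real \<times> 'e::euclidean_space \<Rightarrow> 'p) \<Rightarrow> 'e smooth_curve \<Rightarrow> real \<Rightarrow> 'p" where
  "curve_param \<Phi> q = (\<lambda>t\<in>{0..1}. \<Phi> (t, curve_at q t))"

definition smooth_on_curves ::
    "('p, 'e::euclidean_space) atlas \<Rightarrow> ((real \<Rightarrow> 'p) \<Rightarrow> 'f::{real_vector,t2_space}) \<Rightarrow> bool" where
  "smooth_on_curves B f \<longleftrightarrow>
     (\<forall>V \<Phi>. curve_chart B V \<Phi> \<longrightarrow> bastiani_smooth_on (curve_chart_domain V) (f \<circ> curve_param \<Phi>))"

text \<open>
  \<open>T\<^sub>c C\<^sup>\<infinity>([0,1], N)\<close> consists of the smooth curves \<open>v\<close> in \<open>TN\<close> over \<open>c\<close>. The chart given by \<open>V\<close>, \<open>\<Phi>\<close>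
  represents \<open>(c, v)\<close> by \<open>(q, \<xi>)\<close> if \<open>c = \<Phi> (\<cdot>, q)\<close> and \<open>v = \<partial>\<^sub>x \<Phi> (\<cdot>, q) \<xi>\<close>.
\<close>

definition represents_tangent ::
    "('p, 'e::euclidean_space) atlas \<Rightarrow> (real \<Rightarrow> 'p) \<Rightarrow> (real \<Rightarrow> 'p \<times> 'e) \<Rightarrow>
     (real \<times> 'e) set \<Rightarrow> (real \<times> 'e \<Rightarrow> 'p) \<Rightarrow> 'e smooth_curve \<Rightarrow> 'e smooth_curve \<Rightarrow> bool" where
  "represents_tangent B c v V \<Phi> q \<xi> \<longleftrightarrow>
     curve_chart B V \<Phi> \<and> q \<in> curve_chart_domain V \<and> curve_param \<Phi> q = c \<and>
     (\<forall>t\<in>{0..1}. v t = (c t,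
        (let (U, \<psi>) = chart_at B (c t)
         in dir_deriv {x. (t, x) \<in> V \<and> \<Phi> (t, x) \<in> U} (\<lambda>x. \<psi> (\<Phi> (t, x)))
              (curve_at q t) (curve_at \<xi> t))))"

text \<open>
  The tangent map at \<open>c\<close> of a vector-space valued map \<open>f\<close>, computed in a chart. Only the values of \<open>f\<close> on
  the curves \<open>\<Phi> (\<cdot>, q + s\<xi>)\<close> for small \<open>s\<close> matter. If \<open>v 0 = 0\<close> then \<open>\<xi> 0 = 0\<close> and these curves keep
  their initial point; so for \<open>v\<close> tangent to the immersions starting at \<open>c 0\<close> this is the tangent map of
  the restriction of \<open>f\<close> to these. There is a chart around every smooth \<open>c\<close>, so the value \<open>0\<close> in the last
  line is never taken for a tangent vector \<open>v\<close>.
\<close>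

definition curve_tangent_map ::
    "('p, 'e::euclidean_space) atlas \<Rightarrow> ((real \<Rightarrow> 'p) \<Rightarrow> 'f::{real_vector,t2_space}) \<Rightarrow>
     (real \<Rightarrow> 'p) \<Rightarrow> (real \<Rightarrow> 'p \<times> 'e) \<Rightarrow> 'f" where
  "curve_tangent_map B f c v =
     (if \<exists>V \<Phi> q \<xi>. represents_tangent B c v V \<Phi> q \<xi>
      then (let (V, \<Phi>, q, \<xi>) = (SOME (V, \<Phi>, q, \<xi>). represents_tangent B c v V \<Phi> q \<xi>)
            in dir_deriv UNIV (f \<circ> curve_param \<Phi>) q \<xi>)
      else 0)"

definition curves_from :: "('p, 'e::euclidean_space) atlas \<Rightarrow> 'p \<Rightarrow> (real \<Rightarrow> 'p) set" where
  "curves_from B c0 = {c \<in> smooth_curves B. c 0 = c0}"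

definition immersions_from :: "('p, 'e::euclidean_space) atlas \<Rightarrow> 'p \<Rightarrow> (real \<Rightarrow> 'p) set" where
  "immersions_from B c0 = {c \<in> curves_from B c0. \<forall>t\<in>{0..1}. snd (velocity B c t) \<noteq> 0}"

definition tangent_space_immersions_from ::
    "('p, 'e::euclidean_space) atlas \<Rightarrow> (real \<Rightarrow> 'p) \<Rightarrow> (real \<Rightarrow> 'p \<times> 'e) set" where
  "tangent_space_immersions_from B c =
     {v \<in> smooth_curves (tangent_atlas B). (\<forall>t\<in>{0..1}. fst (v t) = c t) \<and> snd (v 0) = 0}"


section \<open>Lie groups and homogeneous spaces\<close>

definition lie_group :: "('g, 'z) monoid_scheme \<Rightarrow> ('g, 'e::euclidean_space) atlas \<Rightarrow> bool" where
  "lie_group G A \<longleftrightarrow> group G \<and> smooth_manifold A \<and> mcarrier A = carrier G \<and>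
     smooth_map (prod_atlas A A) A (\<lambda>(g, k). g \<otimes>\<^bsub>G\<^esub> k) \<and>
     smooth_map A A (\<lambda>g. inv\<^bsub>G\<^esub> g)"

definition closed_lie_subgroup ::
    "('g, 'z) monoid_scheme \<Rightarrow> ('g, 'e::euclidean_space) atlas \<Rightarrow> 'g set \<Rightarrow> bool" where
  "closed_lie_subgroup G A H \<longleftrightarrow> subgroup H G \<and> submanifold A H \<and> closedin (mtopology A) H"

text \<open>\<open>B\<close> is an atlas of the manifold structure on \<open>G/H\<close> that makes the projection a submersion.\<close>

definition homogeneous_space ::
    "('g, 'z) monoid_scheme \<Rightarrow> ('g, 'e::euclidean_space) atlas \<Rightarrow> 'g set \<Rightarrow>
     ('g set, 'm::euclidean_space) atlas \<Rightarrow> bool" where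
  "homogeneous_space G A H B \<longleftrightarrow>
     smooth_manifold B \<and> mcarrier B = (\<lambda>g. g <#\<^bsub>G\<^esub> H) ` carrier G \<and>
     submersion A B (\<lambda>g. g <#\<^bsub>G\<^esub> H)"

text \<open>The Lie algebra \<open>T\<^sub>e G\<close> is the model space \<open>'e\<close>, in the coordinates of \<open>chart_at A \<one>\<close>.\<close>

definition Evol ::
    "('g, 'z) monoid_scheme \<Rightarrow> ('g, 'e::euclidean_space) atlas \<Rightarrow> 'e smooth_curve \<Rightarrow> real \<Rightarrow> 'g" where
  "Evol G A q = (THE g. g \<in> smooth_curves A \<and> g 0 = \<one>\<^bsub>G\<^esub> \<and>
     (\<forall>t\<in>{0..1}. snd (velocity A g t) = tangent_map A A (\<lambda>x. x \<otimes>\<^bsub>G\<^esub> g t) \<one>\<^bsub>G\<^esub> (curve_at q t)))"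

text \<open>\<open>g <# kH = (gk)H\<close>, so \<open>g <# c0\<close> is the action of \<open>g\<close> on the coset \<open>c0\<close>.\<close>

definition rho ::
    "('g, 'z) monoid_scheme \<Rightarrow> ('g, 'e::euclidean_space) atlas \<Rightarrow> 'g set \<Rightarrow> 'e smooth_curve \<Rightarrow>
     real \<Rightarrow> 'g set" where
  "rho G A c0 q = (\<lambda>t\<in>{0..1}. Evol G A q t <#\<^bsub>G\<^esub> c0)"


section \<open>The square root velocity transform and the pullback metric\<close>

definition inner_product :: "('e::real_vector \<Rightarrow> 'e \<Rightarrow> real) \<Rightarrow> bool" where
  "inner_product ip \<longleftrightarrow> bilinear ip \<and> (\<forall>x y. ip x y = ip y x) \<and> (\<forall>x. x \<noteq> 0 \<longrightarrow> ip x x > 0)"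

definition ip_norm :: "('e \<Rightarrow> 'e \<Rightarrow> real) \<Rightarrow> 'e \<Rightarrow> real" where
  "ip_norm ip x = sqrt (ip x x)"

definition L2_metric ::
    "('e::real_normed_vector \<Rightarrow> 'e \<Rightarrow> real) \<Rightarrow> 'e smooth_curve \<Rightarrow> 'e smooth_curve \<Rightarrow> real" where
  "L2_metric ip f g = integral {0..1} (\<lambda>t. ip (curve_at f t) (curve_at g t))"

definition srvt ::
    "('p, 'm::euclidean_space) atlas \<Rightarrow> ('e::real_normed_vector \<Rightarrow> 'e \<Rightarrow> real) \<Rightarrow>
     ((real \<Rightarrow> 'p \<times> 'm) \<Rightarrow> 'e smooth_curve) \<Rightarrow> (real \<Rightarrow> 'p) \<Rightarrow> 'e smooth_curve" where
  "srvt B ip \<alpha> c = (let q = curve_at (\<alpha> (velocity B c))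
                    in curve_of (\<lambda>t. q t /\<^sub>R sqrt (ip_norm ip (q t))))"

definition pullback_L2 ::
    "('p, 'm::euclidean_space) atlas \<Rightarrow> ('e::real_normed_vector \<Rightarrow> 'e \<Rightarrow> real) \<Rightarrow>
     ((real \<Rightarrow> 'p) \<Rightarrow> 'e smooth_curve) \<Rightarrow> (real \<Rightarrow> 'p) \<Rightarrow> (real \<Rightarrow> 'p \<times> 'm) \<Rightarrow> (real \<Rightarrow> 'p \<times> 'm) \<Rightarrow> real" where
  "pullback_L2 B ip R c v w = L2_metric ip (curve_tangent_map B R c v) (curve_tangent_map B R c w)"

end

theory Submission
  imports Defs
begin

text \<open>
  In the chart of the curve space given by \<open>\<Phi>\<close>, the velocity map is the continuous linear map
  \<open>q \<mapsto> (q, q')\<close> followed by the chart of the tangent bundle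
  \<open>(t, x, y) \<mapsto> (\<Phi> (t, x), \<partial>\<^sub>t \<Phi> + \<partial>\<^sub>x \<Phi> y)\<close>. Hence \<open>\<alpha> \<circ> D\<close> has a directional derivative \<open>h\<close>
  along every tangent vector. The map \<open>N x = x / \<surd>\<parallel>x\<parallel>\<close> satisfies
  \<open>(N x - N z) / s = \<Psi> (x, z, (x - z) / s)\<close> with an explicit smooth \<open>\<Psi>\<close>, so the difference
  quotients of \<open>N \<circ> \<alpha> \<circ> D\<close> converge in \<open>C\<^sup>\<infinity>\<close> because superposition with \<open>\<Psi>\<close> is continuous. The
  limit is \<open>\<Psi> (x, x, h) = (h - \<langle>h, u\<rangle> u / 2) / \<surd>\<parallel>x\<parallel>\<close> with \<open>u = x / \<parallel>x\<parallel>\<close>, and the formula follows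
  pointwise from \<open>\<langle>u, u\<rangle> = 1\<close>.
\<close>

section \<open>Functions of class \<open>C\<^sup>k\<close> on a set\<close>

text \<open>The tangent map is a limit in a Frechet space, so differentiating \<open>N\<close> at
  each fixed \<open>t\<close> would not suffice: all \<open>t\<close>-derivatives of the quotients
  must converge uniformly. A closed formula for the quotient, in which the division by
  \<open>s\<close> sits inside one argument, leaves a single fixed smooth function to superpose and
  avoids a remainder estimate for every order. The other obstacle is that \<alpha> is known to be
  smooth only in charts of the curve space of the tangent bundle. The prolonged chart must therefore
  satisfy \<open>curve_chart\<close> itself, which demands Bastiani smoothness of a map and of its
  inverse on relatively open subsets of \<open>[0,1] \<times> E\<close>. Iterated directional
  derivatives within such sets are awkward to compose, whereas Frechet derivatives within a set obey
  the chain rule; hence the passage from \<open>bastiani_smooth_on\<close> to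
  \<open>smooth_in\<close> and back. At boundary times derivatives may be one-sided, which is why
  their uniqueness is tied to \<open>dir_domain\<close>.\<close>

text \<open>Derivatives are tested in each fixed direction, so every stage has the same type as
  \<open>f\<close> and the recursion is primitive. The existential over \<open>f'\<close> leaves the
  choice open where derivatives within \<open>W\<close> are not unique.\<close>

primrec Ck :: "nat \<Rightarrow> 'a::real_normed_vector set \<Rightarrow> ('a \<Rightarrow> 'b::real_normed_vector) \<Rightarrow> bool" where
  "Ck 0 W f \<longleftrightarrow> continuous_on W f"
| "Ck (Suc k) W f \<longleftrightarrow>
     (\<exists>f'. (\<forall>x\<in>W. (f has_derivative f' x) (at x within W)) \<and> (\<forall>v. Ck k W (\<lambda>x. f' x v)))"

definition smooth_in :: "'a::real_normed_vector set \<Rightarrow> ('a \<Rightarrow> 'b::real_normed_vector) \<Rightarrow> bool" where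
  "smooth_in W f \<longleftrightarrow> (\<forall>k. Ck k W f)"

lemma Ck_SucI:
  assumes "\<And>x. x \<in> W \<Longrightarrow> (f has_derivative f' x) (at x within W)" "\<And>v. Ck k W (\<lambda>x. f' x v)"
  shows "Ck (Suc k) W f"
  using assms by auto

lemma Ck_SucE:
  assumes "Ck (Suc k) W f"
  obtains f' where "\<And>x. x \<in> W \<Longrightarrow> (f has_derivative f' x) (at x within W)"
    and "\<And>v. Ck k W (\<lambda>x. f' x v)"
  using assms by auto

declare Ck.simps(2) [simp del]

lemma Ck_cong:
  assumes "\<And>x. x \<in> W \<Longrightarrow> f x = g x" "Ck k W f"
  shows "Ck k W g"
proof (cases k)
  case 0
  then show ?thesis using assms by (simp cong: continuous_on_cong)
next
  case (Suc j)
  obtain f' where f': "\<And>x. x \<in> W \<Longrightarrow> (f has_derivative f' x) (at x within W)"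
      "\<And>v. Ck j W (\<lambda>x. f' x v)"
    using Ck_SucE[OF assms(2)[unfolded Suc]] by metis
  show ?thesis
    unfolding Suc
  proof (rule Ck_SucI[OF _ f'(2)])
    fix x assume "x \<in> W"
    then show "(g has_derivative f' x) (at x within W)"
      using f'(1) assms(1) by (metis has_derivative_transform)
  qed
qed

lemma Ck_continuous_on: "Ck k W f \<Longrightarrow> continuous_on W f"
  by (cases k) (auto elim!: Ck_SucE intro: has_derivative_continuous_on)

lemma Ck_Suc: "Ck (Suc k) W f \<Longrightarrow> Ck k W f"
proof (induction k arbitrary: f)
  case 0
  then show ?case using Ck_continuous_on by auto
next
  case (Suc k)
  obtain f' where f': "\<And>x. x \<in> W \<Longrightarrow> (f has_derivative f' x) (at x within W)"
      "\<And>v. Ck (Suc k) W (\<lambda>x. f' x v)"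
    using Ck_SucE[OF Suc.prems] by metis
  show ?case
    by (rule Ck_SucI[OF f'(1)]) (auto intro: Suc.IH f'(2))
qed

lemma Ck_const: "Ck k W (\<lambda>x. c)"
  by (induction k arbitrary: c) (auto intro!: Ck_SucI[of _ _ "\<lambda>x v. 0"])

lemma Ck_bounded_linear: "bounded_linear L \<Longrightarrow> Ck k W L"
  by (cases k)
     (auto intro!: Ck_SucI[of _ _ "\<lambda>x. L"] Ck_const bounded_linear_imp_has_derivative
           linear_continuous_on)

lemma Ck_add: "Ck k W f \<Longrightarrow> Ck k W g \<Longrightarrow> Ck k W (\<lambda>x. f x + g x)"
proof (induction k arbitrary: f g)
  case 0
  then show ?case by (auto intro: continuous_on_add)
next
  case (Suc k)
  obtain f' where f': "\<And>x. x \<in> W \<Longrightarrow> (f has_derivative f' x) (at x within W)"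
      "\<And>v. Ck k W (\<lambda>x. f' x v)"
    using Ck_SucE[OF Suc.prems(1)] by metis
  obtain g' where g': "\<And>x. x \<in> W \<Longrightarrow> (g has_derivative g' x) (at x within W)"
      "\<And>v. Ck k W (\<lambda>x. g' x v)"
    using Ck_SucE[OF Suc.prems(2)] by metis
  show ?case
    by (intro Ck_SucI[of _ _ "\<lambda>x v. f' x v + g' x v"] has_derivative_add Suc.IH f' g')
qed

lemma Ck_sum: "(\<And>i. i \<in> I \<Longrightarrow> Ck k W (f i)) \<Longrightarrow> Ck k W (\<lambda>x. \<Sum>i\<in>I. f i x)"
  by (induction I rule: infinite_finite_induct) (simp_all add: Ck_const Ck_add)

lemma Ck_bilinear:
  assumes "bounded_bilinear b"
  shows "Ck k W f \<Longrightarrow> Ck k W g \<Longrightarrow> Ck k W (\<lambda>x. b (f x) (g x))"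
proof (induction k arbitrary: f g)
  case 0
  then show ?case using bounded_bilinear.continuous_on[OF assms] by auto
next
  case (Suc k)
  obtain f' where f': "\<And>x. x \<in> W \<Longrightarrow> (f has_derivative f' x) (at x within W)"
      "\<And>v. Ck k W (\<lambda>x. f' x v)"
    using Ck_SucE[OF Suc.prems(1)] by metis
  obtain g' where g': "\<And>x. x \<in> W \<Longrightarrow> (g has_derivative g' x) (at x within W)"
      "\<And>v. Ck k W (\<lambda>x. g' x v)"
    using Ck_SucE[OF Suc.prems(2)] by metis
  have "Ck k W f" "Ck k W g" by (rule Ck_Suc[OF Suc.prems(1)], rule Ck_Suc[OF Suc.prems(2)])
  then show ?case
    by (intro Ck_SucI[of _ _ "\<lambda>x v. b (f x) (g' x v) + b (f' x v) (g x)"]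
          bounded_bilinear.FDERIV[OF assms] Ck_add Suc.IH f' g')
qed

lemma linear_euclidean_sum:
  fixes L :: "'a::euclidean_space \<Rightarrow> 'b::real_vector"
  assumes "linear L"
  shows "L v = (\<Sum>b\<in>Basis. (v \<bullet> b) *\<^sub>R L b)"
  by (subst euclidean_representation[of v, symmetric])
     (simp only: linear_sum[OF assms] linear_scale[OF assms])

lemma Ck_linear_comp:
  assumes L: "bounded_linear L"
  shows "Ck k W f \<Longrightarrow> Ck k W (\<lambda>x. L (f x))"
proof (induction k arbitrary: f)
  case 0
  then show ?case using bounded_linear.continuous_on[OF L] by auto
next
  case (Suc k)
  obtain f' where f': "\<And>x. x \<in> W \<Longrightarrow> (f has_derivative f' x) (at x within W)"
      "\<And>v. Ck k W (\<lambda>x. f' x v)"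
    using Ck_SucE[OF Suc.prems(1)] by metis
  show ?case
    by (intro Ck_SucI[of _ _ "\<lambda>x v. L (f' x v)"] bounded_linear.has_derivative[OF L] f' Suc.IH)
qed

text \<open>The chain rule yields \<open>g' (f x) (f' x v)\<close>, whose direction moves with
  \<open>x\<close>, while \<open>Ck\<close> controls fixed directions only. Expanding
  \<open>f' x v\<close> in a basis of the intermediate space leaves products of scalar functions
  with \<open>g' (f x) b\<close>; this is where that space has to be finite-dimensional.\<close>

lemma Ck_compose:
  fixes f :: "'a::real_normed_vector \<Rightarrow> 'b::euclidean_space"
  shows "Ck k W f \<Longrightarrow> Ck k T g \<Longrightarrow> f ` W \<subseteq> T \<Longrightarrow> Ck k W (\<lambda>x. g (f x))"
proof (induction k arbitrary: g)
  case 0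
  then show ?case using continuous_on_compose2[of T g W f] by simp
next
  case (Suc k)
  obtain f' where f': "\<And>x. x \<in> W \<Longrightarrow> (f has_derivative f' x) (at x within W)"
      "\<And>v. Ck k W (\<lambda>x. f' x v)"
    using Ck_SucE[OF Suc.prems(1)] by metis
  obtain g' where g': "\<And>x. x \<in> T \<Longrightarrow> (g has_derivative g' x) (at x within T)"
      "\<And>v. Ck k T (\<lambda>x. g' x v)"
    using Ck_SucE[OF Suc.prems(2)] by metis
  have fk: "Ck k W f" by (rule Ck_Suc[OF Suc.prems(1)])
  show ?case
  proof (rule Ck_SucI[of _ _ "\<lambda>x v. g' (f x) (f' x v)"])
    fix x assume x: "x \<in> W"
    then have "(g has_derivative g' (f x)) (at (f x) within f ` W)"
      using g'(1) Suc.prems(3) by (meson has_derivative_subset image_subset_iff)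
    then show "((\<lambda>x. g (f x)) has_derivative (\<lambda>v. g' (f x) (f' x v))) (at x within W)"
      by (rule has_derivative_in_compose[OF f'(1)[OF x]])
  next
    fix v
    have "Ck k W (\<lambda>x. \<Sum>b\<in>Basis. (f' x v \<bullet> b) *\<^sub>R g' (f x) b)"
      by (intro Ck_sum Ck_bilinear[OF bounded_bilinear_scaleR]
            Ck_linear_comp[OF bounded_linear_inner_left] f' Suc.IH fk g' Suc.prems)
    moreover have "(\<Sum>b\<in>Basis. (f' x v \<bullet> b) *\<^sub>R g' (f x) b) = g' (f x) (f' x v)" if "x \<in> W" for x
    proof -
      have "f x \<in> T" using that Suc.prems(3) by blast
      from linear_euclidean_sum[OF has_derivative_linear[OF g'(1)[OF this]], of "f' x v"]
      show ?thesis by simp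
    qed
    ultimately show "Ck k W (\<lambda>x. g' (f x) (f' x v))"
      by (rule Ck_cong[rotated])
  qed
qed

text \<open>The derivative is a multiple of another power, so the exponent varies in the induction.
  The exponents -1 and -1/4 occur later, for reciprocals and for \<open>srv_factor\<close>.\<close>

lemma Ck_powr: "Ck k {0<..} (\<lambda>x::real. x powr a)"
proof (induction k arbitrary: a)
  case 0
  show ?case by (auto intro!: continuous_intros)
next
  case (Suc k)
  show ?case
  proof (rule Ck_SucI[of _ _ "\<lambda>x v. v * (a * x powr (a - 1))"])
    fix x :: real assume "x \<in> {0<..}"
    then have "((\<lambda>x. x powr a) has_real_derivative a * x powr (a - 1)) (at x)"
      by (auto intro!: derivative_eq_intros)
    then show "((\<lambda>x. x powr a) has_derivative (\<lambda>v. v * (a * x powr (a - 1)))) (at x within {0<..})"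
      unfolding has_field_derivative_def by (simp add: has_derivative_at_withinI mult_commute_abs)
  qed (intro Ck_bilinear[OF bounded_bilinear_mult] Ck_const Suc.IH)
qed

lemma smooth_in_cong: "(\<And>x. x \<in> W \<Longrightarrow> f x = g x) \<Longrightarrow> smooth_in W f \<Longrightarrow> smooth_in W g"
  by (simp add: smooth_in_def Ck_cong[of W f g])

lemma smooth_in_continuous_on: "smooth_in W f \<Longrightarrow> continuous_on W f"
  by (simp add: smooth_in_def Ck_continuous_on[of 0 W f])

lemma smooth_in_const: "smooth_in W (\<lambda>x. c)"
  by (simp add: smooth_in_def Ck_const)

lemma smooth_in_bounded_linear: "bounded_linear L \<Longrightarrow> smooth_in W L"
  by (simp add: smooth_in_def Ck_bounded_linear)

lemma smooth_in_add: "smooth_in W f \<Longrightarrow> smooth_in W g \<Longrightarrow> smooth_in W (\<lambda>x. f x + g x)"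
  by (simp add: smooth_in_def Ck_add)

lemma smooth_in_sum: "(\<And>i. i \<in> I \<Longrightarrow> smooth_in W (f i)) \<Longrightarrow> smooth_in W (\<lambda>x. \<Sum>i\<in>I. f i x)"
  by (simp add: smooth_in_def Ck_sum)

lemma smooth_in_bilinear:
  "bounded_bilinear b \<Longrightarrow> smooth_in W f \<Longrightarrow> smooth_in W g \<Longrightarrow> smooth_in W (\<lambda>x. b (f x) (g x))"
  by (simp add: smooth_in_def Ck_bilinear)

lemma smooth_in_linear_comp: "bounded_linear L \<Longrightarrow> smooth_in W f \<Longrightarrow> smooth_in W (\<lambda>x. L (f x))"
  by (simp add: smooth_in_def Ck_linear_comp)

lemma smooth_in_compose:
  fixes f :: "'a::real_normed_vector \<Rightarrow> 'b::euclidean_space"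
  shows "smooth_in W f \<Longrightarrow> smooth_in T g \<Longrightarrow> f ` W \<subseteq> T \<Longrightarrow> smooth_in W (\<lambda>x. g (f x))"
  by (simp add: smooth_in_def Ck_compose[of _ W f T g])

lemma smooth_in_powr: "smooth_in {0<..} (\<lambda>x::real. x powr a)"
  by (simp add: smooth_in_def Ck_powr)

lemma smooth_in_Pair:
  assumes "smooth_in W f" "smooth_in W g"
  shows "smooth_in W (\<lambda>x. (f x, g x))"
proof -
  have "bounded_linear (\<lambda>y::'b. (y, 0::'c))" "bounded_linear (\<lambda>y::'c. (0::'b, y))"
    by (intro bounded_linear_Pair bounded_linear_ident bounded_linear_zero)+
  then have "smooth_in W (\<lambda>x. (f x, 0::'c) + (0::'b, g x))"
    by (intro smooth_in_add smooth_in_linear_comp[of "\<lambda>y. (y, 0)"]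
          smooth_in_linear_comp[of "Pair 0"] assms)
  then show ?thesis by simp
qed

lemma smooth_in_has_derivative:
  assumes "smooth_in W f"
  obtains f' where "\<And>x. x \<in> W \<Longrightarrow> (f has_derivative f' x) (at x within W)"
proof -
  have "Ck (Suc 0) W f" using assms by (simp add: smooth_in_def)
  then show ?thesis by (rule Ck_SucE) (rule that)
qed

section \<open>Bastiani smoothness in finite dimension\<close>

text \<open>The third condition makes directional derivatives within \<open>C\<close> unique in every direction.\<close>

definition dir_domain :: "'a::euclidean_space set \<Rightarrow> bool" where
  "dir_domain C \<longleftrightarrow> convex C \<and> interior C \<noteq> {} \<and> (\<forall>x\<in>C. \<forall>v. \<exists>s. s \<noteq> 0 \<and> x + s *\<^sub>R v \<in> C)"

lemma dir_domain_UNIV: "dir_domain UNIV"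
  by (auto simp: dir_domain_def intro: exI[of _ 1])

lemma unit_interval_step: "t \<in> {0..1} \<Longrightarrow> \<exists>s. s \<noteq> 0 \<and> t + s * a \<in> {0..1::real}"
proof (cases "a = 0")
  case False
  assume t: "t \<in> {0..1}"
  \<comment> \<open>From the left endpoint the step goes to 1, from any other point to 0; the sign
    of \<open>s\<close> adapts to that of \<open>a\<close>.\<close>
  show ?thesis
  proof (cases "t = 0")
    case True
    then show ?thesis using False by (intro exI[of _ "1 / a"]) auto
  next
    case False
    then show ?thesis using t \<open>a \<noteq> 0\<close> by (intro exI[of _ "- t / a"]) auto
  qed
qed (auto intro: exI[of _ 1])

lemma dir_domain_unit_interval: "dir_domain {0..1::real}"
  using unit_interval_step by (auto simp: dir_domain_def)

lemma dir_domain_slab: "dir_domain ({0..1::real} \<times> (UNIV :: 'a::euclidean_space set))"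
  using unit_interval_step
  by (auto simp: dir_domain_def interior_Times convex_Times simp del: atLeastAtMost_iff)

lemma dir_domain_at_neq_bot:
  assumes C: "dir_domain C" and W: "openin (top_of_set C) W" and x: "x \<in> W"
  shows "at 0 within {s. x + s *\<^sub>R v \<in> W} \<noteq> bot"
proof -
  obtain N where N: "open N" "W = C \<inter> N" using W by (auto simp: openin_open)
  obtain s0 where s0: "s0 \<noteq> 0" "x + s0 *\<^sub>R v \<in> C"
    using C x N by (auto simp: dir_domain_def)
  obtain r where r: "r > 0" "ball x r \<subseteq> N" using N x open_contains_ball by blast
  have "0 islimpt {s. x + s *\<^sub>R v \<in> W}"
    unfolding islimpt_approachable
  proof (intro allI impI)
    fix e :: real assume e: "e > 0"
    \<comment> \<open>The admissible step \<open>s0\<close> is shrunk by \<open>m\<close>: the bound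
      1 keeps the point on a segment inside the convex set \<open>C\<close>, the second makes the
      step shorter than \<open>e\<close>, the third keeps the point in \<open>ball x r\<close>. The
      summand 1 in the last denominator covers \<open>v = 0\<close>.\<close>
    define m where "m = min 1 (min (e / (2 * \<bar>s0\<bar>)) (r / (2 * (\<bar>s0\<bar> * norm v + 1))))"
    have m0: "m > 0" and m1: "m \<le> 1"
      using e r s0 by (auto simp: m_def intro!: divide_pos_pos add_nonneg_pos)
    have "m \<le> e / (2 * \<bar>s0\<bar>)" by (simp add: m_def)
    then have a: "m * \<bar>s0\<bar> < e" using s0 e by (simp add: field_simps)
    have "m \<le> r / (2 * (\<bar>s0\<bar> * norm v + 1))" by (simp add: m_def)
    moreover have "2 * (\<bar>s0\<bar> * norm v + 1) > 0" by (simp add: add_nonneg_pos)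
    ultimately have "m * (2 * (\<bar>s0\<bar> * norm v + 1)) \<le> r" by (simp only: pos_le_divide_eq)
    then have "2 * (m * \<bar>s0\<bar> * norm v) + 2 * m \<le> r" by (simp add: algebra_simps)
    moreover have "m * \<bar>s0\<bar> * norm v \<ge> 0" using m0 by simp
    ultimately have b: "m * \<bar>s0\<bar> * norm v < r" using m0 by linarith
    have "x + (m * s0) *\<^sub>R v = (1 - m) *\<^sub>R x + m *\<^sub>R (x + s0 *\<^sub>R v)"
      by (simp add: algebra_simps)
    also have "\<dots> \<in> C"
      using C x N(2) s0 m0 m1 by (intro convexD) (auto simp: dir_domain_def)
    finally have "x + (m * s0) *\<^sub>R v \<in> W"
      using N(2) r(2) b m0 by (auto simp: dist_norm abs_mult)
    then show "\<exists>s\<in>{s. x + s *\<^sub>R v \<in> W}. s \<noteq> 0 \<and> dist s 0 < e"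
      using a m0 s0 by (intro bexI[of _ "m * s0"]) (auto simp: abs_mult)
  qed
  then show ?thesis by (simp add: trivial_limit_within)
qed

lemma has_vector_derivative_quotient:
  "(f has_vector_derivative l) (at x within S) \<longleftrightarrow>
     ((\<lambda>y. (f y - f x) /\<^sub>R (y - x)) \<longlongrightarrow> l) (at x within S)"
proof -
  have "((\<lambda>y. (f y - f x) /\<^sub>R (y - x)) \<longlongrightarrow> l) (at x within S) \<longleftrightarrow>
      ((\<lambda>y. norm ((f y - f x) /\<^sub>R (y - x) - l)) \<longlongrightarrow> 0) (at x within S)"
    by (simp only: tendsto_norm_zero_iff LIM_zero_iff)
  also have "\<dots> \<longleftrightarrow>
      ((\<lambda>y. norm (f y - f x - (y - x) *\<^sub>R l) / norm (y - x)) \<longlongrightarrow> 0) (at x within S)"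
  proof (rule filterlim_cong[OF refl refl])
    have "norm ((f y - f x) /\<^sub>R (y - x) - l) = norm (f y - f x - (y - x) *\<^sub>R l) / norm (y - x)"
      if "y \<noteq> x" for y
    proof -
      have "(f y - f x) /\<^sub>R (y - x) - l = (f y - f x - (y - x) *\<^sub>R l) /\<^sub>R (y - x)"
        using that by (simp add: scaleR_diff_right)
      then show ?thesis by (simp add: divide_inverse_commute)
    qed
    then show "\<forall>\<^sub>F y in at x within S. norm ((f y - f x) /\<^sub>R (y - x) - l) =
        norm (f y - f x - (y - x) *\<^sub>R l) / norm (y - x)"
      by (simp add: eventually_at_filter)
  qed
  also have "\<dots> \<longleftrightarrow> (f has_vector_derivative l) (at x within S)"
    unfolding has_vector_derivative_def has_derivative_iff_norm
    by (simp add: bounded_linear_scaleR_left)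
  finally show ?thesis by simp
qed

lemma has_derivative_imp_has_dir_deriv:
  assumes "(f has_derivative f') (at x within W)"
  shows "has_dir_deriv W f x v (f' v)"
proof -
  let ?S = "{s. x + s *\<^sub>R v \<in> W}"
  have 1: "((\<lambda>s. x + s *\<^sub>R v) has_derivative (\<lambda>s. s *\<^sub>R v)) (at 0 within ?S)"
    by (auto intro!: derivative_eq_intros)
  have 2: "(f has_derivative f') (at (x + 0 *\<^sub>R v) within (\<lambda>s. x + s *\<^sub>R v) ` ?S)"
    using assms by (auto intro: has_derivative_subset)
  have "((\<lambda>s. f (x + s *\<^sub>R v)) has_derivative (\<lambda>s. f' (s *\<^sub>R v))) (at 0 within ?S)"
    by (rule has_derivative_in_compose[OF 1 2])
  then have "((\<lambda>s. f (x + s *\<^sub>R v)) has_vector_derivative f' v) (at 0 within ?S)"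
    using linear_scale[OF has_derivative_linear[OF assms]] by (simp add: has_vector_derivative_def)
  then show ?thesis
    by (simp add: has_vector_derivative_quotient has_dir_deriv_def)
qed

lemma has_dir_deriv_unique:
  assumes "dir_domain C" "openin (top_of_set C) W" "x \<in> W"
    and "has_dir_deriv W f x v l" "has_dir_deriv W f x v l'"
  shows "l = (l' :: 'b::real_normed_vector)"
  using assms(4,5) unfolding has_dir_deriv_def
  by (rule tendsto_unique[OF dir_domain_at_neq_bot[OF assms(1-3)]])

lemma dir_deriv_eqI:
  fixes f :: "'a::euclidean_space \<Rightarrow> 'b::real_normed_vector"
  assumes "dir_domain C" "openin (top_of_set C) W" "x \<in> W"
    and "has_dir_deriv W f x v l"
  shows "dir_deriv W f x v = l"
  using assms(4) unfolding has_dir_deriv_def dir_deriv_def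
  by (rule tendsto_Lim[OF dir_domain_at_neq_bot[OF assms(1-3)]])

lemma has_derivative_imp_dir_deriv:
  fixes f :: "'a::euclidean_space \<Rightarrow> 'b::real_normed_vector"
  assumes "dir_domain C" "openin (top_of_set C) W" "x \<in> W"
    and "(f has_derivative f') (at x within W)"
  shows "dir_deriv W f x v = f' v"
  using dir_deriv_eqI[OF assms(1-3) has_derivative_imp_has_dir_deriv[OF assms(4)]] .

lemma has_dir_deriv_scale:
  fixes f :: "'a::real_vector \<Rightarrow> 'b::real_normed_vector"
  assumes "has_dir_deriv W f x v l"
  shows "has_dir_deriv W f x (a *\<^sub>R v) (a *\<^sub>R l)"
proof (cases "a = 0")
  case True
  then show ?thesis by (simp add: has_dir_deriv_def)
next
  case False
  let ?q = "\<lambda>s. (f (x + s *\<^sub>R v) - f x) /\<^sub>R s"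
  let ?F = "at 0 within {s. x + s *\<^sub>R a *\<^sub>R v \<in> W}"
  have "filterlim (\<lambda>s. s * a) (at 0 within {s. x + s *\<^sub>R v \<in> W}) ?F"
    unfolding filterlim_at
  proof
    show "\<forall>\<^sub>F s in ?F. s * a \<in> {s. x + s *\<^sub>R v \<in> W} \<and> s * a \<noteq> 0"
      using False by (auto simp: eventually_at_filter)
    show "((\<lambda>s. s * a) \<longlongrightarrow> 0) ?F"
      by (rule tendsto_eq_intros refl)+ simp
  qed
  from filterlim_compose[OF assms[unfolded has_dir_deriv_def] this]
  have "((\<lambda>s. a *\<^sub>R ?q (s * a)) \<longlongrightarrow> a *\<^sub>R l) ?F"
    by (intro tendsto_intros)
  moreover have "(\<lambda>s. a *\<^sub>R ?q (s * a)) = (\<lambda>s. (f (x + s *\<^sub>R a *\<^sub>R v) - f x) /\<^sub>R s)"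
    using False by (auto simp: fun_eq_iff)
  ultimately show ?thesis
    by (simp only: has_dir_deriv_def)
qed

lemma has_dir_deriv_along_segment:
  fixes f :: "'a::real_vector \<Rightarrow> 'b::real_normed_vector"
  assumes "has_dir_deriv W f (z + s *\<^sub>R d) d l" "\<And>s. s \<in> {0..1} \<Longrightarrow> z + s *\<^sub>R d \<in> W"
  shows "((\<lambda>s. f (z + s *\<^sub>R d)) has_vector_derivative l) (at s within {0..1})"
proof -
  have "filterlim (\<lambda>r. r - s) (at 0 within {r. z + s *\<^sub>R d + r *\<^sub>R d \<in> W}) (at s within {0..1})"
    unfolding filterlim_at
  proof
    show "\<forall>\<^sub>F r in at s within {0..1}. r - s \<in> {r. z + s *\<^sub>R d + r *\<^sub>R d \<in> W} \<and> r - s \<noteq> 0"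
      using assms(2) by (auto simp: eventually_at_filter algebra_simps)
    show "((\<lambda>r. r - s) \<longlongrightarrow> 0) (at s within {0..1})"
      by (rule tendsto_eq_intros refl)+ simp
  qed
  from filterlim_compose[OF assms(1)[unfolded has_dir_deriv_def] this] show ?thesis
    by (simp add: has_vector_derivative_quotient algebra_simps)
qed

section \<open>From continuous directional derivatives to Frechet derivatives\<close>

context
  fixes C W :: "'a::euclidean_space set" and f :: "'a \<Rightarrow> 'b::real_normed_vector" and f' :: "'a \<Rightarrow> 'a \<Rightarrow> 'b"
  assumes C: "dir_domain C" and W: "openin (top_of_set C) W"
    and D: "\<And>x v. x \<in> W \<Longrightarrow> has_dir_deriv W f x v (f' x v)"
    and cont: "continuous_on (W \<times> UNIV) (\<lambda>(x, v). f' x v)"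
begin

lemma dir_deriv_scale: "x \<in> W \<Longrightarrow> f' x (a *\<^sub>R v) = a *\<^sub>R f' x v"
  by (rule has_dir_deriv_unique[OF C W _ D has_dir_deriv_scale[OF D]])

text \<open>Additivity of \<open>f' x\<close> is still unknown here, so only homogeneity may enter:
  it reduces the comparison of \<open>f' y\<close> with \<open>f' x\<close> to the compact unit
  sphere, where joint continuity gives a uniform bound. Both endpoints are free because
  \<open>dir_deriv_add\<close> compares differences none of whose endpoints is
  \<open>x\<close>.\<close>

lemma strict_difference_bound:
  assumes x: "x \<in> W" and e: "e > 0"
  obtains r where "r > 0" "C \<inter> ball x r \<subseteq> W"
    "\<And>y z. y \<in> C \<inter> ball x r \<Longrightarrow> z \<in> C \<inter> ball x r \<Longrightarrow>
       norm (f y - f z - f' x (y - z)) \<le> e * norm (y - z)"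
proof -
  obtain N where N: "open N" "W = C \<inter> N" using W by (auto simp: openin_open)
  have "continuous_on (W \<times> sphere 0 1) (\<lambda>(x, v). f' x v)"
    by (rule continuous_on_subset[OF cont]) auto
  from continuous_on_prod_compactE[OF this compact_sphere x e]
  obtain X where X: "x \<in> X" "open X"
    "\<forall>y\<in>X \<inter> W. \<forall>u\<in>sphere 0 1. dist (f' y u) (f' x u) \<le> e"
    by auto
  have near: "norm (f' y v - f' x v) \<le> e * norm v" if "y \<in> X \<inter> W" for y v
  proof (cases "v = 0")
    case True
    have "f' z 0 = 0" if "z \<in> W" for z
      using dir_deriv_scale[OF that, of 0 0] by simp
    then show ?thesis using that True x by auto
  next
    case False
    define u where "u = v /\<^sub>R norm v"
    have u: "u \<in> sphere 0 1" "v = norm v *\<^sub>R u" using False by (auto simp: u_def)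
    have y: "y \<in> W" using that by auto
    have "norm (f' y v - f' x v) = norm v * norm (f' y u - f' x u)"
      by (subst (1 2) u(2))
         (simp add: dir_deriv_scale[OF x] dir_deriv_scale[OF y] flip: scaleR_diff_right)
    also have "\<dots> \<le> norm v * e"
      using X(3) that u(1) by (intro mult_left_mono) (auto simp: dist_norm)
    finally show ?thesis by (simp add: mult.commute)
  qed
  have "open (N \<inter> X)" "x \<in> N \<inter> X" using N X x by auto
  then obtain r where r: "r > 0" "ball x r \<subseteq> N \<inter> X" using open_contains_ball by blast
  show ?thesis
  proof
    show "r > 0" by fact
    show "C \<inter> ball x r \<subseteq> W" using r N by auto
    fix y z assume y: "y \<in> C \<inter> ball x r" and z: "z \<in> C \<inter> ball x r"
    define d where "d = y - z"
    have K: "convex (C \<inter> ball x r)" using C by (auto simp: dir_domain_def intro: convex_Int)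
    have p: "z + s *\<^sub>R d \<in> X \<inter> W" if "s \<in> {0..1}" for s
    proof -
      have "z + s *\<^sub>R d = (1 - s) *\<^sub>R z + s *\<^sub>R y" by (simp add: d_def algebra_simps)
      also have "\<dots> \<in> C \<inter> ball x r" using that by (intro convexD[OF K] z y) auto
      finally show ?thesis using r N by blast
    qed
    define g where "g s = f (z + s *\<^sub>R d) - s *\<^sub>R f' x d" for s
    have der: "(g has_vector_derivative f' (z + s *\<^sub>R d) d - f' x d) (at s within {0..1})"
      if "s \<in> {0..1}" for s
      unfolding g_def
      using p that
      by (intro has_vector_derivative_diff has_dir_deriv_along_segment[where W=W] D)
         (auto intro!: derivative_eq_intros)
    have "norm (g 1 - g 0) \<le> (e * norm d) * norm (1 - 0 :: real)"
    proof (rule differentiable_bound[OF _ der[unfolded has_vector_derivative_def]])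
      fix s :: real assume s: "s \<in> {0..1}"
      show "onorm (\<lambda>h. h *\<^sub>R (f' (z + s *\<^sub>R d) d - f' x d)) \<le> e * norm d"
        using mult_left_mono[OF near[OF p[OF s], of d], of "\<bar>_\<bar>"] e
        by (intro onorm_bound) (auto simp: mult.commute)
    qed auto
    then show "norm (f y - f z - f' x (y - z)) \<le> e * norm (y - z)"
      by (simp add: g_def d_def algebra_simps)
  qed
qed

text \<open>
  The difference quotients are compared at the points \<open>x + s M (p - x)\<close> for an interior point \<open>p\<close>,
  because \<open>x + s v\<close> may lie outside \<open>C\<close>.
\<close>

lemma dir_deriv_add:
  assumes x: "x \<in> W"
  shows "f' x (v + w) = f' x v + f' x w"
proof -
  obtain p \<delta> where p: "\<delta> > 0" "ball p \<delta> \<subseteq> C"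
    using C by (auto simp: dir_domain_def mem_interior)
  \<comment> \<open>\<open>M\<close> is so large that \<open>u /\<^sub>R M\<close> is shorter than
    \<delta> for \<open>u = v\<close> and \<open>u = v + w\<close>. Then
    \<open>x + (s * M) *\<^sub>R (p - x) + s *\<^sub>R u\<close> is the convex combination of
    \<open>x\<close> and \<open>p + u /\<^sub>R M\<close> with weight \<open>s * M\<close>, hence
    lies in \<open>C\<close>.\<close>
  define M where "M = (norm v + norm (v + w) + 1) / \<delta>"
  have M: "M > 0" "norm v < M * \<delta>" "norm (v + w) < M * \<delta>"
    using p by (auto simp: M_def add_nonneg_pos)
  have conv: "convex C" using C by (simp add: dir_domain_def)
  have xC: "x \<in> C" using x W by (auto simp: openin_open)
  have in_C: "x + (s * M) *\<^sub>R (p - x) + s *\<^sub>R u \<in> C" if "norm u < M * \<delta>" "0 \<le> s" "s * M \<le> 1" for u s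
  proof -
    have "norm (u /\<^sub>R M) < \<delta>" using that(1) M(1) by (simp add: field_simps)
    then have "p + u /\<^sub>R M \<in> C" using p(2) by (auto simp: dist_norm)
    then have "(1 - s * M) *\<^sub>R x + (s * M) *\<^sub>R (p + u /\<^sub>R M) \<in> C"
      using that M by (intro convexD[OF conv xC]) auto
    moreover have "(1 - s * M) *\<^sub>R x + (s * M) *\<^sub>R (p + u /\<^sub>R M) = x + (s * M) *\<^sub>R (p - x) + s *\<^sub>R u"
      using M by (simp add: algebra_simps)
    ultimately show ?thesis by simp
  qed
  define L where "L = norm v + norm w + norm (v + w)"
  have "norm (f' x (v + w) - f' x v - f' x w) \<le> e * L" if e: "e > 0" for e
  proof -
    obtain r where r: "r > 0" and bd: "\<And>y z. y \<in> C \<inter> ball x r \<Longrightarrow> z \<in> C \<inter> ball x r \<Longrightarrow>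
       norm (f y - f z - f' x (y - z)) \<le> e * norm (y - z)"
      using strict_difference_bound[OF x e] by metis
    \<comment> \<open>All test points lie within distance \<open>s * k\<close> of \<open>x\<close>;
      the two bounds on \<open>s\<close> keep the weight \<open>s * M\<close> at most 1 and the
      points inside \<open>ball x r\<close>.\<close>
    define k where "k = M * norm (p - x) + L + 1"
    have k: "k > 0" using M by (auto simp: k_def L_def intro!: add_nonneg_pos)
    define s where "s = min (1 / M) (r / (2 * k))"
    have s: "s > 0" "s * M \<le> 1" "s * k < r"
    proof -
      show "s > 0" using r M k by (simp add: s_def)
      have "s \<le> 1 / M" "s \<le> r / (2 * k)" by (simp_all add: s_def)
      then show "s * M \<le> 1" "s * k < r" using M k r by (simp_all add: field_simps)
    qed
    have mem: "x + (s * M) *\<^sub>R (p - x) + s *\<^sub>R u \<in> C \<inter> ball x r"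
      if "norm u < M * \<delta>" "norm u \<le> L" for u
    proof -
      have "norm ((s * M) *\<^sub>R (p - x) + s *\<^sub>R u) \<le> s * (M * norm (p - x)) + s * norm u"
        using norm_triangle_ineq[of "(s * M) *\<^sub>R (p - x)" "s *\<^sub>R u"] s M by simp
      also have "\<dots> \<le> s * k"
        using that(2) s(1) unfolding k_def distrib_left[symmetric] by (intro mult_left_mono) auto
      also have "\<dots> < r" by fact
      finally have "x + ((s * M) *\<^sub>R (p - x) + s *\<^sub>R u) \<in> ball x r"
        unfolding mem_ball by (subst dist_commute) (simp only: dist_norm add_diff_cancel_left')
      then have "x + (s * M) *\<^sub>R (p - x) + s *\<^sub>R u \<in> ball x r"
        by (simp only: add.assoc)
      then show ?thesis using in_C[OF that(1)] s by simp
    qed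
    define z where "z = x + (s * M) *\<^sub>R (p - x)"
    have z0: "z \<in> C \<inter> ball x r" using mem[of 0] p M by (simp add: z_def L_def)
    have z1: "z + s *\<^sub>R v \<in> C \<inter> ball x r" using mem[of v] M by (simp add: z_def L_def)
    have z2: "z + s *\<^sub>R (v + w) \<in> C \<inter> ball x r" using mem[of "v + w"] M by (simp add: z_def L_def)
    \<comment> \<open>These are the errors of linearisation along the three sides of the triangle
      \<open>z\<close>, \<open>z + s *\<^sub>R v\<close>, \<open>z + s *\<^sub>R (v + w)\<close>. In
      \<open>B + E - A\<close> the values of \<open>f\<close> cancel and only the defect of
      additivity remains.\<close>
    define A where "A = f (z + s *\<^sub>R (v + w)) - f z - s *\<^sub>R f' x (v + w)"
    define B where "B = f (z + s *\<^sub>R v) - f z - s *\<^sub>R f' x v"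
    define E where "E = f (z + s *\<^sub>R (v + w)) - f (z + s *\<^sub>R v) - s *\<^sub>R f' x w"
    have "norm A \<le> e * (s * norm (v + w))" "norm B \<le> e * (s * norm v)" "norm E \<le> e * (s * norm w)"
      using bd[OF z2 z0] bd[OF z1 z0] bd[OF z2 z1] s(1)
      by (simp_all add: A_def B_def E_def dir_deriv_scale[OF x] flip: scaleR_diff_right)
    moreover have "s *\<^sub>R (f' x (v + w) - f' x v - f' x w) = B + E - A"
      by (simp add: A_def B_def E_def algebra_simps)
    moreover have "norm (B + E - A) \<le> norm A + norm B + norm E"
      using norm_triangle_ineq4[of "B + E" A] norm_triangle_ineq[of B E] by linarith
    ultimately have "norm (s *\<^sub>R (f' x (v + w) - f' x v - f' x w)) \<le>
        e * (s * norm (v + w)) + e * (s * norm v) + e * (s * norm w)"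
      by simp
    also have "\<dots> = s * (e * L)" by (simp add: L_def algebra_simps)
    finally show ?thesis
      unfolding norm_scaleR abs_of_pos[OF s(1)] using s(1) by (simp only: mult_le_cancel_left_pos)
  qed
  note * = this
  have "norm (f' x (v + w) - f' x v - f' x w) \<le> 0"
  proof (rule field_le_epsilon)
    fix e :: real assume "e > 0"
    moreover have "L \<ge> 0" by (simp add: L_def)
    \<comment> \<open>\<open>L\<close> may vanish, hence the denominator
      \<open>L + 1\<close>.\<close>
    ultimately have "e / (L + 1) > 0" "e / (L + 1) * L \<le> e" by (auto simp: field_simps)
    with *[of "e / (L + 1)"]
    show "norm (f' x (v + w) - f' x v - f' x w) \<le> 0 + e" by simp
  qed
  then have "f' x (v + w) - f' x v - f' x w = 0" by simp
  then show ?thesis by (simp only: diff_diff_eq right_minus_eq)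
qed

lemma has_derivative_dir_deriv:
  assumes x: "x \<in> W"
  shows "(f has_derivative f' x) (at x within W)"
  unfolding has_derivative_within_alt
proof (intro conjI allI impI)
  show "bounded_linear (f' x)"
    by (simp add: linear_conv_bounded_linear[symmetric] linearI dir_deriv_add[OF x] dir_deriv_scale[OF x])
  fix e :: real assume e: "e > 0"
  obtain r where r: "r > 0" and bd: "\<And>y z. y \<in> C \<inter> ball x r \<Longrightarrow> z \<in> C \<inter> ball x r \<Longrightarrow>
       norm (f y - f z - f' x (y - z)) \<le> e * norm (y - z)"
    using strict_difference_bound[OF x e] by metis
  have "W \<subseteq> C" using W by (auto simp: openin_open)
  then show "\<exists>d>0. \<forall>y\<in>W. norm (y - x) < d \<longrightarrow> norm (f y - f x - f' x (y - x)) \<le> e * norm (y - x)"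
    using r x by (intro exI[of _ r] conjI ballI impI bd) (auto simp: dist_norm norm_minus_commute)
qed

end

section \<open>Bastiani smoothness and the classes \<open>Ck\<close> agree\<close>

lemma iter_dir_deriv_cong_dirs:
  "(\<And>j. j < k \<Longrightarrow> y j = z j) \<Longrightarrow> iter_dir_deriv W f k y = iter_dir_deriv W f k z"
  by (induction k) auto

text \<open>The definition adds the last direction outermost. Splitting off the innermost one
  instead lets inductions replace \<open>f\<close> by one of its directional derivatives.\<close>

lemma iter_dir_deriv_Suc_first:
  "iter_dir_deriv W f (Suc k) y = iter_dir_deriv W (\<lambda>x. dir_deriv W f x (y 0)) k (y \<circ> Suc)"
  by (induction k) simp_all

lemma dir_deriv_cong:
  assumes "\<And>x. x \<in> W \<Longrightarrow> f x = g x" "x \<in> W"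
  shows "dir_deriv W f x v = dir_deriv W g x v"
proof -
  have "((\<lambda>s. (f (x + s *\<^sub>R v) - f x) /\<^sub>R s) \<longlongrightarrow> l) (at 0 within {s. x + s *\<^sub>R v \<in> W}) \<longleftrightarrow>
        ((\<lambda>s. (g (x + s *\<^sub>R v) - g x) /\<^sub>R s) \<longlongrightarrow> l) (at 0 within {s. x + s *\<^sub>R v \<in> W})" for l
    using assms by (intro filterlim_cong) (auto simp: eventually_at_filter)
  then show ?thesis by (simp add: dir_deriv_def Topological_Spaces.Lim_def)
qed

lemma iter_dir_deriv_cong:
  assumes "\<And>x. x \<in> W \<Longrightarrow> f x = g x" "x \<in> W"
  shows "iter_dir_deriv W f k y x = iter_dir_deriv W g k y x"
  using assms(2)
proof (induction k arbitrary: x)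
  case (Suc k)
  then show ?case by (auto intro: dir_deriv_cong)
qed (use assms(1) in auto)

text \<open>The function \<open>iter_dir_deriv W f m y\<close> depends only on the entries of
  \<open>y\<close> below \<open>m\<close>. Letting entry \<open>m\<close> vary thus exposes its
  derivative in every direction, and joint continuity in the whole sequence restricts to joint
  continuity in \<open>(x, v)\<close>.\<close>

lemma bastiani_smooth_on_has_derivative:
  fixes f :: "'a::euclidean_space \<Rightarrow> 'b::real_normed_vector"
  assumes C: "dir_domain C" and W: "openin (top_of_set C) W" and f: "bastiani_smooth_on W f"
    and x: "x \<in> W"
  shows "(iter_dir_deriv W f m y has_derivative (\<lambda>v. iter_dir_deriv W f (Suc m) (y(m := v)) x))
           (at x within W)"
proof (rule has_derivative_dir_deriv[OF C W _ _ x])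
  fix x v assume x: "x \<in> W"
  have "\<exists>l. has_dir_deriv W (iter_dir_deriv W f m (y(m := v))) x ((y(m := v)) m) l"
    using f x unfolding bastiani_smooth_on_def by blast
  moreover have [simp]: "iter_dir_deriv W f m (y(m := v)) = iter_dir_deriv W f m y"
    by (rule iter_dir_deriv_cong_dirs) auto
  ultimately obtain l where "has_dir_deriv W (iter_dir_deriv W f m y) x v l" by auto
  with dir_deriv_eqI[OF C W x this]
  show "has_dir_deriv W (iter_dir_deriv W f m y) x v (iter_dir_deriv W f (Suc m) (y(m := v)) x)"
    by simp
next
  let ?h = "\<lambda>p. (fst p, y(m := snd p))"
  have h: "continuous_on (W \<times> UNIV) ?h"
  proof (intro continuous_on_Pair continuous_on_coordinatewise_then_product)
    fix i
    show "continuous_on (W \<times> UNIV) (\<lambda>p. (y(m := snd p)) i)"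
      by (cases "i = m") (auto intro: continuous_intros)
  qed (auto intro: continuous_intros)
  have g: "continuous_on (W \<times> UNIV) (\<lambda>p. iter_dir_deriv W f (Suc m) (snd p) (fst p))"
    using f unfolding bastiani_smooth_on_def case_prod_unfold by blast
  have "?h ` (W \<times> UNIV) \<subseteq> W \<times> UNIV" by auto
  from continuous_on_compose2[OF g h this] show "continuous_on (W \<times> UNIV) (\<lambda>(x, v). iter_dir_deriv W f (Suc m) (y(m := v)) x)"
    by (simp only: case_prod_unfold fst_conv snd_conv)
qed

lemma bastiani_smooth_on_imp_smooth_in:
  fixes f :: "'a::euclidean_space \<Rightarrow> 'b::real_normed_vector"
  assumes C: "dir_domain C" and W: "openin (top_of_set C) W" and f: "bastiani_smooth_on W f"
  shows "smooth_in W f"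
proof -
  have "Ck k W (iter_dir_deriv W f m y)" for k m y
  proof (induction k arbitrary: m y)
    case 0
    have "\<And>x. x \<in> W \<Longrightarrow> \<exists>D. (iter_dir_deriv W f m y has_derivative D) (at x within W)"
      using bastiani_smooth_on_has_derivative[OF C W f] by blast
    then show ?case
      by (simp add: continuous_on_eq_continuous_within) (blast intro: has_derivative_continuous)
  next
    case (Suc k)
    show ?case
      by (rule Ck_SucI[OF bastiani_smooth_on_has_derivative[OF C W f] Suc.IH])
  qed
  from this[of _ 0] show ?thesis by (simp add: smooth_in_def)
qed

lemma smooth_in_has_derivative_dir_deriv:
  fixes f :: "'a::euclidean_space \<Rightarrow> 'b::real_normed_vector"
  assumes C: "dir_domain C" and W: "openin (top_of_set C) W" and f: "smooth_in W f"
    and x: "x \<in> W"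
  shows "(f has_derivative dir_deriv W f x) (at x within W)"
proof -
  obtain f' where f': "\<And>x. x \<in> W \<Longrightarrow> (f has_derivative f' x) (at x within W)"
    using smooth_in_has_derivative[OF f] by metis
  have "dir_deriv W f x = f' x"
    by (rule ext) (rule has_derivative_imp_dir_deriv[OF C W x f'[OF x]])
  then show ?thesis using f'[OF x] by simp
qed

text \<open>Each order \<open>k\<close> comes with its own \<open>f'\<close>; uniqueness of
  derivatives on a relatively open part of a \<open>dir_domain\<close> identifies all of them with
  \<open>dir_deriv W f\<close>.\<close>

lemma smooth_in_dir_deriv:
  fixes f :: "'a::euclidean_space \<Rightarrow> 'b::real_normed_vector"
  assumes C: "dir_domain C" and W: "openin (top_of_set C) W" and f: "smooth_in W f"
  shows "smooth_in W (\<lambda>x. dir_deriv W f x v)"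
  unfolding smooth_in_def
proof
  fix k
  have "Ck (Suc k) W f" using f by (simp add: smooth_in_def)
  then obtain f' where f': "\<And>x. x \<in> W \<Longrightarrow> (f has_derivative f' x) (at x within W)"
      "\<And>v. Ck k W (\<lambda>x. f' x v)"
    using Ck_SucE by metis
  show "Ck k W (\<lambda>x. dir_deriv W f x v)"
    by (rule Ck_cong[OF _ f'(2)])
       (simp add: has_derivative_imp_dir_deriv[OF C W _ f'(1)])
qed

lemma smooth_in_iter_dir_deriv:
  fixes f :: "'a::euclidean_space \<Rightarrow> 'b::real_normed_vector"
  assumes C: "dir_domain C" and W: "openin (top_of_set C) W" and f: "smooth_in W f"
  shows "smooth_in W (iter_dir_deriv W f k y)"
  by (induction k) (auto intro: smooth_in_dir_deriv[OF C W] f)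

lemma iter_dir_deriv_sum:
  fixes f :: "'i \<Rightarrow> 'a::euclidean_space \<Rightarrow> 'b::real_normed_vector"
  assumes C: "dir_domain C" and W: "openin (top_of_set C) W"
    and "\<And>i. i \<in> I \<Longrightarrow> smooth_in W (f i)" "x \<in> W"
  shows "iter_dir_deriv W (\<lambda>x. \<Sum>i\<in>I. a i *\<^sub>R f i x) k y x = (\<Sum>i\<in>I. a i *\<^sub>R iter_dir_deriv W (f i) k y x)"
  using assms(3)
proof (induction k arbitrary: f y)
  case (Suc k)
  have "iter_dir_deriv W (\<lambda>x. \<Sum>i\<in>I. a i *\<^sub>R f i x) (Suc k) y x =
      iter_dir_deriv W (\<lambda>x. dir_deriv W (\<lambda>x. \<Sum>i\<in>I. a i *\<^sub>R f i x) x (y 0)) k (y \<circ> Suc) x"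
    by (simp only: iter_dir_deriv_Suc_first)
  also have "\<dots> = iter_dir_deriv W (\<lambda>x. \<Sum>i\<in>I. a i *\<^sub>R dir_deriv W (f i) x (y 0)) k (y \<circ> Suc) x"
  proof (rule iter_dir_deriv_cong[OF _ assms(4)])
    fix x assume x: "x \<in> W"
    have "((\<lambda>x. \<Sum>i\<in>I. a i *\<^sub>R f i x) has_derivative (\<lambda>v. \<Sum>i\<in>I. a i *\<^sub>R dir_deriv W (f i) x v)) (at x within W)"
      by (intro has_derivative_sum has_derivative_scaleR_right
            smooth_in_has_derivative_dir_deriv[OF C W Suc.prems x])
    from has_derivative_imp_dir_deriv[OF C W x this]
    show "dir_deriv W (\<lambda>x. \<Sum>i\<in>I. a i *\<^sub>R f i x) x (y 0) = (\<Sum>i\<in>I. a i *\<^sub>R dir_deriv W (f i) x (y 0))" .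
  qed
  also have "\<dots> = (\<Sum>i\<in>I. a i *\<^sub>R iter_dir_deriv W (\<lambda>x. dir_deriv W (f i) x (y 0)) k (y \<circ> Suc) x)"
    by (intro Suc.IH smooth_in_dir_deriv[OF C W] Suc.prems)
  finally show ?case by (simp only: iter_dir_deriv_Suc_first)
qed simp

text \<open>Joint continuity holds since \<open>iter_dir_deriv W f k y x\<close> is multilinear in \<open>y 0, \<dots>, y (k-1)\<close>.\<close>

lemma smooth_in_continuous_iter_dir_deriv:
  fixes f :: "'a::euclidean_space \<Rightarrow> 'b::real_normed_vector"
  assumes C: "dir_domain C" and W: "openin (top_of_set C) W"
  shows "smooth_in W f \<Longrightarrow> continuous_on (W \<times> UNIV) (\<lambda>(x, y). iter_dir_deriv W f k y x)"
proof (induction k arbitrary: f)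
  case 0
  have "continuous_on (W \<times> UNIV) (\<lambda>p. f (fst p))"
    by (rule continuous_on_compose2[OF smooth_in_continuous_on[OF 0]])
       (auto intro: continuous_intros)
  then show ?case by (simp add: case_prod_unfold)
next
  case (Suc k)
  let ?fb = "\<lambda>b x. dir_deriv W f x b"
  \<comment> \<open>Only the innermost direction is expanded in the basis. The others stay in the
    shifted sequence \<open>y \<circ> Suc\<close> and are covered by the induction hypothesis for
    \<open>?fb b\<close>.\<close>
  have eq: "iter_dir_deriv W f (Suc k) y x = (\<Sum>b\<in>Basis. (y 0 \<bullet> b) *\<^sub>R iter_dir_deriv W (?fb b) k (y \<circ> Suc) x)"
    if x: "x \<in> W" for x y
  proof -
    have "iter_dir_deriv W f (Suc k) y x = iter_dir_deriv W (?fb (y 0)) k (y \<circ> Suc) x"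
      by (simp only: iter_dir_deriv_Suc_first)
    also have "\<dots> = iter_dir_deriv W (\<lambda>x. \<Sum>b\<in>Basis. (y 0 \<bullet> b) *\<^sub>R ?fb b x) k (y \<circ> Suc) x"
    proof (rule iter_dir_deriv_cong[OF _ x])
      fix x assume x: "x \<in> W"
      show "?fb (y 0) x = (\<Sum>b\<in>Basis. (y 0 \<bullet> b) *\<^sub>R ?fb b x)"
        by (rule linear_euclidean_sum)
           (rule has_derivative_linear[OF smooth_in_has_derivative_dir_deriv[OF C W Suc.prems x]])
    qed
    also have "\<dots> = (\<Sum>b\<in>Basis. (y 0 \<bullet> b) *\<^sub>R iter_dir_deriv W (?fb b) k (y \<circ> Suc) x)"
      by (rule iter_dir_deriv_sum[OF C W _ x]) (rule smooth_in_dir_deriv[OF C W Suc.prems])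
    finally show ?thesis .
  qed
  have coord: "continuous_on (W \<times> UNIV) (\<lambda>p. snd p i)" for i :: nat and W :: "'a set"
    using continuous_on_product_then_coordinatewise[of "W \<times> UNIV" snd i]
    by (simp add: continuous_on_snd)
  have shift: "continuous_on (W \<times> UNIV) (\<lambda>p. (fst p, snd p \<circ> Suc))" for W :: "'a set"
    by (intro continuous_on_Pair continuous_on_coordinatewise_then_product)
       (auto intro: continuous_intros coord)
  have "continuous_on (W \<times> UNIV) (\<lambda>p. iter_dir_deriv W (?fb b) k (snd p \<circ> Suc) (fst p))" for b
  proof -
    have "continuous_on (W \<times> UNIV) (\<lambda>p. iter_dir_deriv W (?fb b) k (snd p) (fst p))"
      using Suc.IH[OF smooth_in_dir_deriv[OF C W Suc.prems]] by (simp only: case_prod_unfold)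
    from continuous_on_compose2[OF this shift[of W]] show ?thesis
      by (simp add: image_subset_iff)
  qed
  then have "continuous_on (W \<times> UNIV)
      (\<lambda>p. \<Sum>b\<in>Basis. (snd p 0 \<bullet> b) *\<^sub>R iter_dir_deriv W (?fb b) k (snd p \<circ> Suc) (fst p))"
    by (intro continuous_intros coord)
  then show ?case
    by (rule continuous_on_eq) (auto simp only: eq case_prod_unfold mem_Times_iff fst_conv snd_conv)
qed

lemma smooth_in_imp_bastiani_smooth_on:
  fixes f :: "'a::euclidean_space \<Rightarrow> 'b::real_normed_vector"
  assumes C: "dir_domain C" and W: "openin (top_of_set C) W" and f: "smooth_in W f"
  shows "bastiani_smooth_on W f"
  unfolding bastiani_smooth_on_def
  using has_derivative_imp_has_dir_deriv[OF smooth_in_has_derivative_dir_deriv[OF C W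
          smooth_in_iter_dir_deriv[OF C W f]]]
    smooth_in_continuous_iter_dir_deriv[OF C W f]
  by blast

section \<open>Convergence of all derivatives of smooth paths\<close>

abbreviation path_deriv :: "(real \<Rightarrow> 'a::real_normed_vector) \<Rightarrow> real \<Rightarrow> 'a" where
  "path_deriv f \<equiv> nth_deriv (Suc 0) {0..1} f"

lemma nth_deriv_nth_deriv: "nth_deriv k S (nth_deriv m S f) = nth_deriv (k + m) S f"
  by (induction k) auto

lemma path_deriv_eqI:
  assumes "t \<in> {0..1}" "(f has_vector_derivative D) (at t within {0..1})"
  shows "path_deriv f t = D"
  using vector_derivative_within[OF at_within_unit_interval[OF assms(1)] assms(2)] by simp

lemma smooth_path_on_has_vector_derivative:
  assumes "smooth_path_on S f" "t \<in> S"
  shows "(nth_deriv k S f has_vector_derivative nth_deriv (Suc k) S f t) (at t within S)"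
  using assms by (simp add: smooth_path_on_def flip: vector_derivative_works)

lemma smooth_path_on_nth_deriv: "smooth_path_on S f \<Longrightarrow> smooth_path_on S (nth_deriv m S f)"
  by (simp add: smooth_path_on_def nth_deriv_nth_deriv)

lemma smooth_path_on_continuous_on:
  "smooth_path_on S f \<Longrightarrow> continuous_on S (nth_deriv k S f)"
  by (simp add: smooth_path_on_def continuous_on_eq_continuous_within differentiable_imp_continuous_within)

text \<open>This gives smooth paths all closure properties of \<open>smooth_in\<close>. On the line
  the derivative in direction \<open>v\<close> is \<open>v\<close> times the one in direction 1, so
  both recursions run through the same functions.\<close>

lemma smooth_path_on_unit_interval_iff: "smooth_path_on {0..1} f \<longleftrightarrow> smooth_in {0..1} f"
proof
  assume f: "smooth_path_on {0..1} f"
  have "Ck k {0..1} (nth_deriv m {0..1} f)" for k m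
  proof (induction k arbitrary: m)
    case 0
    show ?case using smooth_path_on_continuous_on[OF f] by simp
  next
    case (Suc k)
    show ?case
    proof (rule Ck_SucI)
      fix t :: real assume "t \<in> {0..1}"
      then show "(nth_deriv m {0..1} f has_derivative (\<lambda>v. v *\<^sub>R nth_deriv (Suc m) {0..1} f t))
          (at t within {0..1})"
        using smooth_path_on_has_vector_derivative[OF f] unfolding has_vector_derivative_def by blast
    next
      fix v :: real
      show "Ck k {0..1} (\<lambda>t. v *\<^sub>R nth_deriv (Suc m) {0..1} f t)"
        by (rule Ck_linear_comp[OF bounded_linear_scaleR_right Suc.IH])
    qed
  qed
  from this[of _ 0] show "smooth_in {0..1} f" by (simp add: smooth_in_def)
next
  assume f: "smooth_in {0..1} f"
  have W: "openin (top_of_set {0..1}) {0..1::real}" by simp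
  note D = smooth_in_has_derivative_dir_deriv[OF dir_domain_unit_interval W]
  have sm: "smooth_in {0..1} (nth_deriv m {0..1} f)" for m
  proof (induction m)
    case (Suc m)
    show ?case
    proof (rule smooth_in_cong[OF _ smooth_in_dir_deriv[OF dir_domain_unit_interval W Suc.IH, of 1]])
      fix t :: real assume t: "t \<in> {0..1}"
      let ?D = "dir_deriv {0..1} (nth_deriv m {0..1} f) t"
      have "?D = (\<lambda>v. v *\<^sub>R ?D 1)"
      proof
        fix v :: real
        show "?D v = v *\<^sub>R ?D 1"
          using linear_scale[OF has_derivative_linear[OF D[OF Suc.IH t]], of v 1]
          unfolding real_scaleR_def mult_1_right .
      qed
      then have "(nth_deriv m {0..1} f has_vector_derivative ?D 1) (at t within {0..1})"
        using D[OF Suc.IH t] unfolding has_vector_derivative_def by metis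
      from path_deriv_eqI[OF t this]
      show "dir_deriv {0..1} (nth_deriv m {0..1} f) t 1 = nth_deriv (Suc m) {0..1} f t" by simp
    qed
  qed (use f in simp)
  show "smooth_path_on {0..1} f"
    unfolding smooth_path_on_def differentiable_def using D[OF sm] by blast
qed

lemma smooth_path_on_superposition:
  fixes f :: "real \<Rightarrow> 'a::euclidean_space"
  assumes "smooth_path_on {0..1} f" "smooth_in U h" "f ` {0..1} \<subseteq> U"
  shows "smooth_path_on {0..1} (\<lambda>t. h (f t))"
  using assms smooth_in_compose unfolding smooth_path_on_unit_interval_iff by blast

lemma smooth_path_on_bilinear:
  assumes "bounded_bilinear b" "smooth_path_on {0..1} f" "smooth_path_on {0..1} g"
  shows "smooth_path_on {0..1} (\<lambda>t. b (f t) (g t))"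
  using assms smooth_in_bilinear unfolding smooth_path_on_unit_interval_iff by blast

lemma smooth_path_on_linear:
  assumes "bounded_linear L" "smooth_path_on {0..1} f"
  shows "smooth_path_on {0..1} (\<lambda>t. L (f t))"
  using assms smooth_in_linear_comp unfolding smooth_path_on_unit_interval_iff by blast

lemma nth_deriv_linear:
  assumes L: "bounded_linear L" and f: "smooth_path_on {0..1} f"
  shows "t \<in> {0..1} \<Longrightarrow> nth_deriv k {0..1} (\<lambda>t. L (f t)) t = L (nth_deriv k {0..1} f t)"
proof (induction k arbitrary: t)
  case (Suc k)
  have "((\<lambda>t. L (nth_deriv k {0..1} f t)) has_vector_derivative L (nth_deriv (Suc k) {0..1} f t)) (at t within {0..1})"
    by (rule bounded_linear.has_vector_derivative[OF L smooth_path_on_has_vector_derivative[OF f Suc.prems]])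
  then have "(nth_deriv k {0..1} (\<lambda>t. L (f t)) has_vector_derivative L (nth_deriv (Suc k) {0..1} f t)) (at t within {0..1})"
    by (rule has_vector_derivative_transform[OF Suc.prems, rotated]) (rule Suc.IH)
  from path_deriv_eqI[OF Suc.prems this] show ?case by simp
qed simp

text \<open>Convergence in the \<open>C^k\<close> norm, for plain functions rather than for
  \<open>smooth_curve\<close>: a superposition need be smooth only eventually along the filter, once
  the paths have entered the domain of the superposed function.\<close>

definition Ck_limit ::
    "nat \<Rightarrow> 'i filter \<Rightarrow> ('i \<Rightarrow> real \<Rightarrow> 'a::real_normed_vector) \<Rightarrow> (real \<Rightarrow> 'a) \<Rightarrow> bool" where
  "Ck_limit k F f g \<longleftrightarrow>
     (\<forall>j\<le>k. uniform_limit {0..1} (\<lambda>s. nth_deriv j {0..1} (f s)) (nth_deriv j {0..1} g) F)"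

lemma Ck_limit_0: "Ck_limit 0 F f g \<longleftrightarrow> uniform_limit {0..1} f g F"
  by (simp add: Ck_limit_def)

text \<open>With the innermost derivative split off, an induction on \<open>k\<close> can
  differentiate a product or a superposition once and treat the result as a new expression of lower
  order.\<close>

lemma Ck_limit_Suc:
  "Ck_limit (Suc k) F f g \<longleftrightarrow>
     uniform_limit {0..1} f g F \<and> Ck_limit k F (\<lambda>s. path_deriv (f s)) (path_deriv g)"
proof -
  have "Ck_limit (Suc k) F f g \<longleftrightarrow> uniform_limit {0..1} f g F \<and>
     (\<forall>j\<le>k. uniform_limit {0..1} (\<lambda>s. nth_deriv (Suc j) {0..1} (f s)) (nth_deriv (Suc j) {0..1} g) F)"
    (is "?l \<longleftrightarrow> ?a \<and> ?b")
  proof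
    assume *: "?a \<and> ?b"
    have "uniform_limit {0..1} (\<lambda>s. nth_deriv j {0..1} (f s)) (nth_deriv j {0..1} g) F"
      if "j \<le> Suc k" for j
      using * that by (cases j) (auto simp del: nth_deriv.simps(2))
    then show ?l by (simp only: Ck_limit_def) blast
  next
    assume l: ?l
    then have ?b by (auto simp: Ck_limit_def simp del: nth_deriv.simps(2))
    moreover have ?a using l[unfolded Ck_limit_def, rule_format, of 0] by simp
    ultimately show "?a \<and> ?b" by simp
  qed
  moreover have "nth_deriv (Suc j) S h = nth_deriv j S (nth_deriv (Suc 0) S h)" for j S and h :: "real \<Rightarrow> 'b"
    by (simp only: nth_deriv_nth_deriv add_Suc_right add_0_right)
  ultimately show ?thesis unfolding Ck_limit_def by simp
qed

lemma Ck_limit_mono: "Ck_limit k F f g \<Longrightarrow> j \<le> k \<Longrightarrow> Ck_limit j F f g"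
  unfolding Ck_limit_def by auto

lemma Ck_limit_cong:
  assumes "\<forall>\<^sub>F s in F. \<forall>t\<in>{0..1}. f s t = f' s t" "\<And>t. t \<in> {0..1} \<Longrightarrow> g t = g' t"
    and "Ck_limit k F f g"
  shows "Ck_limit k F f' g'"
  unfolding Ck_limit_def
proof (intro allI impI)
  fix j assume "j \<le> k"
  have "\<forall>\<^sub>F s in F. \<forall>t\<in>{0..1}. nth_deriv j {0..1} (f s) t = nth_deriv j {0..1} (f' s) t"
    using assms(1)
  proof eventually_elim
    case (elim s)
    show ?case
    proof
      fix t :: real assume "t \<in> {0..1}"
      then show "nth_deriv j {0..1} (f s) t = nth_deriv j {0..1} (f' s) t"
        using elim by (intro nth_deriv_cong) auto
    qed
  qed
  moreover have "nth_deriv j {0..1} g t = nth_deriv j {0..1} g' t" if "t \<in> {0..1}" for t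
    by (rule nth_deriv_cong[OF assms(2) that])
  moreover have "uniform_limit {0..1} (\<lambda>s. nth_deriv j {0..1} (f s)) (nth_deriv j {0..1} g) F"
    using assms(3) \<open>j \<le> k\<close> unfolding Ck_limit_def by blast
  ultimately show "uniform_limit {0..1} (\<lambda>s. nth_deriv j {0..1} (f' s)) (nth_deriv j {0..1} g') F"
    by (rule uniform_limit_cong[THEN iffD1])
qed

lemma Ck_limit_const: "Ck_limit k F (\<lambda>s. g) g"
  unfolding Ck_limit_def by (simp add: uniform_limit_const)

lemma Ck_limit_linear:
  assumes L: "bounded_linear L" and f: "\<forall>\<^sub>F s in F. smooth_path_on {0..1} (f s)"
    and g: "smooth_path_on {0..1} g" and lim: "Ck_limit k F f g"
  shows "Ck_limit k F (\<lambda>s t. L (f s t)) (\<lambda>t. L (g t))"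
  unfolding Ck_limit_def
proof (intro allI impI)
  fix j assume j: "j \<le> k"
  have "uniform_limit {0..1} (\<lambda>s t. L (nth_deriv j {0..1} (f s) t)) (\<lambda>t. L (nth_deriv j {0..1} g t)) F"
    using lim j unfolding Ck_limit_def by (auto intro: bounded_linear.uniform_limit[OF L])
  moreover have "\<forall>\<^sub>F s in F. \<forall>t\<in>{0..1}.
      L (nth_deriv j {0..1} (f s) t) = nth_deriv j {0..1} (\<lambda>t. L (f s t)) t"
    using f by eventually_elim (simp add: nth_deriv_linear[OF L] del: atLeastAtMost_iff)
  ultimately show "uniform_limit {0..1} (\<lambda>s. nth_deriv j {0..1} (\<lambda>t. L (f s t)))
      (nth_deriv j {0..1} (\<lambda>t. L (g t))) F"
    by (subst (asm) uniform_limit_cong) (auto simp: nth_deriv_linear[OF L g] simp del: atLeastAtMost_iff)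
qed

lemma Ck_limit_add:
  assumes f: "\<forall>\<^sub>F s in F. smooth_path_on {0..1} (f s)" "\<forall>\<^sub>F s in F. smooth_path_on {0..1} (f' s)"
    and g: "smooth_path_on {0..1} g" "smooth_path_on {0..1} g'"
    and lim: "Ck_limit k F f g" "Ck_limit k F f' g'"
  shows "Ck_limit k F (\<lambda>s t. f s t + f' s t) (\<lambda>t. g t + g' t)"
  unfolding Ck_limit_def
proof (intro allI impI)
  fix j assume j: "j \<le> k"
  have eq: "nth_deriv j {0..1} (\<lambda>t. p t + p' t) t = nth_deriv j {0..1} p t + nth_deriv j {0..1} p' t"
    if "smooth_path_on {0..1} p" "smooth_path_on {0..1} p'" "t \<in> {0..1}" for p p' :: "real \<Rightarrow> 'b" and t
    using nth_deriv_linear_combination(1)[OF that, of j 1 1] by simp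
  have "uniform_limit {0..1} (\<lambda>s t. nth_deriv j {0..1} (f s) t + nth_deriv j {0..1} (f' s) t)
      (\<lambda>t. nth_deriv j {0..1} g t + nth_deriv j {0..1} g' t) F"
    using lim j unfolding Ck_limit_def by (auto intro: uniform_limit_add)
  moreover have "\<forall>\<^sub>F s in F. \<forall>t\<in>{0..1}.
      nth_deriv j {0..1} (f s) t + nth_deriv j {0..1} (f' s) t = nth_deriv j {0..1} (\<lambda>t. f s t + f' s t) t"
    using f by eventually_elim (simp add: eq del: atLeastAtMost_iff)
  ultimately show "uniform_limit {0..1} (\<lambda>s. nth_deriv j {0..1} (\<lambda>t. f s t + f' s t))
      (nth_deriv j {0..1} (\<lambda>t. g t + g' t)) F"
    by (subst (asm) uniform_limit_cong) (auto simp: eq[OF g] simp del: atLeastAtMost_iff)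
qed

lemma smooth_path_on_sum:
  assumes "\<And>i. i \<in> I \<Longrightarrow> smooth_path_on {0..1} (f i)"
  shows "smooth_path_on {0..1} (\<lambda>t. \<Sum>i\<in>I. f i t)"
  using assms smooth_in_sum unfolding smooth_path_on_unit_interval_iff by blast

lemma Ck_limit_sum:
  assumes "finite I" "\<And>i. i \<in> I \<Longrightarrow> \<forall>\<^sub>F s in F. smooth_path_on {0..1} (f i s)"
    and "\<And>i. i \<in> I \<Longrightarrow> smooth_path_on {0..1} (g i)"
    and "\<And>i. i \<in> I \<Longrightarrow> Ck_limit k F (f i) (g i)"
  shows "Ck_limit k F (\<lambda>s t. \<Sum>i\<in>I. f i s t) (\<lambda>t. \<Sum>i\<in>I. g i t)"
  using assms
proof (induction I rule: finite_induct)
  case (insert i I)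
  have "\<forall>\<^sub>F s in F. \<forall>i\<in>I. smooth_path_on {0..1} (f i s)"
    using insert by (intro eventually_ball_finite) auto
  then have "\<forall>\<^sub>F s in F. smooth_path_on {0..1} (\<lambda>t. \<Sum>i\<in>I. f i s t)"
    by eventually_elim (simp add: smooth_path_on_sum)
  then show ?case
    unfolding sum.insert[OF insert.hyps]
    by (intro Ck_limit_add smooth_path_on_sum insert.IH insert.prems; simp)
qed (simp add: Ck_limit_const)

lemma uniform_limit_bilinear_path:
  assumes b: "bounded_bilinear b" and g: "smooth_path_on {0..1} g" "smooth_path_on {0..1} g'"
    and lim: "uniform_limit {0..1} f g F" "uniform_limit {0..1} f' g' F"
  shows "uniform_limit {0..1} (\<lambda>s t. b (f s t) (f' s t)) (\<lambda>t. b (g t) (g' t)) F"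
proof -
  have "compact (g ` {0..1})" "compact (g' ` {0..1})"
    using smooth_path_on_continuous_on[OF g(1), of 0] smooth_path_on_continuous_on[OF g(2), of 0]
    by (auto intro: compact_continuous_image)
  then show ?thesis
    by (intro bounded_bilinear.bounded_uniform_limit[OF b] compact_imp_bounded lim)
qed

lemma Ck_limit_bilinear:
  fixes b :: "'a::real_normed_vector \<Rightarrow> 'b::real_normed_vector \<Rightarrow> 'c::real_normed_vector"
  assumes b: "bounded_bilinear b"
  shows "\<lbrakk>\<forall>\<^sub>F s in F. smooth_path_on {0..1} (f s); \<forall>\<^sub>F s in F. smooth_path_on {0..1} (f' s);
      smooth_path_on {0..1} g; smooth_path_on {0..1} g'; Ck_limit k F f g; Ck_limit k F f' g'\<rbrakk> \<Longrightarrow>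
    Ck_limit k F (\<lambda>s t. b (f s t) (f' s t)) (\<lambda>t. b (g t) (g' t))"
proof (induction k arbitrary: f f' g g')
  case 0
  then show ?case unfolding Ck_limit_0 using uniform_limit_bilinear_path[OF b] by blast
next
  case (Suc k)
  have D: "path_deriv (\<lambda>t. b (p t) (q t)) t = b (p t) (path_deriv q t) + b (path_deriv p t) (q t)"
    if "smooth_path_on {0..1} p" "smooth_path_on {0..1} q" "t \<in> {0..1}" for p q t
    using smooth_path_on_has_vector_derivative[OF that(1,3), of 0]
      smooth_path_on_has_vector_derivative[OF that(2,3), of 0]
    by (intro path_deriv_eqI[OF that(3)] bounded_bilinear.has_vector_derivative[OF b]) simp_all
  note d = smooth_path_on_nth_deriv[of _ _ "Suc 0"]
  have ev: "\<forall>\<^sub>F s in F. smooth_path_on {0..1} (path_deriv (f s))" "\<forall>\<^sub>F s in F. smooth_path_on {0..1} (path_deriv (f' s))"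
    using eventually_mono[OF Suc.prems(1) d] eventually_mono[OF Suc.prems(2) d] by simp_all
  have lim: "Ck_limit k F (\<lambda>s. path_deriv (f s)) (path_deriv g)"
      "Ck_limit k F (\<lambda>s. path_deriv (f' s)) (path_deriv g')"
      "Ck_limit k F f g" "Ck_limit k F f' g'" "Ck_limit 0 F f g" "Ck_limit 0 F f' g'"
    using Suc.prems(5,6) Ck_limit_mono[OF Suc.prems(5), of k] Ck_limit_mono[OF Suc.prems(6), of k]
    unfolding Ck_limit_Suc[of k] Ck_limit_0 by simp_all
  have "Ck_limit k F (\<lambda>s t. b (f s t) (path_deriv (f' s) t) + b (path_deriv (f s) t) (f' s t))
      (\<lambda>t. b (g t) (path_deriv g' t) + b (path_deriv g t) (g' t))"
    using eventually_mono[OF eventually_conj[OF Suc.prems(1) ev(2)]]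
      eventually_mono[OF eventually_conj[OF ev(1) Suc.prems(2)]]
    by (intro Ck_limit_add Suc.IH smooth_path_on_bilinear[OF b] d Suc.prems ev lim)
       (simp_all add: smooth_path_on_bilinear[OF b])
  moreover have "\<forall>\<^sub>F s in F. \<forall>t\<in>{0..1}. b (f s t) (path_deriv (f' s) t) + b (path_deriv (f s) t) (f' s t) =
      path_deriv (\<lambda>t. b (f s t) (f' s t)) t"
    using Suc.prems(1,2) by eventually_elim (intro ballI D[symmetric])
  ultimately have "Ck_limit k F (\<lambda>s. path_deriv (\<lambda>t. b (f s t) (f' s t))) (path_deriv (\<lambda>t. b (g t) (g' t)))"
    by (rule Ck_limit_cong[rotated 2, OF _ _ D[OF Suc.prems(3,4), symmetric]])
  moreover have "uniform_limit {0..1} (\<lambda>s t. b (f s t) (f' s t)) (\<lambda>t. b (g t) (g' t)) F"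
    using uniform_limit_bilinear_path[OF b Suc.prems(3,4)] lim(5,6) unfolding Ck_limit_0 .
  ultimately show ?case by (simp only: Ck_limit_Suc)
qed

text \<open>Uniform continuity of \<open>h\<close> is available on compact sets only. The image of
  \<open>g\<close> is therefore thickened to its sum with a small closed ball, still compact and
  inside \<open>U\<close>, which the paths \<open>f s\<close> eventually enter.\<close>

lemma uniform_limit_superposition_path:
  fixes f :: "'i \<Rightarrow> real \<Rightarrow> 'a::euclidean_space" and h :: "'a \<Rightarrow> 'b::metric_space"
  assumes U: "open U" and g: "smooth_path_on {0..1} g" "g ` {0..1} \<subseteq> U"
    and h: "continuous_on U h" and lim: "uniform_limit {0..1} f g F"
  shows "uniform_limit {0..1} (\<lambda>s t. h (f s t)) (\<lambda>t. h (g t)) F"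
    and "\<forall>\<^sub>F s in F. f s ` {0..1} \<subseteq> U"
proof -
  have K: "compact (g ` {0..1})"
    using smooth_path_on_continuous_on[OF g(1), of 0] by (auto intro: compact_continuous_image)
  obtain e where e: "e > 0" "(\<Union>x\<in>g ` {0..1}. cball x e) \<subseteq> U"
    using compact_subset_open_imp_cball_epsilon_subset[OF K U g(2)] .
  define B where "B = {x + y |x y. x \<in> g ` {0..1} \<and> y \<in> cball 0 e}"
  have B: "compact B" unfolding B_def by (intro compact_sums K compact_cball)
  have BU: "B \<subseteq> U"
  proof
    fix z assume "z \<in> B"
    then obtain x y where "z = x + y" "x \<in> g ` {0..1}" "norm y \<le> e" by (auto simp: B_def)
    then have "z \<in> cball x e" by (simp add: dist_norm)
    then show "z \<in> U" using e \<open>x \<in> g ` {0..1}\<close> by blast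
  qed
  have unif: "uniformly_continuous_on B h"
    using h BU B
    by (intro compact_uniformly_continuous) (auto intro: continuous_on_subset)
  have "\<forall>\<^sub>F s in F. \<forall>t\<in>{0..1}. dist (f s t) (g t) < e"
    by (rule uniform_limitD[OF lim e(1)])
  then have inB: "\<forall>\<^sub>F s in F. \<forall>t\<in>{0..1}. f s t \<in> B"
  proof eventually_elim
    case (elim s)
    show ?case
    proof
      fix t :: real assume t: "t \<in> {0..1}"
      have "f s t = g t + (f s t - g t)" by simp
      moreover have "f s t - g t \<in> cball 0 e" using elim t by (auto simp: dist_norm norm_minus_commute less_imp_le)
      ultimately show "f s t \<in> B" using t unfolding B_def by blast
    qed
  qed
  from uniform_limit_compose_uniformly_continuous_on[OF lim unif inB compact_imp_closed[OF B]]
  show "uniform_limit {0..1} (\<lambda>s t. h (f s t)) (\<lambda>t. h (g t)) F" .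
  show "\<forall>\<^sub>F s in F. f s ` {0..1} \<subseteq> U"
    using inB by eventually_elim (use BU in blast)
qed

text \<open>By the chain rule \<open>path_deriv (\<lambda>t. h (f s t))\<close> is a sum of
  coordinates of \<open>path_deriv (f s)\<close> times superpositions with
  \<open>\<lambda>x. dir_deriv U h x b\<close>. The induction hypothesis is applied to the latter,
  so \<open>h\<close> must be arbitrary in the induction.\<close>

lemma Ck_limit_superposition:
  fixes f :: "'i \<Rightarrow> real \<Rightarrow> 'a::euclidean_space"
  assumes U: "open U" and f: "\<forall>\<^sub>F s in F. smooth_path_on {0..1} (f s)"
    and g: "smooth_path_on {0..1} g" "g ` {0..1} \<subseteq> U"
  shows "smooth_in U h \<Longrightarrow> Ck_limit k F f g \<Longrightarrow> Ck_limit k F (\<lambda>s t. h (f s t)) (\<lambda>t. h (g t))"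
proof (induction k arbitrary: h)
  case 0
  then show ?case
    unfolding Ck_limit_0 using uniform_limit_superposition_path(1)[OF U g] smooth_in_continuous_on by blast
next
  case (Suc k)
  have UW: "openin (top_of_set UNIV) U" using U by simp
  note hD = smooth_in_has_derivative_dir_deriv[OF dir_domain_UNIV UW Suc.prems(1)]
  note hb = smooth_in_dir_deriv[OF dir_domain_UNIV UW Suc.prems(1)]
  have D: "path_deriv (\<lambda>t. h (p t)) t = (\<Sum>b\<in>Basis. (path_deriv p t \<bullet> b) *\<^sub>R dir_deriv U h (p t) b)"
    if p: "smooth_path_on {0..1} p" "p ` {0..1} \<subseteq> U" and t: "t \<in> {0..1}" for p t
  proof -
    have pt: "p t \<in> U" using p t by blast
    have "(h has_derivative dir_deriv U h (p t)) (at (p t) within p ` {0..1})"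
      by (rule has_derivative_subset[OF hD[OF pt] p(2)])
    moreover have "(p has_vector_derivative path_deriv p t) (at t within {0..1})"
      using smooth_path_on_has_vector_derivative[OF p(1) t, of 0] by simp
    ultimately have "((h \<circ> p) has_vector_derivative dir_deriv U h (p t) (path_deriv p t)) (at t within {0..1})"
      by (intro vector_derivative_diff_chain_within)
    then have "path_deriv (\<lambda>t. h (p t)) t = dir_deriv U h (p t) (path_deriv p t)"
      unfolding o_def by (rule path_deriv_eqI[OF t])
    also have "\<dots> = (\<Sum>b\<in>Basis. (path_deriv p t \<bullet> b) *\<^sub>R dir_deriv U h (p t) b)"
      by (rule linear_euclidean_sum[OF has_derivative_linear[OF hD[OF pt]]])
    finally show ?thesis .
  qed
  have base: "Ck_limit 0 F f g" and limk: "Ck_limit k F f g"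
    and lim': "Ck_limit k F (\<lambda>s. path_deriv (f s)) (path_deriv g)"
    using Suc.prems(2) Ck_limit_mono[OF Suc.prems(2), of k]
    unfolding Ck_limit_Suc[of k] Ck_limit_0 by simp_all
  note unif = uniform_limit_superposition_path[OF U g smooth_in_continuous_on[OF Suc.prems(1)]
      base[unfolded Ck_limit_0]]
  note fU = unif(2)
  note d = smooth_path_on_nth_deriv[of _ _ "Suc 0"]
  have inner: "bounded_linear (\<lambda>x. x \<bullet> b)" for b :: 'a by (rule bounded_linear_inner_left)
  have ev1: "\<forall>\<^sub>F s in F. smooth_path_on {0..1} (path_deriv (f s))"
    by (rule eventually_mono[OF f d])
  have ev2: "\<forall>\<^sub>F s in F. smooth_path_on {0..1} (\<lambda>t. path_deriv (f s) t \<bullet> b)" for b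
    by (rule eventually_mono[OF ev1 smooth_path_on_linear[OF inner]])
  have ev3: "\<forall>\<^sub>F s in F. smooth_path_on {0..1} (\<lambda>t. dir_deriv U h (f s t) b)" for b
    using f fU by eventually_elim (rule smooth_path_on_superposition[OF _ hb])
  have ev4: "\<forall>\<^sub>F s in F. smooth_path_on {0..1} (\<lambda>t. (path_deriv (f s) t \<bullet> b) *\<^sub>R dir_deriv U h (f s t) b)" for b
    using ev2 ev3 by eventually_elim (rule smooth_path_on_bilinear[OF bounded_bilinear_scaleR])
  have "Ck_limit k F (\<lambda>s t. \<Sum>b\<in>Basis. (path_deriv (f s) t \<bullet> b) *\<^sub>R dir_deriv U h (f s t) b)
      (\<lambda>t. \<Sum>b\<in>Basis. (path_deriv g t \<bullet> b) *\<^sub>R dir_deriv U h (g t) b)"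
    by (intro Ck_limit_sum Ck_limit_bilinear[OF bounded_bilinear_scaleR] finite_Basis ev4 ev2 ev3
          Ck_limit_linear[OF inner] smooth_path_on_bilinear[OF bounded_bilinear_scaleR]
          smooth_path_on_linear[OF inner] smooth_path_on_superposition[OF g(1) hb g(2)] d g(1) ev1
          Suc.IH hb limk lim')
  moreover have "\<forall>\<^sub>F s in F. \<forall>t\<in>{0..1}. (\<Sum>b\<in>Basis. (path_deriv (f s) t \<bullet> b) *\<^sub>R dir_deriv U h (f s t) b) =
      path_deriv (\<lambda>t. h (f s t)) t"
    using f fU by eventually_elim (intro ballI D[symmetric])
  ultimately have "Ck_limit k F (\<lambda>s. path_deriv (\<lambda>t. h (f s t))) (path_deriv (\<lambda>t. h (g t)))"
    by (rule Ck_limit_cong[rotated 2, OF _ _ D[OF g, symmetric]])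
  with unif(1) show ?case by (simp only: Ck_limit_Suc)
qed


section \<open>Convergence in the Frechet space of smooth curves\<close>

text \<open>Openness is defined through the sets \<open>curve_nbhd\<close>, which are not open by
  definition. The points having a smaller neighbourhood of the same order inside form an open set,
  by the triangle inequality with halved radii; no maximum over \<open>[0,1]\<close> is
  involved.\<close>

lemma open_superset_curve_nbhd:
  assumes "e > 0"
  obtains S where "open S" "p \<in> S" "S \<subseteq> curve_nbhd n e p"
proof
  define S where "S = {q. \<exists>d>0. curve_nbhd n d q \<subseteq> curve_nbhd n e p}"
  show "open S"
    unfolding open_smooth_curve_def
  proof
    fix q assume "q \<in> S"
    then obtain d where d: "d > 0" "curve_nbhd n d q \<subseteq> curve_nbhd n e p" by (auto simp: S_def)
    have "curve_nbhd n (d / 2) q \<subseteq> S"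
    proof
      fix r assume r: "r \<in> curve_nbhd n (d / 2) q"
      have "curve_nbhd n (d / 2) r \<subseteq> curve_nbhd n d q"
      proof
        fix r' assume r': "r' \<in> curve_nbhd n (d / 2) r"
        show "r' \<in> curve_nbhd n d q"
          unfolding curve_nbhd_def mem_Collect_eq
        proof (intro allI impI ballI)
          fix k and t :: real assume "k \<le> n" "t \<in> {0..1}"
          then have "norm (nth_deriv k {0..1} (curve_at r) t - nth_deriv k {0..1} (curve_at q) t) < d / 2"
            "norm (nth_deriv k {0..1} (curve_at r') t - nth_deriv k {0..1} (curve_at r) t) < d / 2"
            using r r' unfolding curve_nbhd_def by blast+
          then show "norm (nth_deriv k {0..1} (curve_at r') t - nth_deriv k {0..1} (curve_at q) t) < d"
            using norm_diff_triangle_less by (metis field_sum_of_halves)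
        qed
      qed
      then show "r \<in> S" using d unfolding S_def by (auto intro!: exI[of _ "d / 2"])
    qed
    then show "\<exists>n. \<exists>d>0. curve_nbhd n d q \<subseteq> S" using d(1) by (intro exI[of _ n] exI[of _ "d / 2"]) auto
  qed
  show "p \<in> S" using assms by (auto simp: S_def)
  show "S \<subseteq> curve_nbhd n e p"
  proof
    fix q assume "q \<in> S"
    then obtain d where "d > 0" "curve_nbhd n d q \<subseteq> curve_nbhd n e p" by (auto simp: S_def)
    moreover have "q \<in> curve_nbhd n d q" using \<open>d > 0\<close> by (simp add: curve_nbhd_def)
    ultimately show "q \<in> curve_nbhd n e p" by blast
  qed
qed

lemma tendsto_smooth_curve_iff:
  fixes X :: "'i \<Rightarrow> 'a::real_normed_vector smooth_curve"
  shows "(X \<longlongrightarrow> l) F \<longleftrightarrow> (\<forall>k. Ck_limit k F (\<lambda>s. curve_at (X s)) (curve_at l))"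
proof
  assume lim: "(X \<longlongrightarrow> l) F"
  show "\<forall>k. Ck_limit k F (\<lambda>s. curve_at (X s)) (curve_at l)"
    unfolding Ck_limit_def
  proof (intro allI impI uniform_limitI)
    fix k j :: nat and e :: real assume "j \<le> k" "e > 0"
    obtain S where "open S" "l \<in> S" and S: "S \<subseteq> curve_nbhd k e l"
      using open_superset_curve_nbhd[OF \<open>e > 0\<close>] .
    then have "\<forall>\<^sub>F s in F. X s \<in> S" using lim by (simp add: topological_tendstoD)
    then show "\<forall>\<^sub>F s in F. \<forall>t\<in>{0..1}.
        dist (nth_deriv j {0..1} (curve_at (X s)) t) (nth_deriv j {0..1} (curve_at l) t) < e"
      by eventually_elim (use S \<open>j \<le> k\<close> in \<open>force simp: curve_nbhd_def dist_norm\<close>)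
  qed
next
  assume lim: "\<forall>k. Ck_limit k F (\<lambda>s. curve_at (X s)) (curve_at l)"
  show "(X \<longlongrightarrow> l) F"
  proof (rule topological_tendstoI)
    fix S :: "'a smooth_curve set" assume "open S" "l \<in> S"
    then obtain n e where e: "e > 0" "curve_nbhd n e l \<subseteq> S"
      unfolding open_smooth_curve_def by blast
    have "\<forall>\<^sub>F s in F. \<forall>j\<in>{..n}. \<forall>t\<in>{0..1}.
        dist (nth_deriv j {0..1} (curve_at (X s)) t) (nth_deriv j {0..1} (curve_at l) t) < e"
    proof (rule eventually_ball_finite, simp, rule ballI)
      fix j assume "j \<in> {..n}"
      then show "\<forall>\<^sub>F s in F. \<forall>t\<in>{0..1}.
          dist (nth_deriv j {0..1} (curve_at (X s)) t) (nth_deriv j {0..1} (curve_at l) t) < e"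
        using lim e(1) unfolding Ck_limit_def by (intro uniform_limitD) auto
    qed
    then show "\<forall>\<^sub>F s in F. X s \<in> S"
    proof eventually_elim
      case (elim s)
      then have "X s \<in> curve_nbhd n e l" unfolding curve_nbhd_def by (auto simp: dist_norm)
      then show ?case using e(2) by blast
    qed
  qed
qed

section \<open>The derivative of the square root transform\<close>

lemma smooth_in_power: "smooth_in W f \<Longrightarrow> smooth_in W (\<lambda>x. f x ^ n :: real)"
  by (induction n) (simp_all add: smooth_in_const smooth_in_bilinear[OF bounded_bilinear_mult])

lemma smooth_in_inverse:
  assumes "smooth_in W f" "\<And>x. x \<in> W \<Longrightarrow> f x > 0"
  shows "smooth_in W (\<lambda>x. inverse (f x) :: real)"
proof (rule smooth_in_cong[OF _ smooth_in_compose[OF assms(1) smooth_in_powr[of "-1"]]])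
  show "f x powr - 1 = inverse (f x)" if "x \<in> W" for x
    using assms(2)[OF that] by (simp add: powr_minus)
qed (use assms(2) in auto)

definition srv_factor :: "('e \<Rightarrow> 'e \<Rightarrow> real) \<Rightarrow> 'e \<Rightarrow> real" where
  "srv_factor ip x = inverse (sqrt (ip_norm ip x))"

text \<open>
  For \<open>N x = srv_factor ip x *\<^sub>R x\<close> this function of \<open>(x, z, y)\<close> with \<open>y = (x - z) /\<^sub>R s\<close> is
  \<open>(N x - N z) /\<^sub>R s\<close>, in a form that extends smoothly to \<open>s = 0\<close>. The factor satisfies
  \<open>srv_factor ip x ^ 4 * ip x x = 1\<close>, and the fraction arises from
  \<open>a^4 - b^4 = (a - b) (a^3 + a^2 b + a b^2 + b^3)\<close>.
\<close>

definition srv_quotient :: "('e::real_vector \<Rightarrow> 'e \<Rightarrow> real) \<Rightarrow> 'e \<times> 'e \<times> 'e \<Rightarrow> 'e" where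
  "srv_quotient ip = (\<lambda>(x, z, y). let a = srv_factor ip x; b = srv_factor ip z in
     a *\<^sub>R y + (- (b ^ 4) * ip y (x + z) * inverse (ip x x * (a ^ 3 + a\<^sup>2 * b + a * b\<^sup>2 + b ^ 3))) *\<^sub>R z)"

context
  fixes ip :: "'e::euclidean_space \<Rightarrow> 'e \<Rightarrow> real"
  assumes ip: "inner_product ip"
begin

lemma ip_bounded_bilinear: "bounded_bilinear ip"
  using ip by (simp add: inner_product_def bilinear_conv_bounded_bilinear)

lemma ip_pos: "x \<noteq> 0 \<Longrightarrow> ip x x > 0"
  using ip by (simp add: inner_product_def)

lemma ip_sym: "ip x y = ip y x"
  using ip by (simp add: inner_product_def)

lemmas ip_algebra =
  bounded_bilinear.add_left[OF ip_bounded_bilinear] bounded_bilinear.add_right[OF ip_bounded_bilinear]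
  bounded_bilinear.diff_left[OF ip_bounded_bilinear] bounded_bilinear.diff_right[OF ip_bounded_bilinear]
  bounded_bilinear.scaleR_left[OF ip_bounded_bilinear] bounded_bilinear.scaleR_right[OF ip_bounded_bilinear]
  bounded_bilinear.zero_left[OF ip_bounded_bilinear] bounded_bilinear.zero_right[OF ip_bounded_bilinear]

lemma srv_factor_pos: "x \<noteq> 0 \<Longrightarrow> srv_factor ip x > 0"
  using ip_pos by (simp add: srv_factor_def ip_norm_def)

lemma srv_denominator_pos:
  assumes "x \<noteq> 0" "z \<noteq> 0"
  defines "a \<equiv> srv_factor ip x" and "b \<equiv> srv_factor ip z"
  shows "ip x x * (a ^ 3 + a\<^sup>2 * b + a * b\<^sup>2 + b ^ 3) > 0"
  unfolding a_def b_def
  by (intro mult_pos_pos add_pos_pos zero_less_power srv_factor_pos ip_pos assms)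

lemma srv_factor_power4: "x \<noteq> 0 \<Longrightarrow> srv_factor ip x ^ 4 * ip x x = 1"
proof -
  assume "x \<noteq> 0"
  then have p: "ip x x > 0" by (rule ip_pos)
  have "sqrt (sqrt (ip x x)) ^ 4 = (sqrt (sqrt (ip x x)) ^ 2) ^ 2" by simp
  also have "\<dots> = ip x x" using p by (simp only: real_sqrt_pow2 less_imp_le real_sqrt_ge_zero)
  finally show ?thesis using p by (simp add: srv_factor_def ip_norm_def power_inverse)
qed

lemma srv_difference:
  assumes x: "x \<noteq> 0" and z: "z \<noteq> 0" and s: "s \<noteq> 0"
  shows "(srv_factor ip x *\<^sub>R x - srv_factor ip z *\<^sub>R z) /\<^sub>R s = srv_quotient ip (x, z, (x - z) /\<^sub>R s)"
proof -
  define a b where "a = srv_factor ip x" and "b = srv_factor ip z"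
  define S where "S = a ^ 3 + a\<^sup>2 * b + a * b\<^sup>2 + b ^ 3"
  have pos: "ip x x * S > 0"
    unfolding S_def a_def b_def by (rule srv_denominator_pos[OF x z])
  have "(a - b) * (ip x x * S) = a ^ 4 * ip x x - b ^ 4 * ip x x"
    by (simp add: S_def algebra_simps power2_eq_square power3_eq_cube power4_eq_xxxx)
  \<comment> \<open>Both \<open>a ^ 4 * ip x x\<close> and \<open>b ^ 4 * ip z z\<close> equal 1.
    The exchange leaves a difference of two squared norms, which contains the factor
    \<open>x - z\<close> that absorbs the division by \<open>s\<close>.\<close>
  also have "\<dots> = b ^ 4 * ip z z - b ^ 4 * ip x x"
    using srv_factor_power4 x z by (simp add: a_def b_def)
  also have "\<dots> = - (b ^ 4) * ip (x - z) (x + z)"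
    by (simp add: ip_algebra ip_sym[of z x] algebra_simps)
  finally have *: "(a - b) * (ip x x * S) = - (b ^ 4) * ip (x - z) (x + z)" .
  have "a - b = (a - b) * (ip x x * S) * inverse (ip x x * S)"
    using pos by (metis less_irrefl mult.assoc mult.right_neutral right_inverse)
  then have "a - b = - (b ^ 4) * ip (x - z) (x + z) * inverse (ip x x * S)"
    unfolding * .
  then have "(a - b) / s = - (b ^ 4) * ip ((x - z) /\<^sub>R s) (x + z) * inverse (ip x x * S)"
    by (simp add: bounded_bilinear.scaleR_left[OF ip_bounded_bilinear] divide_inverse mult_ac)
  \<comment> \<open>Discrete product rule: \<open>a *\<^sub>R x - b *\<^sub>R z = a *\<^sub>R (x -
    z) + (a - b) *\<^sub>R z\<close>.\<close>
  then have "srv_quotient ip (x, z, (x - z) /\<^sub>R s) = a *\<^sub>R ((x - z) /\<^sub>R s) + ((a - b) / s) *\<^sub>R z"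
    unfolding srv_quotient_def by (simp add: Let_def S_def flip: a_def b_def)
  also have "\<dots> = (a *\<^sub>R x - b *\<^sub>R z) /\<^sub>R s"
    by (simp add: algebra_simps divide_inverse)
  finally show ?thesis by (simp add: a_def b_def)
qed

text \<open>The map being differentiated is positively homogeneous of degree 1/2, so the radial part
  of \<open>h\<close> is halved while the part orthogonal to \<open>x\<close> keeps its full weight.
  Squaring this 1/2 gives the coefficient 1/4 of the metric.\<close>

lemma srv_quotient_diagonal:
  assumes x: "x \<noteq> 0"
  defines "r \<equiv> ip_norm ip x"
  shows "srv_quotient ip (x, x, h) = (h - (1 / 2 * ip h (x /\<^sub>R r)) *\<^sub>R (x /\<^sub>R r)) /\<^sub>R sqrt r"
proof -
  define a where "a = srv_factor ip x"
  have a: "a > 0" "a ^ 4 * ip x x = 1" using srv_factor_pos[OF x] srv_factor_power4[OF x] by (auto simp: a_def)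
  have r: "r > 0" "r\<^sup>2 = ip x x" using ip_pos[OF x] by (auto simp: r_def ip_norm_def)
  have ar: "a = inverse (sqrt r)" by (simp add: a_def srv_factor_def r_def)
  have S: "a ^ 3 + a\<^sup>2 * a + a * a\<^sup>2 + a ^ 3 = 4 * a ^ 3"
    by (simp add: power2_eq_square power3_eq_cube)
  have "- (a ^ 4) * ip h (x + x) * inverse (ip x x * (4 * a ^ 3)) = - (1 / 2 * ip h x / ip x x) * a"
    using a ip_pos[OF x] by (simp add: ip_algebra field_simps power4_eq_xxxx power3_eq_cube)
  moreover have "srv_quotient ip (x, x, h) =
      a *\<^sub>R h + (- (a ^ 4) * ip h (x + x) * inverse (ip x x * (4 * a ^ 3))) *\<^sub>R x"
    unfolding srv_quotient_def Let_def prod.case a_def[symmetric] S ..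
  ultimately have "srv_quotient ip (x, x, h) = a *\<^sub>R (h - (1 / 2 * ip h x / ip x x) *\<^sub>R x)"
    by (simp add: algebra_simps)
  also have "(1 / 2 * ip h x / ip x x) *\<^sub>R x = (1 / 2 * ip h (x /\<^sub>R r)) *\<^sub>R (x /\<^sub>R r)"
  proof -
    have "ip h (x /\<^sub>R r) = ip h x / r"
      by (simp add: bounded_bilinear.scaleR_right[OF ip_bounded_bilinear] divide_inverse)
    moreover have "1 / 2 * ip h x / ip x x = 1 / 2 * (ip h x / r) * inverse r"
      unfolding r(2)[symmetric] power2_eq_square using r(1) by (simp add: field_simps)
    ultimately show ?thesis by (simp only: scaleR_scaleR)
  qed
  finally show ?thesis unfolding ar .
qed

lemma smooth_in_srv_factor: "smooth_in (- {0}) (srv_factor ip)"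
proof (rule smooth_in_cong)
  show "ip x x powr (- 1 / 4) = srv_factor ip x" if "x \<in> - {0}" for x
  proof -
    have "ip x x powr (- 1 / 4) = inverse ((ip x x powr (1 / 2)) powr (1 / 2))"
      by (simp add: powr_powr powr_minus flip: powr_minus)
    then show ?thesis
      using ip_pos[of x] that by (simp add: srv_factor_def ip_norm_def powr_half_sqrt)
  qed
  show "smooth_in (- {0}) (\<lambda>x. ip x x powr (- 1 / 4))"
    using ip_pos
    by (intro smooth_in_compose[OF _ smooth_in_powr] smooth_in_bilinear[OF ip_bounded_bilinear]
          smooth_in_bounded_linear bounded_linear_ident) auto
qed

lemma smooth_in_srv_quotient: "smooth_in ((- {0}) \<times> (- {0}) \<times> UNIV) (srv_quotient ip)"
proof -
  let ?W = "(- {0}) \<times> (- {0}) \<times> (UNIV :: 'e set)"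
  have pr: "smooth_in ?W fst" "smooth_in ?W (\<lambda>p. fst (snd p))" "smooth_in ?W (\<lambda>p. snd (snd p))"
    by (intro smooth_in_bounded_linear bounded_linear_fst bounded_linear_compose[OF bounded_linear_fst]
          bounded_linear_compose[OF bounded_linear_snd] bounded_linear_snd)+
  have f: "smooth_in ?W (\<lambda>p. srv_factor ip (fst p))" "smooth_in ?W (\<lambda>p. srv_factor ip (fst (snd p)))"
    by (rule smooth_in_compose[OF pr(1) smooth_in_srv_factor] smooth_in_compose[OF pr(2) smooth_in_srv_factor], auto)+
  note mult = smooth_in_bilinear[OF bounded_bilinear_mult]
  have "smooth_in ?W (\<lambda>p. let a = srv_factor ip (fst p); b = srv_factor ip (fst (snd p)) in
     a *\<^sub>R snd (snd p) + ((- 1 * b ^ 4) * ip (snd (snd p)) (fst p + fst (snd p)) *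
       inverse (ip (fst p) (fst p) * (a ^ 3 + a\<^sup>2 * b + a * b\<^sup>2 + b ^ 3))) *\<^sub>R fst (snd p))"
    unfolding Let_def
    by (intro smooth_in_add smooth_in_bilinear[OF bounded_bilinear_scaleR] smooth_in_bilinear[OF ip_bounded_bilinear]
          mult smooth_in_inverse smooth_in_power smooth_in_const f pr)
       (auto intro!: srv_denominator_pos)
  then show ?thesis
    by (rule smooth_in_cong[rotated]) (auto simp: srv_quotient_def Let_def)
qed

end

section \<open>Difference quotients of the square root transform in
  \<open>C^\<infinity>\<close>\<close>

lemma nth_deriv_const: "t \<in> {0..1} \<Longrightarrow> nth_deriv k {0..1} (\<lambda>t. c) t = (if k = 0 then c else 0)"
proof (induction k arbitrary: t)
  case (Suc k)
  have "(nth_deriv k {0..1} (\<lambda>t. c) has_vector_derivative 0) (at t within {0..1})"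
    by (rule has_vector_derivative_transform[OF Suc.prems Suc.IH has_vector_derivative_const])
  from path_deriv_eqI[OF Suc.prems this] show ?case by simp
qed simp

lemma smooth_path_on_const: "smooth_path_on {0..1} (\<lambda>t. c)"
  unfolding smooth_path_on_unit_interval_iff by (rule smooth_in_const)

lemma smooth_path_on_Pair:
  "smooth_path_on {0..1} f \<Longrightarrow> smooth_path_on {0..1} g \<Longrightarrow> smooth_path_on {0..1} (\<lambda>t. (f t, g t))"
  unfolding smooth_path_on_unit_interval_iff by (rule smooth_in_Pair)

text \<open>Turns the scalar \<open>s\<close> into a convergent family of paths, for the product
  with \<open>s\<close> in \<open>tendsto_srv_quotient\<close>.\<close>

lemma Ck_limit_const_paths:
  assumes "(c \<longlongrightarrow> d) F"
  shows "Ck_limit k F (\<lambda>s t. c s) (\<lambda>t. d)"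
  unfolding Ck_limit_def
proof (intro allI impI)
  fix j :: nat
  have "uniform_limit {0..1::real} (\<lambda>s t. c s) (\<lambda>t. d) F"
    using assms by (auto simp: uniform_limit_iff tendsto_iff elim!: allE eventually_mono)
  then have "uniform_limit {0..1::real} (\<lambda>s t. if j = 0 then c s else 0) (\<lambda>t. if j = 0 then d else 0) F"
    by (simp add: uniform_limit_const)
  then show "uniform_limit {0..1} (\<lambda>s. nth_deriv j {0..1} (\<lambda>t. c s)) (nth_deriv j {0..1} (\<lambda>t. d)) F"
    by (rule uniform_limit_cong'[THEN iffD1, rotated 2]) (simp_all only: nth_deriv_const)
qed

lemma Ck_limit_Pair:
  fixes f :: "'i \<Rightarrow> real \<Rightarrow> 'a::real_normed_vector" and f' :: "'i \<Rightarrow> real \<Rightarrow> 'b::real_normed_vector"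
  assumes f: "\<forall>\<^sub>F s in F. smooth_path_on {0..1} (f s)" "\<forall>\<^sub>F s in F. smooth_path_on {0..1} (f' s)"
    and g: "smooth_path_on {0..1} g" "smooth_path_on {0..1} g'"
    and lim: "Ck_limit k F f g" "Ck_limit k F f' g'"
  shows "Ck_limit k F (\<lambda>s t. (f s t, f' s t)) (\<lambda>t. (g t, g' t))"
proof -
  let ?i = "\<lambda>y::'a. (y, 0::'b)" and ?j = "\<lambda>y::'b. (0::'a, y)"
  have L: "bounded_linear ?i" "bounded_linear ?j"
    by (intro bounded_linear_Pair bounded_linear_ident bounded_linear_zero)+
  have "Ck_limit k F (\<lambda>s t. ?i (f s t) + ?j (f' s t)) (\<lambda>t. ?i (g t) + ?j (g' t))"
    by (intro Ck_limit_add Ck_limit_linear[of ?i] Ck_limit_linear[of ?j] smooth_path_on_linear[of ?i]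
          smooth_path_on_linear[of ?j] L f g lim
          eventually_mono[OF f(1) smooth_path_on_linear[OF L(1)]]
          eventually_mono[OF f(2) smooth_path_on_linear[OF L(2)]])
  then show ?thesis by simp
qed

text \<open>For larger \<open>s\<close> the curve \<open>X s\<close> may have zeros, and
  \<open>curve_of\<close> may then meet a function that is not smooth. The identity with
  \<open>srv_quotient\<close> is thus claimed only eventually, once the curves avoid 0; there it
  presents the quotients as superpositions with triples that converge in every order.\<close>

lemma tendsto_srv_quotient:
  fixes X :: "real \<Rightarrow> 'e::euclidean_space smooth_curve"
  assumes ip: "inner_product ip" and nz: "\<And>t. t \<in> {0..1} \<Longrightarrow> curve_at (X 0) t \<noteq> 0"
    and lim: "((\<lambda>s. (X s - X 0) /\<^sub>R s) \<longlongrightarrow> l) (at 0)"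
  defines "R \<equiv> \<lambda>s. curve_of (\<lambda>t. curve_at (X s) t /\<^sub>R sqrt (ip_norm ip (curve_at (X s) t)))"
    and "m \<equiv> curve_of (\<lambda>t. srv_quotient ip (curve_at (X 0) t, curve_at (X 0) t, curve_at l t))"
  shows "((\<lambda>s. (R s - R 0) /\<^sub>R s) \<longlongrightarrow> m) (at 0)"
    and "\<And>t. t \<in> {0..1} \<Longrightarrow>
       curve_at m t = srv_quotient ip (curve_at (X 0) t, curve_at (X 0) t, curve_at l t)"
proof -
  define Q where "Q s = (X s - X 0) /\<^sub>R s" for s
  note sm = smooth_path_on_curve_at
  have limQ: "Ck_limit k (at 0) (\<lambda>s. curve_at (Q s)) (curve_at l)" for k
    using lim by (simp add: tendsto_smooth_curve_iff Q_def)
  \<comment> \<open>For \<open>s \<noteq> 0\<close> the curve is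
    \<open>X 0 + s *\<^sub>R Q s\<close>, so convergence of the quotients forces convergence of the
    curves.\<close>
  have limX: "Ck_limit k (at 0) (\<lambda>s. curve_at (X s)) (curve_at (X 0))" for k
  proof -
    have "Ck_limit k (at 0) (\<lambda>s t. curve_at (X 0) t + s *\<^sub>R curve_at (Q s) t)
        (\<lambda>t. curve_at (X 0) t + 0 *\<^sub>R curve_at l t)"
      by (intro Ck_limit_add Ck_limit_bilinear[OF bounded_bilinear_scaleR] Ck_limit_const limQ
            Ck_limit_const_paths tendsto_ident_at smooth_path_on_bilinear[OF bounded_bilinear_scaleR]
            smooth_path_on_const sm always_eventually allI)
    then show ?thesis
      by (rule Ck_limit_cong[rotated 2]) (auto simp: Q_def curve_at_ops eventually_at_filter)
  qed
  \<comment> \<open>The superposed function is a constant dummy; what matters is the conclusion that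
    the paths eventually stay in the open set.\<close>
  have N: "\<forall>\<^sub>F s in at 0. curve_at (X s) ` {0..1} \<subseteq> - {0}"
    by (rule uniform_limit_superposition_path(2)[OF _ sm _ continuous_on_const limX[of 0, unfolded Ck_limit_0]])
       (use nz in auto)
  have srv: "curve_at (curve_of (\<lambda>t. p t /\<^sub>R sqrt (ip_norm ip (p t)))) t = srv_factor ip (p t) *\<^sub>R p t"
    if "smooth_path_on {0..1} p" "p ` {0..1} \<subseteq> - {0}" "t \<in> {0..1}" for p t
  proof -
    have "smooth_path_on {0..1} (\<lambda>t. srv_factor ip (p t) *\<^sub>R p t)"
      by (intro smooth_path_on_bilinear[OF bounded_bilinear_scaleR] that
            smooth_path_on_superposition[OF that(1) smooth_in_srv_factor[OF ip]])
    then show ?thesis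
      using that(3) by (subst curve_at_curve_of) (simp_all add: srv_factor_def)
  qed
  let ?W = "(- {0}) \<times> (- {0}) \<times> (UNIV :: 'e set)"
  let ?T = "\<lambda>s t. (curve_at (X s) t, curve_at (X 0) t, curve_at (Q s) t)"
  let ?Z = "\<lambda>t. (curve_at (X 0) t, curve_at (X 0) t, curve_at l t)"
  have T0: "smooth_path_on {0..1} ?Z" "?Z ` {0..1} \<subseteq> ?W"
    using nz by (auto intro!: smooth_path_on_Pair sm)
  have limT: "Ck_limit k (at 0) ?T ?Z" for k
    by (intro Ck_limit_Pair smooth_path_on_Pair always_eventually allI sm limX limQ Ck_limit_const)
  have limPsi: "Ck_limit k (at 0) (\<lambda>s t. srv_quotient ip (?T s t)) (\<lambda>t. srv_quotient ip (?Z t))" for k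
    by (rule Ck_limit_superposition[OF _ _ T0 smooth_in_srv_quotient[OF ip] limT])
       (auto intro!: open_Times always_eventually smooth_path_on_Pair sm)
  show m: "curve_at m t = srv_quotient ip (?Z t)" if "t \<in> {0..1}" for t
    using that smooth_path_on_superposition[OF T0(1) smooth_in_srv_quotient[OF ip] T0(2)]
    unfolding m_def by (subst curve_at_curve_of) auto
  have "\<forall>\<^sub>F s in at 0. \<forall>t\<in>{0..1}. srv_quotient ip (?T s t) = curve_at ((R s - R 0) /\<^sub>R s) t"
    using N eventually_neq_at_within[of 0 0 UNIV]
  proof eventually_elim
    case (elim s)
    show ?case
    proof
      fix t :: real assume t: "t \<in> {0..1}"
      have "curve_at ((R s - R 0) /\<^sub>R s) t = (curve_at (R s) t - curve_at (R 0) t) /\<^sub>R s"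
        by (simp add: curve_at_ops)
      also have "curve_at (R s) t = srv_factor ip (curve_at (X s) t) *\<^sub>R curve_at (X s) t"
        unfolding R_def by (rule srv[OF sm elim(1) t])
      also have "curve_at (R 0) t = srv_factor ip (curve_at (X 0) t) *\<^sub>R curve_at (X 0) t"
        unfolding R_def by (rule srv[OF sm _ t]) (use nz in auto)
      also have "(srv_factor ip (curve_at (X s) t) *\<^sub>R curve_at (X s) t -
          srv_factor ip (curve_at (X 0) t) *\<^sub>R curve_at (X 0) t) /\<^sub>R s = srv_quotient ip (?T s t)"
      proof -
        have "curve_at (X s) t \<noteq> 0" using elim(1) t by force
        from srv_difference[OF ip this nz[OF t] elim(2)] show ?thesis
          by (simp add: Q_def curve_at_ops)
      qed
      finally show "srv_quotient ip (?T s t) = curve_at ((R s - R 0) /\<^sub>R s) t" by simp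
    qed
  qed
  then have "Ck_limit k (at 0) (\<lambda>s. curve_at ((R s - R 0) /\<^sub>R s)) (curve_at m)" for k
    by (rule Ck_limit_cong[OF _ _ limPsi]) (simp add: m)
  then show "((\<lambda>s. (R s - R 0) /\<^sub>R s) \<longlongrightarrow> m) (at 0)"
    by (simp add: tendsto_smooth_curve_iff)
qed

section \<open>The velocity map in charts\<close>

abbreviation slab :: "(real \<times> 'a::euclidean_space) set" where
  "slab \<equiv> {0..1} \<times> UNIV"

section \<open>Jet prolongation of time-dependent maps\<close>

text \<open>The pair \<open>(x, y)\<close> is a single point of the model space of the tangent
  bundle, so the result again has the shape of a chart domain for curves.\<close>

definition tangent_set :: "('t \<times> 'a) set \<Rightarrow> ('t \<times> 'a \<times> 'a) set" where
  "tangent_set W = {(t, x, y). (t, x) \<in> W}"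

text \<open>
  The map induced by \<open>(t, x) \<mapsto> (t, f (t, x))\<close> on first order jets: a path \<open>x\<close> with
  derivative \<open>y\<close> at \<open>t\<close> is sent to the path \<open>f (\<cdot>, x)\<close> and its derivative.
\<close>

definition jet_map ::
    "(real \<times> 'a::euclidean_space) set \<Rightarrow> (real \<times> 'a \<Rightarrow> 'b::euclidean_space) \<Rightarrow> real \<times> 'a \<times> 'a \<Rightarrow> real \<times> 'b \<times> 'b" where
  "jet_map W f = (\<lambda>(t, x, y). (t, f (t, x), dir_deriv W f (t, x) (1, y)))"

lemma openin_tangent_set:
  assumes "openin (top_of_set slab) W"
  shows "openin (top_of_set slab) (tangent_set W)"
proof -
  obtain N where N: "open N" "W = slab \<inter> N" using assms by (auto simp: openin_open)
  have "open ((\<lambda>p. (fst p, fst (snd p))) -` N)"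
    by (intro open_vimage[OF N(1)] continuous_intros)
  moreover have "tangent_set W = slab \<inter> (\<lambda>p. (fst p, fst (snd p))) -` N"
    by (auto simp: tangent_set_def N(2))
  ultimately show ?thesis by (auto simp: openin_open)
qed

text \<open>The direction \<open>(1, y)\<close> varies with the point. Linearity splits the
  derivative into the fixed directions \<open>(1, 0)\<close> and \<open>(0, b)\<close> with the
  coordinates of \<open>y\<close> as coefficients.\<close>

lemma smooth_in_jet_map:
  fixes f :: "real \<times> 'a::euclidean_space \<Rightarrow> 'b::euclidean_space"
  assumes W: "openin (top_of_set slab) W" and f: "smooth_in W f"
  shows "smooth_in (tangent_set W) (jet_map W f)"
proof -
  let ?T = "tangent_set W"
  have pr: "smooth_in ?T fst" "smooth_in ?T (\<lambda>p. (fst p, fst (snd p)))" "smooth_in ?T (\<lambda>p. snd (snd p))"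
    by (intro smooth_in_bounded_linear bounded_linear_fst bounded_linear_Pair
          bounded_linear_compose[OF bounded_linear_fst] bounded_linear_compose[OF bounded_linear_snd]
          bounded_linear_snd)+
  have sub: "(\<lambda>p. (fst p, fst (snd p))) ` ?T \<subseteq> W" by (auto simp: tangent_set_def)
  note D = smooth_in_dir_deriv[OF dir_domain_slab W f]
  have "smooth_in ?T (\<lambda>p. (fst p, f (fst p, fst (snd p)),
      dir_deriv W f (fst p, fst (snd p)) (1, 0) +
      (\<Sum>b\<in>Basis. (snd (snd p) \<bullet> b) *\<^sub>R dir_deriv W f (fst p, fst (snd p)) (0, b))))"
    by (intro smooth_in_Pair smooth_in_add smooth_in_sum smooth_in_bilinear[OF bounded_bilinear_scaleR]
          smooth_in_linear_comp[OF bounded_linear_inner_left] pr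
          smooth_in_compose[OF pr(2) f sub] smooth_in_compose[OF pr(2) D sub])
  then show ?thesis
  proof (rule smooth_in_cong[rotated], clarify)
    fix t x and y :: 'a assume "(t, x, y) \<in> ?T"
    then have "linear (dir_deriv W f (t, x))"
      using has_derivative_linear[OF smooth_in_has_derivative_dir_deriv[OF dir_domain_slab W f]]
      by (simp add: tangent_set_def)
    then have "dir_deriv W f (t, x) (1, y) =
        dir_deriv W f (t, x) (1, 0) + dir_deriv W f (t, x) (0, y)"
      and "linear (\<lambda>y. dir_deriv W f (t, x) (0, y))"
      using linear_add[of "dir_deriv W f (t, x)" "(1, 0)" "(0, y)"]
        linear_compose[of "Pair 0" "dir_deriv W f (t, x)"]
      by (simp_all add: o_def linear_iff)
    with linear_euclidean_sum[OF this(2), of y]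
    show "(fst (t, x, y), f (fst (t, x, y), fst (snd (t, x, y))),
          dir_deriv W f (fst (t, x, y), fst (snd (t, x, y))) (1, 0) +
          (\<Sum>b\<in>Basis. (snd (snd (t, x, y)) \<bullet> b) *\<^sub>R
            dir_deriv W f (fst (t, x, y), fst (snd (t, x, y))) (0, b))) = jet_map W f (t, x, y)"
      by (simp add: jet_map_def)
  qed
qed

text \<open>The map \<open>z \<mapsto> (fst z, f z)\<close> preserves time, so its derivative sends
  \<open>(1, y)\<close> to a vector of the form \<open>(1, y')\<close>. Differentiating the identity
  \<open>g (t, f (t, x)) = x\<close> in direction \<open>(1, y)\<close> then returns
  \<open>y\<close>.\<close>

lemma jet_map_left_inverse:
  fixes f :: "real \<times> 'a::euclidean_space \<Rightarrow> 'b::euclidean_space"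
  assumes W: "openin (top_of_set slab) W" and f: "smooth_in W f"
    and W': "openin (top_of_set slab) W'" and g: "smooth_in W' g"
    and inv: "\<And>t x. (t, x) \<in> W \<Longrightarrow> (t, f (t, x)) \<in> W' \<and> g (t, f (t, x)) = x"
    and p: "p \<in> tangent_set W"
  shows "jet_map W f p \<in> tangent_set W'" "jet_map W' g (jet_map W f p) = p"
proof -
  obtain t x y where p_eq: "p = (t, x, y)" and tx: "(t, x) \<in> W"
    using p by (auto simp: tangent_set_def)
  let ?F = "\<lambda>z. (fst z, f z)"
  have F: "?F ` W \<subseteq> W'" "(t, f (t, x)) \<in> W'" using inv tx by force+
  have "(f has_derivative dir_deriv W f (t, x)) (at (t, x) within W)"
    by (rule smooth_in_has_derivative_dir_deriv[OF dir_domain_slab W f tx])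
  then have 1: "(?F has_derivative (\<lambda>v. (fst v, dir_deriv W f (t, x) v))) (at (t, x) within W)"
    by (intro has_derivative_Pair has_derivative_fst has_derivative_ident)
  have 2: "(g has_derivative dir_deriv W' g (t, f (t, x))) (at (?F (t, x)) within ?F ` W)"
    using has_derivative_subset[OF smooth_in_has_derivative_dir_deriv[OF dir_domain_slab W' g F(2)] F(1)]
    by simp
  have "((\<lambda>z. g (?F z)) has_derivative (\<lambda>v. dir_deriv W' g (t, f (t, x)) (fst v, dir_deriv W f (t, x) v)))
      (at (t, x) within W)"
    by (rule has_derivative_in_compose[OF 1 2])
  then have "(snd has_derivative (\<lambda>v. dir_deriv W' g (t, f (t, x)) (fst v, dir_deriv W f (t, x) v)))
      (at (t, x) within W)"
    by (rule has_derivative_transform[OF tx, rotated]) (use inv in auto)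
  from has_derivative_imp_dir_deriv[OF dir_domain_slab W tx this, of "(1, y)"]
    has_derivative_imp_dir_deriv[OF dir_domain_slab W tx has_derivative_snd[OF has_derivative_ident], of "(1, y)"]
  have "dir_deriv W' g (t, f (t, x)) (1, dir_deriv W f (t, x) (1, y)) = y" by simp
  then show "jet_map W' g (jet_map W f p) = p"
    using inv[OF tx] by (simp add: jet_map_def p_eq)
  show "jet_map W f p \<in> tangent_set W'"
    using F(2) by (simp add: jet_map_def p_eq tangent_set_def)
qed

lemma jet_map_diffeomorphism:
  fixes f :: "real \<times> 'a::euclidean_space \<Rightarrow> 'a"
  defines "F \<equiv> \<lambda>(t, x). (t, f (t, x))"
  assumes W: "openin (top_of_set slab) W" and inj: "inj_on F W"
    and W': "openin (top_of_set slab) (F ` W)"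
    and F: "bastiani_smooth_on W F" and G: "bastiani_smooth_on (F ` W) (inv_into W F)"
  shows "smooth_in (tangent_set W) (jet_map W f)"
    and "inj_on (jet_map W f) (tangent_set W)"
    and "openin (top_of_set slab) (jet_map W f ` tangent_set W)"
    and "smooth_in (jet_map W f ` tangent_set W) (inv_into (tangent_set W) (jet_map W f))"
proof -
  define g where "g z = snd (inv_into W F z)" for z
  have Fs: "smooth_in W F" "smooth_in (F ` W) (inv_into W F)"
    using F G bastiani_smooth_on_imp_smooth_in[OF dir_domain_slab] W W' by blast+
  have f: "smooth_in W f"
    by (rule smooth_in_cong[OF _ smooth_in_linear_comp[OF bounded_linear_snd Fs(1)]]) (auto simp: F_def)
  have g: "smooth_in (F ` W) g"
    unfolding g_def by (rule smooth_in_linear_comp[OF bounded_linear_snd Fs(2)])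
  have inv1: "(t, f (t, x)) \<in> F ` W \<and> g (t, f (t, x)) = x" if "(t, x) \<in> W" for t x
  proof -
    have *: "F (t, x) = (t, f (t, x))" by (simp add: F_def)
    then have "(t, f (t, x)) \<in> F ` W" using that by (metis imageI)
    moreover have "inv_into W F (F (t, x)) = (t, x)" by (rule inv_into_f_f[OF inj that])
    ultimately show ?thesis by (simp add: g_def *)
  qed
  have inv2: "(t, g (t, x)) \<in> W \<and> f (t, g (t, x)) = x" if tx: "(t, x) \<in> F ` W" for t x
  proof -
    obtain x' where x': "(t, x') \<in> W" "x = f (t, x')" using tx by (auto simp: F_def)
    then show ?thesis using inv1[OF x'(1)] by simp
  qed
  have L: "jet_map W f p \<in> tangent_set (F ` W)" "jet_map (F ` W) g (jet_map W f p) = p"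
    if "p \<in> tangent_set W" for p
    by (rule jet_map_left_inverse[OF W f W' g _ that], erule inv1)+
  have L': "jet_map (F ` W) g p \<in> tangent_set W" "jet_map W f (jet_map (F ` W) g p) = p"
    if "p \<in> tangent_set (F ` W)" for p
    by (rule jet_map_left_inverse[OF W' g W f _ that], erule inv2)+
  show "smooth_in (tangent_set W) (jet_map W f)" by (rule smooth_in_jet_map[OF W f])
  show inj': "inj_on (jet_map W f) (tangent_set W)"
    by (rule inj_on_inverseI[of _ "jet_map (F ` W) g"]) (rule L(2))
  have im: "jet_map W f ` tangent_set W = tangent_set (F ` W)"
  proof (intro equalityI subsetI)
    fix p assume "p \<in> tangent_set (F ` W)"
    then show "p \<in> jet_map W f ` tangent_set W"
      using L' by (metis imageI)
  qed (use L(1) in blast)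
  show "openin (top_of_set slab) (jet_map W f ` tangent_set W)"
    unfolding im by (rule openin_tangent_set[OF W'])
  show "smooth_in (jet_map W f ` tangent_set W) (inv_into (tangent_set W) (jet_map W f))"
    unfolding im
  proof (rule smooth_in_cong[OF _ smooth_in_jet_map[OF W' g]])
    fix p assume p: "p \<in> tangent_set (F ` W)"
    show "jet_map (F ` W) g p = inv_into (tangent_set W) (jet_map W f) p"
      using inv_into_f_f[OF inj' L'(1)[OF p]] L'(2)[OF p] by simp
  qed
qed

section \<open>Prolonged charts for curves in the tangent bundle\<close>

lemma chart_at_in_atlas:
  assumes "p \<in> mcarrier A" "chart_at A p = (U, \<psi>)"
  shows "(U, \<psi>) \<in> A" "p \<in> U"
proof -
  have "\<exists>C. C \<in> A \<and> p \<in> fst C" using assms(1) by (force simp: mcarrier_def)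
  then have "chart_at A p \<in> A \<and> p \<in> fst (chart_at A p)" unfolding chart_at_def by (rule someI_ex)
  then show "(U, \<psi>) \<in> A" "p \<in> U" by (simp_all add: assms(2))
qed

definition tangent_param ::
    "('p, 'e::euclidean_space) atlas \<Rightarrow> (real \<times> 'e) set \<Rightarrow> (real \<times> 'e \<Rightarrow> 'p) \<Rightarrow> real \<times> 'e \<times> 'e \<Rightarrow> 'p \<times> 'e" where
  "tangent_param B V \<Phi> = (\<lambda>(t, x, y). (\<Phi> (t, x),
     (let (U, \<psi>) = chart_at B (\<Phi> (t, x))
      in dir_deriv {z\<in>V. \<Phi> z \<in> U} (\<lambda>z. \<psi> (\<Phi> z)) (t, x) (1, y))))"

definition path_jet :: "'e::euclidean_space smooth_curve \<Rightarrow> ('e \<times> 'e) smooth_curve" where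
  "path_jet q = curve_of (\<lambda>t. (curve_at q t, path_deriv (curve_at q) t))"

lemma curve_at_path_jet:
  "t \<in> {0..1} \<Longrightarrow> curve_at (path_jet q) t = (curve_at q t, path_deriv (curve_at q) t)"
proof -
  have "smooth_path_on {0..1} (\<lambda>t. (curve_at q t, path_deriv (curve_at q) t))"
    using smooth_path_on_curve_at[of q] smooth_path_on_nth_deriv[OF smooth_path_on_curve_at[of q], of 1]
    unfolding smooth_path_on_unit_interval_iff by (simp add: smooth_in_Pair)
  then show "t \<in> {0..1} \<Longrightarrow> ?thesis" by (simp add: path_jet_def curve_at_curve_of)
qed

text \<open>An affine line of curves goes to an affine line, so a directional derivative of \<alpha>
  in the prolonged chart is directly one of \<alpha> after the velocity map.\<close>

lemma path_jet_linear: "path_jet (q + s *\<^sub>R \<xi>) = path_jet q + s *\<^sub>R path_jet \<xi>"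
proof (rule curve_eqI)
  fix t
  show "curve_at (path_jet (q + s *\<^sub>R \<xi>)) t = curve_at (path_jet q + s *\<^sub>R path_jet \<xi>) t"
  proof (cases "t \<in> {0..1}")
    case True
    have "curve_at (q + s *\<^sub>R \<xi>) = (\<lambda>t. 1 *\<^sub>R curve_at q t + s *\<^sub>R curve_at \<xi> t)"
      by (simp add: fun_eq_iff curve_at_ops)
    then have "path_deriv (curve_at (q + s *\<^sub>R \<xi>)) t =
        path_deriv (curve_at q) t + s *\<^sub>R path_deriv (curve_at \<xi>) t"
      using nth_deriv_linear_combination(1)[OF smooth_path_on_curve_at[of q] smooth_path_on_curve_at[of \<xi>] True, of "Suc 0" 1 s]
      by (simp only: scaleR_one)
    then show ?thesis using True by (simp add: curve_at_path_jet curve_at_ops del: nth_deriv.simps)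
  qed (simp add: curve_at_outside)
qed

lemma path_jet_in_domain_iff:
  "path_jet q \<in> curve_chart_domain (tangent_set V) \<longleftrightarrow> q \<in> curve_chart_domain V"
  by (simp add: curve_chart_domain_def tangent_set_def curve_at_path_jet del: nth_deriv.simps atLeastAtMost_iff)

text \<open>Reconciles limits within a chart domain, as in \<open>bastiani_smooth_on\<close>, with
  the derivative within \<open>UNIV\<close> in \<open>curve_tangent_map\<close>.\<close>

lemma at_within_eventually:
  assumes "\<forall>\<^sub>F s in at a. s \<in> S"
  shows "at a within S = at a"
proof (rule antisym)
  show "at a \<le> at a within S"
  proof (rule filter_leI)
    fix P assume "eventually P (at a within S)"
    then have "\<forall>\<^sub>F s in at a. s \<in> S \<longrightarrow> P s" by (auto simp: eventually_at_filter elim: eventually_mono)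
    with assms show "eventually P (at a)" by eventually_elim blast
  qed
qed (rule at_le, simp)

context
  fixes B :: "('p, 'e::euclidean_space) atlas" and V :: "(real \<times> 'e) set" and \<Phi> :: "real \<times> 'e \<Rightarrow> 'p"
  assumes B: "smooth_manifold B" and chart: "curve_chart B V \<Phi>"
begin

private abbreviation W where "W U \<equiv> {z\<in>V. \<Phi> z \<in> U}"

lemma curve_chart_V: "openin (top_of_set slab) V" "\<Phi> ` V \<subseteq> mcarrier B"
    "inj_on (\<lambda>(t, x). (t, \<Phi> (t, x))) V"
  using chart by (auto simp: curve_chart_def)

lemma curve_chart_local:
  assumes "(U, \<psi>) \<in> B"
  defines "F \<equiv> \<lambda>(t, x). (t, \<psi> (\<Phi> (t, x)))"
  shows "openin (top_of_set slab) (W U)" "openin (top_of_set slab) (F ` W U)"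
    "bastiani_smooth_on (W U) F" "bastiani_smooth_on (F ` W U) (inv_into (W U) F)"
    "inj_on F (W U)" "smooth_in (W U) (\<lambda>z. \<psi> (\<Phi> z))"
proof -
  show *: "openin (top_of_set slab) (W U)" "openin (top_of_set slab) (F ` W U)"
    "bastiani_smooth_on (W U) F" "bastiani_smooth_on (F ` W U) (inv_into (W U) F)"
    using chart assms(1) unfolding curve_chart_def F_def Let_def by blast+
  have "inj_on \<psi> U" using B assms(1) by (auto simp: smooth_manifold_def)
  then show "inj_on F (W U)"
    using curve_chart_V(3) unfolding inj_on_def F_def by fastforce
  have "smooth_in (W U) F"
    by (rule bastiani_smooth_on_imp_smooth_in[OF dir_domain_slab *(1,3)])
  then show "smooth_in (W U) (\<lambda>z. \<psi> (\<Phi> z))"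
    by (rule smooth_in_cong[OF _ smooth_in_linear_comp[OF bounded_linear_snd], rotated]) (auto simp: F_def)
qed

text \<open>Chain rule for the chart transition. The two derivatives are taken within different
  sets, so they are compared on the overlap, which is relatively open in the slab and hence still
  determines them.\<close>

lemma dir_deriv_change_of_chart:
  assumes U: "(U, \<psi>) \<in> B" and U': "(U', \<psi>') \<in> B" and z: "z \<in> V" "\<Phi> z \<in> U" "\<Phi> z \<in> U'"
  shows "dir_deriv (\<psi> ` (U' \<inter> U)) (\<psi>' \<circ> inv_into U \<psi>) (\<psi> (\<Phi> z)) (dir_deriv (W U) (\<lambda>z. \<psi> (\<Phi> z)) z v) =
    dir_deriv (W U') (\<lambda>z. \<psi>' (\<Phi> z)) z v"
proof -
  let ?N = "\<psi> ` (U' \<inter> U)" and ?W = "W U \<inter> W U'" and ?\<tau> = "\<psi>' \<circ> inv_into U \<psi>"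
  have tr: "smooth_transition (U, \<psi>) (U', \<psi>')" and inj: "inj_on \<psi> U"
    using B U U' by (auto simp: smooth_manifold_def)
  have N: "openin (top_of_set UNIV) ?N" and "bastiani_smooth_on ?N ?\<tau>"
    using tr by (simp_all add: smooth_transition_def Int_commute)
  then have \<tau>: "smooth_in ?N ?\<tau>" by (rule_tac bastiani_smooth_on_imp_smooth_in[OF dir_domain_UNIV])
  note loc = curve_chart_local[OF U] and loc' = curve_chart_local[OF U']
  have Wo: "openin (top_of_set slab) ?W" by (rule openin_Int[OF loc(1) loc'(1)])
  have zW: "z \<in> ?W" using z by auto
  have 1: "((\<lambda>z. \<psi> (\<Phi> z)) has_derivative dir_deriv (W U) (\<lambda>z. \<psi> (\<Phi> z)) z) (at z within ?W)"
    by (rule has_derivative_subset[OF smooth_in_has_derivative_dir_deriv[OF dir_domain_slab loc(1) loc(6)]])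
       (use zW in auto)
  have 2: "(?\<tau> has_derivative dir_deriv ?N ?\<tau> (\<psi> (\<Phi> z))) (at (\<psi> (\<Phi> z)) within (\<lambda>z. \<psi> (\<Phi> z)) ` ?W)"
    by (rule has_derivative_subset[OF smooth_in_has_derivative_dir_deriv[OF dir_domain_UNIV N \<tau>]])
       (use zW in auto)
  have "((\<lambda>z. ?\<tau> (\<psi> (\<Phi> z))) has_derivative
      (\<lambda>v. dir_deriv ?N ?\<tau> (\<psi> (\<Phi> z)) (dir_deriv (W U) (\<lambda>z. \<psi> (\<Phi> z)) z v))) (at z within ?W)"
    by (rule has_derivative_in_compose[OF 1 2])
  then have "((\<lambda>z. \<psi>' (\<Phi> z)) has_derivative
      (\<lambda>v. dir_deriv ?N ?\<tau> (\<psi> (\<Phi> z)) (dir_deriv (W U) (\<lambda>z. \<psi> (\<Phi> z)) z v))) (at z within ?W)"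
    by (rule has_derivative_transform[OF zW, rotated]) (simp add: inv_into_f_f[OF inj])
  note E1 = has_derivative_imp_dir_deriv[OF dir_domain_slab Wo zW this, of v]
  have "((\<lambda>z. \<psi>' (\<Phi> z)) has_derivative dir_deriv (W U') (\<lambda>z. \<psi>' (\<Phi> z)) z) (at z within ?W)"
    by (rule has_derivative_subset[OF smooth_in_has_derivative_dir_deriv[OF dir_domain_slab loc'(1) loc'(6)]])
       (use zW in auto)
  from has_derivative_imp_dir_deriv[OF dir_domain_slab Wo zW this, of v] E1 show ?thesis by simp
qed


text \<open>The preferred chart \<open>chart_at B\<close> may jump from point to point, so
  smoothness of \<open>tangent_param\<close> is not visible from its formula. Passing to a tangent
  chart cancels this choice and leaves a jet map.\<close>

lemma tangent_chart_tangent_param: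
  assumes U': "(U', \<psi>') \<in> B" and z: "(t, x, y) \<in> tangent_set (W U')"
  shows "(t, snd (tangent_chart B (U', \<psi>')) (tangent_param B V \<Phi> (t, x, y))) =
    jet_map (W U') (\<lambda>z. \<psi>' (\<Phi> z)) (t, x, y)"
proof -
  have z: "(t, x) \<in> V" "\<Phi> (t, x) \<in> U'" using z by (auto simp: tangent_set_def)
  have p: "\<Phi> (t, x) \<in> mcarrier B" using curve_chart_V(2) z by blast
  obtain U \<psi> where U: "chart_at B (\<Phi> (t, x)) = (U, \<psi>)" by fastforce
  note C = chart_at_in_atlas[OF p U]
  show ?thesis
    using dir_deriv_change_of_chart[OF C(1) U' z(1) C(2) z(2), of "(1, y)"]
    by (simp add: tangent_chart_def tangent_param_def jet_map_def U)
qed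

text \<open>Smoothness of \<alpha> is expressed in charts for \<open>tangent_atlas B\<close>; this
  provides the one in which velocities are described by \<open>path_jet\<close>. Seen in a tangent
  chart it is a jet map, so \<open>jet_map_diffeomorphism\<close> supplies the local
  conditions.\<close>

lemma curve_chart_tangent_param: "curve_chart (tangent_atlas B) (tangent_set V) (tangent_param B V \<Phi>)"
  unfolding curve_chart_def
proof (intro conjI)
  show "openin (top_of_set slab) (tangent_set V)"
    by (rule openin_tangent_set[OF curve_chart_V(1)])
  show "tangent_param B V \<Phi> ` tangent_set V \<subseteq> mcarrier (tangent_atlas B)"
  proof (clarify, goal_cases)
    case (1 q y t x y')
    then have "\<Phi> (t, x) \<in> mcarrier B" using curve_chart_V(2) by (auto simp: tangent_set_def)
    then obtain U \<psi> where "(U, \<psi>) \<in> B" "\<Phi> (t, x) \<in> U" by (auto simp: mcarrier_def)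
    then show ?case
      using 1 by (force simp: mcarrier_def tangent_atlas_def tangent_chart_def tangent_param_def)
  qed
  show "inj_on (\<lambda>(t, p). (t, tangent_param B V \<Phi> (t, p))) (tangent_set V)"
  proof (rule inj_onI)
    fix p p'
    assume pp: "p \<in> tangent_set V" "p' \<in> tangent_set V"
      "(\<lambda>(t, p). (t, tangent_param B V \<Phi> (t, p))) p = (\<lambda>(t, p). (t, tangent_param B V \<Phi> (t, p))) p'"
    obtain t x y t' x' y' where p_eq: "p = (t, x, y)" "p' = (t', x', y')"
      using prod_cases3 by metis
    have t: "t' = t" using pp(3) by (simp add: p_eq)
    have z: "(t, x, y) \<in> tangent_set V" "(t, x', y') \<in> tangent_set V"
      and eq: "tangent_param B V \<Phi> (t, x, y) = tangent_param B V \<Phi> (t, x', y')"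
      using pp by (simp_all add: p_eq t)
    have tx: "(t, x) \<in> V" "(t, x') \<in> V" using z by (auto simp: tangent_set_def)
    have "\<Phi> (t, x) = \<Phi> (t, x')" using eq by (simp add: tangent_param_def)
    then have x: "x = x'" using curve_chart_V(3) tx by (auto simp: inj_on_def)
    obtain U \<psi> where U: "chart_at B (\<Phi> (t, x)) = (U, \<psi>)" by fastforce
    note C = chart_at_in_atlas[OF _ U]
    have mem: "\<Phi> (t, x) \<in> mcarrier B" using curve_chart_V(2) tx by blast
    \<comment> \<open>Equal base points select the same preferred chart, so the vector components
      can be compared through one injective jet map.\<close>
    have "jet_map (W U) (\<lambda>z. \<psi> (\<Phi> z)) (t, x, y) = jet_map (W U) (\<lambda>z. \<psi> (\<Phi> z)) (t, x, y')"
      using eq by (simp add: tangent_param_def jet_map_def U flip: x)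
    moreover have "(t, x, y) \<in> tangent_set (W U)" "(t, x, y') \<in> tangent_set (W U)"
      using tx C(2)[OF mem] by (auto simp: tangent_set_def)
    ultimately have "(t, x, y) = (t, x, y')"
      using jet_map_diffeomorphism(2)[OF curve_chart_local(1,5,2-4)[OF C(1)[OF mem]]]
      by (blast dest: inj_onD)
    then show "p = p'" using x t by (simp add: p_eq)
  qed
  show "\<forall>Z\<in>tangent_atlas B. case Z of (U, \<psi>) \<Rightarrow>
      let Y = {z \<in> tangent_set V. tangent_param B V \<Phi> z \<in> U};
          F = \<lambda>(t, x). (t, \<psi> (tangent_param B V \<Phi> (t, x)))
      in openin (top_of_set slab) Y \<and> openin (top_of_set slab) (F ` Y) \<and>
         bastiani_smooth_on Y F \<and> bastiani_smooth_on (F ` Y) (inv_into Y F)" (is "\<forall>Z\<in>_. ?G Z")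
  proof
  fix Z assume "Z \<in> tangent_atlas B"
  then obtain U \<psi> where U: "(U, \<psi>) \<in> B" and Z: "Z = tangent_chart B (U, \<psi>)"
    by (auto simp: tangent_atlas_def)
  define \<kappa> where "\<kappa> = snd (tangent_chart B (U, \<psi>))"
  have Z: "Z = (U \<times> UNIV, \<kappa>)" by (simp add: Z \<kappa>_def tangent_chart_def)
  let ?F = "\<lambda>(t, p). (t, \<kappa> (tangent_param B V \<Phi> (t, p)))" and ?J = "jet_map (W U) (\<lambda>z. \<psi> (\<Phi> z))"
  let ?T = "tangent_set (W U)"
  have T: "{z \<in> tangent_set V. tangent_param B V \<Phi> z \<in> U \<times> UNIV} = ?T"
    by (auto simp: tangent_set_def tangent_param_def)
  have F: "?F z = ?J z" if "z \<in> ?T" for z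
    using that tangent_chart_tangent_param[OF U] by (cases z) (simp add: \<kappa>_def)
  note D = jet_map_diffeomorphism[OF curve_chart_local(1,5,2-4)[OF U]]
  have To: "openin (top_of_set slab) ?T" by (rule openin_tangent_set[OF curve_chart_local(1)[OF U]])
  have im: "?F ` ?T = ?J ` ?T" by (rule image_cong[OF refl F])
  have "inv_into ?T ?F = inv_into ?T ?J"
    unfolding inv_into_def by (intro ext arg_cong[where f = Eps] conj_cong refl) (simp only: F)
  moreover have "bastiani_smooth_on ?T ?F"
    by (rule smooth_in_imp_bastiani_smooth_on[OF dir_domain_slab To smooth_in_cong[OF F[symmetric] D(1)]])
  moreover have "bastiani_smooth_on (?J ` ?T) (inv_into ?T ?J)"
    by (rule smooth_in_imp_bastiani_smooth_on[OF dir_domain_slab D(3,4)])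
  ultimately have "?G (U \<times> UNIV, \<kappa>)"
    unfolding prod.case Let_def T im using To D(3) by simp
  then show "?G Z" by (simp only: Z)
  qed
qed

lemma velocity_curve_param:
  assumes q: "q \<in> curve_chart_domain V"
  shows "velocity B (curve_param \<Phi> q) = curve_param (tangent_param B V \<Phi>) (path_jet q)"
proof
  fix t
  show "velocity B (curve_param \<Phi> q) t = curve_param (tangent_param B V \<Phi>) (path_jet q) t"
  proof (cases "t \<in> {0..1}")
    case t: True
    define \<gamma> where "\<gamma> s = (s, curve_at q s)" for s
    have V: "\<gamma> s \<in> V" if "s \<in> {0..1}" for s
      using q that by (simp add: curve_chart_domain_def \<gamma>_def)
    obtain U \<psi> where U: "chart_at B (\<Phi> (\<gamma> t)) = (U, \<psi>)" by fastforce
    have p: "\<Phi> (\<gamma> t) \<in> mcarrier B" using curve_chart_V(2) V[OF t] by blast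
    note C = chart_at_in_atlas[OF p U]
    note loc = curve_chart_local[OF C(1)]
    let ?f = "\<lambda>z. \<psi> (\<Phi> z)"
    obtain N where N: "open N" "W U = slab \<inter> N" using loc(1) by (auto simp: openin_open)
    have "(curve_at q has_vector_derivative path_deriv (curve_at q) t) (at t within {0..1})"
      using smooth_path_on_has_vector_derivative[OF smooth_path_on_curve_at[of q] t, of 0] by simp
    then have \<gamma>: "(\<gamma> has_vector_derivative (1, path_deriv (curve_at q) t)) (at t within {0..1})"
      unfolding \<gamma>_def by (intro has_vector_derivative_Pair has_vector_derivative_id)
    then have "continuous_on {0..1} \<gamma>"
      unfolding \<gamma>_def using smooth_path_on_continuous_on[OF smooth_path_on_curve_at[of q], of 0]
      by (auto intro!: continuous_intros)
    then have "openin (top_of_set {0..1}) ({0..1} \<inter> \<gamma> -` N)"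
      using N(1) by (rule continuous_openin_preimage_gen)
    then obtain O' where O': "open O'" "{0..1} \<inter> \<gamma> -` N = {0..1} \<inter> O'"
      by (auto simp: openin_open)
    \<comment> \<open>\<open>S\<close> contains the times at which the path lies in the chart domain
      \<open>U\<close>. It is relatively open, so derivatives at \<open>t\<close> within
      \<open>{0..1}\<close> and within \<open>S\<close> agree.\<close>
    define S where "S = {0..1} \<inter> \<gamma> -` N"
    have tS: "t \<in> S" using t V[OF t] C(2) N(2) by (auto simp: S_def)
    have S: "at t within {0..1} = at t within S"
      by (rule at_within_nhd[of _ O']) (use tS O' in \<open>auto simp: S_def\<close>)
    have \<gamma>S: "\<gamma> ` S \<subseteq> W U" unfolding N(2) by (auto simp: S_def \<gamma>_def)
    have "(?f has_derivative dir_deriv (W U) ?f (\<gamma> t)) (at (\<gamma> t) within \<gamma> ` S)"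
      by (rule has_derivative_subset[OF smooth_in_has_derivative_dir_deriv[OF dir_domain_slab loc(1,6)] \<gamma>S])
         (use \<gamma>S tS in blast)
    then have "((?f \<circ> \<gamma>) has_vector_derivative dir_deriv (W U) ?f (\<gamma> t) (1, path_deriv (curve_at q) t))
        (at t within S)"
      by (rule vector_derivative_diff_chain_within[OF \<gamma>[unfolded S]])
    then have "((\<psi> \<circ> curve_param \<Phi> q) has_vector_derivative
        dir_deriv (W U) ?f (\<gamma> t) (1, path_deriv (curve_at q) t)) (at t within S)"
      by (rule has_vector_derivative_transform[OF tS, rotated])
         (auto simp: S_def curve_param_def \<gamma>_def)
    from vector_derivative_within[OF at_within_unit_interval[OF t] this[folded S]]
    have "vector_derivative (\<psi> \<circ> curve_param \<Phi> q) (at t within {0..1}) =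
        dir_deriv (W U) ?f (\<gamma> t) (1, path_deriv (curve_at q) t)" .
    then show ?thesis
      using t U by (simp add: velocity_def curve_param_def curve_at_path_jet tangent_param_def \<gamma>_def
          del: nth_deriv.simps atLeastAtMost_iff)
  next
    case False
    then show ?thesis unfolding velocity_def curve_param_def restrict_def by (simp only: if_False)
  qed
qed

text \<open>The graph of \<open>q\<close> is compact, so a tube of some radius \<open>e\<close>
  around it stays in the open set \<open>N\<close>; a bound \<open>M\<close> for \<xi> keeps the
  perturbed graph in the tube for \<open>\<bar>s\<bar> < e / M\<close>.\<close>

lemma eventually_in_curve_chart_domain:
  assumes q: "q \<in> curve_chart_domain V"
  shows "\<forall>\<^sub>F s in at 0. q + s *\<^sub>R \<xi> \<in> curve_chart_domain V"
proof -
  obtain N where N: "open N" "V = slab \<inter> N" using curve_chart_V(1) by (auto simp: openin_open)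
  let ?K = "(\<lambda>t. (t, curve_at q t)) ` {0..1}"
  have cont: "continuous_on {0..1} (curve_at p)" for p :: "'e smooth_curve"
    using smooth_path_on_continuous_on[OF smooth_path_on_curve_at[of p], of 0] by simp
  have "compact ?K" by (intro compact_continuous_image continuous_intros cont) simp
  moreover have "?K \<subseteq> N" using q N(2) by (auto simp: curve_chart_domain_def)
  ultimately obtain e where e: "e > 0" "(\<Union>x\<in>?K. ball x e) \<subseteq> N"
    using compact_subset_open_imp_ball_epsilon_subset N(1) by metis
  have "compact (curve_at \<xi> ` {0..1})" by (intro compact_continuous_image cont) simp
  then obtain M where M: "M > 0" "\<And>t. t \<in> {0..1} \<Longrightarrow> norm (curve_at \<xi> t) \<le> M"
    using compact_imp_bounded bounded_pos by (metis imageI)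
  have "\<forall>\<^sub>F s in at 0. \<bar>s\<bar> < e / M"
    using e(1) M(1) by (auto simp: eventually_at intro!: exI[of _ "e / M"])
  then show ?thesis
  proof eventually_elim
    case (elim s)
    show ?case
      unfolding curve_chart_domain_def
    proof (clarify, goal_cases)
      case (1 t)
      have "\<bar>s\<bar> * norm (curve_at \<xi> t) \<le> \<bar>s\<bar> * M" using M(2) 1 by (intro mult_left_mono) auto
      also have "\<dots> < e" using elim M(1) by (simp add: field_simps)
      finally have "(t, curve_at (q + s *\<^sub>R \<xi>) t) \<in> ball (t, curve_at q t) e"
        by (simp add: dist_Pair_Pair dist_norm curve_at_ops)
      then have "(t, curve_at (q + s *\<^sub>R \<xi>) t) \<in> N" using e(2) 1 by blast
      then show ?case using 1 N(2) by simp
    qed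
  qed
qed

lemma velocity_difference_quotient:
  fixes \<alpha> :: "(real \<Rightarrow> 'p \<times> 'e) \<Rightarrow> 'f::{real_vector,t2_space}"
  assumes \<alpha>: "smooth_on_curves (tangent_atlas B) \<alpha>" and q: "q \<in> curve_chart_domain V"
  obtains l where "((\<lambda>s. (\<alpha> (velocity B (curve_param \<Phi> (q + s *\<^sub>R \<xi>))) -
      \<alpha> (velocity B (curve_param \<Phi> q))) /\<^sub>R s) \<longlongrightarrow> l) (at 0)"
proof -
  let ?V = "curve_chart_domain (tangent_set V)" and ?f = "\<alpha> \<circ> curve_param (tangent_param B V \<Phi>)"
  have "bastiani_smooth_on ?V ?f"
    using \<alpha> curve_chart_tangent_param unfolding smooth_on_curves_def by blast
  \<comment> \<open>The clause \<open>k = 0\<close> of smoothness gives a derivative of the map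
    itself; the constant sequence supplies the direction.\<close>
  then have "\<exists>l. has_dir_deriv ?V (iter_dir_deriv ?V ?f 0 (\<lambda>_. path_jet \<xi>)) (path_jet q) (path_jet \<xi>) l"
    using path_jet_in_domain_iff[of q V] q unfolding bastiani_smooth_on_def by blast
  then obtain l where l: "has_dir_deriv ?V ?f (path_jet q) (path_jet \<xi>) l" by auto
  let ?S = "{s. q + s *\<^sub>R \<xi> \<in> curve_chart_domain V}"
  have "((\<lambda>s. (\<alpha> (velocity B (curve_param \<Phi> (q + s *\<^sub>R \<xi>))) -
      \<alpha> (velocity B (curve_param \<Phi> q))) /\<^sub>R s) \<longlongrightarrow> l) (at 0 within ?S)"
    using l unfolding has_dir_deriv_def path_jet_linear[symmetric] path_jet_in_domain_iff
    by (rule Lim_transform_eventually)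
       (auto simp: eventually_at_filter velocity_curve_param q)
  moreover have "at 0 within ?S = at 0"
    by (rule at_within_eventually) (use eventually_in_curve_chart_domain[OF q] in simp)
  ultimately show ?thesis using that by simp
qed

end

section \<open>The pullback metric\<close>

text \<open>
  The same representative of \<open>(c, v)\<close> is chosen for both tangent maps. If there is none, both are
  \<open>0\<close> and the formula still holds.
\<close>

lemma curve_tangent_map_srvt:
  fixes B :: "('p, 'm::euclidean_space) atlas" and ip :: "'e::euclidean_space \<Rightarrow> 'e \<Rightarrow> real"
    and \<alpha> :: "(real \<Rightarrow> 'p \<times> 'm) \<Rightarrow> 'e smooth_curve" and v :: "real \<Rightarrow> 'p \<times> 'm"
    and c t
  assumes B: "smooth_manifold B" and ip: "inner_product ip"
    and \<alpha>: "smooth_on_curves (tangent_atlas B) \<alpha>"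
    and nz: "\<And>t. t \<in> {0..1} \<Longrightarrow> curve_at (\<alpha> (velocity B c)) t \<noteq> 0"
    and t: "t \<in> {0..1}"
  defines "x \<equiv> curve_at (\<alpha> (velocity B c)) t"
    and "h \<equiv> curve_at (curve_tangent_map B (\<alpha> \<circ> velocity B) c v) t"
  shows "curve_at (curve_tangent_map B (srvt B ip \<alpha>) c v) t =
    (h - (1 / 2 * ip h (x /\<^sub>R ip_norm ip x)) *\<^sub>R (x /\<^sub>R ip_norm ip x)) /\<^sub>R sqrt (ip_norm ip x)"
proof (cases "\<exists>V \<Phi> q \<xi>. represents_tangent B c v V \<Phi> q \<xi>")
  case False
  then have "curve_tangent_map B f c v = 0" for f :: "(real \<Rightarrow> 'p) \<Rightarrow> 'e smooth_curve"
    unfolding curve_tangent_map_def by (rule if_not_P)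
  then show ?thesis by (simp add: h_def curve_at_ops ip_algebra[OF ip])
next
  case True
  obtain V \<Phi> q \<xi> where some: "(SOME (V, \<Phi>, q, \<xi>). represents_tangent B c v V \<Phi> q \<xi>) = (V, \<Phi>, q, \<xi>)"
    using prod_cases4 by blast
  have "\<exists>z. case z of (V, \<Phi>, q, \<xi>) \<Rightarrow> represents_tangent B c v V \<Phi> q \<xi>" using True by auto
  from someI_ex[OF this] have "represents_tangent B c v V \<Phi> q \<xi>" unfolding some by simp
  then have chart: "curve_chart B V \<Phi>" and q: "q \<in> curve_chart_domain V" and c: "curve_param \<Phi> q = c"
    by (auto simp: represents_tangent_def)
  have tm: "curve_tangent_map B f c v = dir_deriv UNIV (f \<circ> curve_param \<Phi>) q \<xi>"
    for f :: "(real \<Rightarrow> 'p) \<Rightarrow> 'e smooth_curve"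
    using True unfolding curve_tangent_map_def some by simp
  define X where "X s = \<alpha> (velocity B (curve_param \<Phi> (q + s *\<^sub>R \<xi>)))" for s
  have X0: "X 0 = \<alpha> (velocity B c)" by (simp add: X_def c)
  obtain l where l: "((\<lambda>s. (X s - X 0) /\<^sub>R s) \<longlongrightarrow> l) (at 0)"
    using velocity_difference_quotient[OF B chart \<alpha> q, of \<xi>] unfolding X_def by auto
  have "curve_tangent_map B (\<alpha> \<circ> velocity B) c v = l"
    unfolding tm dir_deriv_def using l by (intro tendsto_Lim) (auto simp: X_def)
  then have h: "h = curve_at l t" by (simp add: h_def)
  have nz': "\<And>t. t \<in> {0..1} \<Longrightarrow> curve_at (X 0) t \<noteq> 0" using nz by (simp add: X0)
  have srv: "curve_tangent_map B (srvt B ip \<alpha>) c v =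
      curve_of (\<lambda>t. srv_quotient ip (curve_at (X 0) t, curve_at (X 0) t, curve_at l t))"
    unfolding tm dir_deriv_def using tendsto_srv_quotient(1)[OF ip nz' l]
    by (intro tendsto_Lim) (auto simp: X_def srvt_def Let_def)
  have "curve_at (curve_tangent_map B (srvt B ip \<alpha>) c v) t =
      srv_quotient ip (curve_at (X 0) t, curve_at (X 0) t, curve_at l t)"
    unfolding srv by (rule tendsto_srv_quotient(2)[OF ip _ l t]) (rule nz')
  then have "curve_at (curve_tangent_map B (srvt B ip \<alpha>) c v) t = srv_quotient ip (x, x, h)"
    by (simp only: h x_def X0)
  also have "\<dots> = (h - (1 / 2 * ip h (x /\<^sub>R ip_norm ip x)) *\<^sub>R (x /\<^sub>R ip_norm ip x)) /\<^sub>R sqrt (ip_norm ip x)"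
    by (rule srv_quotient_diagonal[OF ip]) (use nz[OF t] in \<open>simp add: x_def\<close>)
  finally show ?thesis .
qed

text \<open>As \<open>u\<close> is a unit vector, both sides equal
  \<open>(ip h k - 3 / 4 * a * b) / r\<close> with \<open>a = ip h u\<close> and
  \<open>b = ip k u\<close>: the 3/4 arises as 1/2 + 1/2 - 1/4 on the left and as 1 - 1/4 on the
  right. The final factor \<open>r\<close> is the density of \<open>ds\<close>.\<close>

lemma srv_metric_pointwise:
  fixes ip :: "'e::euclidean_space \<Rightarrow> 'e \<Rightarrow> real"
  assumes ip: "inner_product ip" and x: "x \<noteq> 0"
  defines "r \<equiv> ip_norm ip x"
  defines "u \<equiv> x /\<^sub>R r"
  shows "ip ((h - (1 / 2 * ip h u) *\<^sub>R u) /\<^sub>R sqrt r) ((k - (1 / 2 * ip k u) *\<^sub>R u) /\<^sub>R sqrt r) =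
    (1 / 4 * ip (h /\<^sub>R r) u * ip (k /\<^sub>R r) u +
     ip (h /\<^sub>R r - ip (h /\<^sub>R r) u *\<^sub>R u) (k /\<^sub>R r - ip (k /\<^sub>R r) u *\<^sub>R u)) * r"
proof -
  have r: "r > 0" "r\<^sup>2 = ip x x" using ip_pos[OF ip x] by (auto simp: r_def ip_norm_def)
  have uu: "ip u u = 1"
    using r(1) by (simp add: u_def ip_algebra[OF ip] power2_eq_square field_simps flip: r(2))
  define a b where "a = ip h u" and "b = ip k u"
  have sym: "ip u k = b" by (simp add: b_def ip_sym[OF ip])
  have core: "ip (h - c *\<^sub>R u) (k - d *\<^sub>R u) = ip h k - d * a - c * b + c * d" for c d
    by (simp add: ip_algebra[OF ip] uu sym algebra_simps flip: a_def)
  have scale: "ip (y /\<^sub>R s) (z /\<^sub>R s) = ip y z / (s * s)" for y z s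
    by (simp add: ip_algebra[OF ip] divide_inverse mult_ac)
  have "ip ((h - (1 / 2 * a) *\<^sub>R u) /\<^sub>R sqrt r) ((k - (1 / 2 * b) *\<^sub>R u) /\<^sub>R sqrt r) =
      (ip h k - 3 / 4 * a * b) / r"
    unfolding scale core using r(1) by (simp add: field_simps)
  also have "\<dots> = (1 / 4 * (a / r) * (b / r) + ip (h - a *\<^sub>R u) (k - b *\<^sub>R u) / (r * r)) * r"
    unfolding core using r(1) by (simp add: field_simps)
  also have "ip (h - a *\<^sub>R u) (k - b *\<^sub>R u) / (r * r) =
      ip (h /\<^sub>R r - (a / r) *\<^sub>R u) (k /\<^sub>R r - (b / r) *\<^sub>R u)"
    unfolding scale[symmetric] by (simp add: scaleR_diff_right divide_inverse mult.commute)
  also have "a / r = ip (h /\<^sub>R r) u"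
    by (simp add: a_def ip_algebra[OF ip] divide_inverse)
  also have "b / r = ip (k /\<^sub>R r) u"
    by (simp add: b_def ip_algebra[OF ip] divide_inverse)
  finally show ?thesis unfolding a_def b_def .
qed

theorem theorem11:
  fixes G :: "('g, 'z) monoid_scheme"
    and A :: "('g, 'e::euclidean_space) atlas"
    and H :: "'g set"
    and B :: "('g set, 'm::euclidean_space) atlas"
    and ip :: "'e \<Rightarrow> 'e \<Rightarrow> real"
    and c0 :: "'g set"
    and \<alpha> :: "(real \<Rightarrow> 'g set \<times> 'm) \<Rightarrow> 'e smooth_curve"
    and c :: "real \<Rightarrow> 'g set"
    and v w :: "real \<Rightarrow> 'g set \<times> 'm"
  assumes "lie_group G A"
    and "closed_lie_subgroup G A H"
    and "homogeneous_space G A H B"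
    and "inner_product ip"
    and "c0 \<in> mcarrier B"
    and "smooth_on_curves (tangent_atlas B) \<alpha>"
    and "\<forall>k\<in>curves_from B c0. rho G A c0 (\<alpha> (velocity B k)) = k"
    and "\<forall>k\<in>immersions_from B c0. \<forall>t\<in>{0..1}. curve_at (\<alpha> (velocity B k)) t \<noteq> 0"
    and "c \<in> immersions_from B c0"
    and "v \<in> tangent_space_immersions_from B c"
    and "w \<in> tangent_space_immersions_from B c"
  shows
    "let q = curve_at (\<alpha> (velocity B c));
         u = (\<lambda>t. q t /\<^sub>R ip_norm ip (q t));
         Ds = (\<lambda>v t. curve_at (curve_tangent_map B (\<alpha> \<circ> velocity B) c v) t /\<^sub>R ip_norm ip (q t))
     in pullback_L2 B ip (srvt B ip \<alpha>) c v w =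
          integral {0..1} (\<lambda>t.
            (1/4 * ip (Ds v t) (u t) * ip (Ds w t) (u t) +
             ip (Ds v t - ip (Ds v t) (u t) *\<^sub>R u t) (Ds w t - ip (Ds w t) (u t) *\<^sub>R u t))
            * ip_norm ip (q t)) \<and>
        pullback_L2 B ip (srvt B ip \<alpha>) c v v =
          integral {0..1} (\<lambda>t.
            (1/4 * (ip (Ds v t) (u t))\<^sup>2 +
             (ip_norm ip (Ds v t - ip (Ds v t) (u t) *\<^sub>R u t))\<^sup>2)
            * ip_norm ip (q t))"
proof -
  let ?q = "curve_at (\<alpha> (velocity B c))"
  let ?Ds = "\<lambda>v t. curve_at (curve_tangent_map B (\<alpha> \<circ> velocity B) c v) t /\<^sub>R ip_norm ip (?q t)"
  let ?u = "\<lambda>t. ?q t /\<^sub>R ip_norm ip (?q t)"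
  have B: "smooth_manifold B" using assms(3) by (simp add: homogeneous_space_def)
  note ip = assms(4)
  have nz: "\<And>t. t \<in> {0..1} \<Longrightarrow> ?q t \<noteq> 0" using assms(8,9) by blast
  \<comment> \<open>The integrands agree at every \<open>t\<close> in \<open>[0,1]\<close>, so no
    integrability is involved. The statement covers all pairs, and the norm formula is its diagonal
    case.\<close>
  have metric: "pullback_L2 B ip (srvt B ip \<alpha>) c v w =
      integral {0..1} (\<lambda>t. (1/4 * ip (?Ds v t) (?u t) * ip (?Ds w t) (?u t) +
        ip (?Ds v t - ip (?Ds v t) (?u t) *\<^sub>R ?u t) (?Ds w t - ip (?Ds w t) (?u t) *\<^sub>R ?u t))
        * ip_norm ip (?q t))" for v w
    unfolding pullback_L2_def L2_metric_def
    by (intro integral_cong)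
       (simp only: curve_tangent_map_srvt[OF B ip assms(6) nz] srv_metric_pointwise[OF ip nz])
  \<comment> \<open>\<open>inner_product\<close> states positivity off the origin, so the origin is
    a separate case.\<close>
  have norm: "(ip_norm ip y)\<^sup>2 = ip y y" for y
    using ip_pos[OF ip, of y] by (cases "y = 0") (simp_all add: ip_norm_def ip_algebra[OF ip])
  show ?thesis
    unfolding Let_def norm using metric[of v w] metric[of v v]
    by (simp only: power2_eq_square mult.assoc simp_thms)
qed

end
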